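(* Let $\Omega$ be a domain in $\mathbb C^d$ containing $\mathbf 0$, let $p\ge 1$, and let $s_1,\ldots,s_p$ be normalized, irreducible, diagonal (holomorphic) complete Pick kernels on $\Omega$. (1) Let $k=s_1\circ\cdots\circ s_p$ be the Schur product, a kernel on $\Omega$. Then $1/s_{j,w}\in M(\mathcal H(k))$ for all $j=1,\ldots,p$ and $w\in\Omega$. Moreover, a bounded linear functional $\Lambda$ on $\mathcal H(k)$ with $\Lambda(1)=1$ is multiplicative if and only if $$\frac{1}{\Lambda(k_w)}=\prod_{j=1}^p\Lambda\Big(\frac1{s_{j,w}}\Big)\qquad\text{for all } w\in\Omega.$$ (2) Let $k=s_1\otimes\cdots\otimes s_p$ be the tensor product, a kernel on $\Omega^p=\Omega\times\cdots\times\Omega$. Then for all $j=1,\ldots,p$ and $w\in\Omega$ the function $(z_1,\ldots,z_p)\mapsto 1/s_{j,w}(z_j)$ on $\Omega^p$, again denoted $1/s_{j,w}$, belongs to $M(\mathcal H(k))$. Moreover, a bounded linear functional $\Lambda$ on $\mathcal H(k)$ with $\Lambda(1)=1$ is multiplicative if and only if $$\frac{1}{\Lambda(k_{w})}=\prod_{j=1}^p\Lambda\Big(\frac1{s_{j,w_j}}\Big)\qquad\text{for all } w=(w_1,\ldots,w_p)\in\Omega^p.$$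
   Context: Diagonal holomorphic kernel: a reproducing kernel $s$ on a domain $\Omega\subseteq\mathbb C^d$ containing $\mathbf 0$, holomorphic in the first variable and anti-holomorphic in the second, such that there are (strictly) positive numbers $\{a_\alpha\}_{\alpha\in\mathbb Z_+^d}$ for which the power series expansion of $s$ at $\mathbf 0$ is $s(z,w)=\sum_{\alpha\in\mathbb Z_+^d}a_\alpha z^\alpha\overline w^{\,\alpha}$. It is normalized if $a_{\mathbf 0}=1$. Irreducible: $s(z,w)\ne0$ for all $z,w\in\Omega$, and the kernel functions $s_z$ and $s_w$ are linearly independent whenever $z\neq w$. Complete Pick kernel: for all $N,m\in\mathbb N$, all points $z_1,\ldots,z_N\in\Omega$ and all contractive $m\times m$ matrices $W_1,\ldots,W_N$, positive semidefiniteness of the block matrix $[(I-W_iW_j^* )s(z_i,z_j)]_{i,j=1}^N$ implies the existence of a contractive multiplier $\Phi$ of $\mathcal H(s)\otimes\mathbb C^m$ with $\Phi(z_i)=W_i$ for all $i$. Notation: $s_{j,w}(z)=s_j(z,w)$ and $k_w(z)=k(z,w)$. The Schur product is $(s_1\circ\cdots\circ s_p)(z,w)=\prod_{j}s_j(z,w)$ for $z,w\in\Omega$. The tensor product is $(s_1\otimes\cdots\otimes s_p)((z_1,\ldots,z_p),(w_1,\ldots,w_p))=\prod_j s_j(z_j,w_j)$ for $z_j,w_j\in\Omega$. The multiplier algebra $M(\mathcal H(k))$ consists of the holomorphic functions $\varphi$ on the domain of $k$ for which $f\mapsto\varphi f$ is a bounded operator on $\mathcal H(k)$; here $1\in\mathcal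 H(k)$, so $M(\mathcal H(k))\subseteq\mathcal H(k)$. The displayed identities are understood to include the assertion $\Lambda(k_w)\neq0$. A linear functional $\Lambda$ on $\mathcal H(k)$ is multiplicative if $\Lambda(fg)=\Lambda(f)\Lambda(g)$ whenever $f,g\in\mathcal H(k)$ are such that the pointwise product $fg$ is also in $\mathcal H(k)$. *)

theory Defs
  imports "HOL-Analysis.Analysis"
begin

section \<open>Functions on a set\<close>

text \<open>A complex-valued function on a set \<open>X\<close> is represented by a total function that vanishes
  outside \<open>X\<close>, so that equality and pointwise algebra of functions on \<open>X\<close> are those of HOL.\<close>

definition fun_on :: "'a set \<Rightarrow> ('a \<Rightarrow> complex) \<Rightarrow> 'a \<Rightarrow> complex" where
  "fun_on X f = (\<lambda>x. if x \<in> X then f x else 0)"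

definition kernel_fun :: "'a set \<Rightarrow> ('a \<Rightarrow> 'a \<Rightarrow> complex) \<Rightarrow> 'a \<Rightarrow> 'a \<Rightarrow> complex" where
  "kernel_fun X k w = fun_on X (\<lambda>z. k z w)"

section \<open>Positive semidefiniteness and reproducing kernel Hilbert spaces\<close>

definition psd_matrix :: "'i set \<Rightarrow> ('i \<Rightarrow> 'i \<Rightarrow> complex) \<Rightarrow> bool" where
  "psd_matrix I A \<longleftrightarrow>
     (\<forall>c. (\<Sum>i\<in>I. \<Sum>j\<in>I. cnj (c i) * A i j * c j) \<in> \<real>\<^sub>\<ge>\<^sub>0)"

definition reproducing_kernel :: "'a set \<Rightarrow> ('a \<Rightarrow> 'a \<Rightarrow> complex) \<Rightarrow> bool" where
  "reproducing_kernel X k \<longleftrightarrow> (\<forall>F. finite F \<and> F \<subseteq> X \<longrightarrow> psd_matrix F k)"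

definition hnorm :: "(('a \<Rightarrow> complex) \<Rightarrow> ('a \<Rightarrow> complex) \<Rightarrow> complex) \<Rightarrow> ('a \<Rightarrow> complex) \<Rightarrow> real" where
  "hnorm ip f = sqrt (Re (ip f f))"

text \<open>\<open>rkhs X k H ip\<close>: the set \<open>H\<close> of functions on \<open>X\<close> with the inner product \<open>ip\<close> (linear in its
  first argument, and relevant only on \<open>H\<close>) is the Hilbert space \<open>\<H>(k)\<close> with reproducing kernel
  \<open>k\<close>. By the Moore-Aronszajn theorem, every reproducing kernel \<open>k\<close> has such a space, and \<open>H\<close> and
  the restriction of \<open>ip\<close> to \<open>H\<close> are determined by \<open>X\<close> and \<open>k\<close>.\<close>

locale rkhs =
  fixes X :: "'a set"
    and k :: "'a \<Rightarrow> 'a \<Rightarrow> complex"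
    and H :: "('a \<Rightarrow> complex) set"
    and ip :: "('a \<Rightarrow> complex) \<Rightarrow> ('a \<Rightarrow> complex) \<Rightarrow> complex"
  assumes support: "\<And>f x. f \<in> H \<Longrightarrow> x \<notin> X \<Longrightarrow> f x = 0"
    and zero_mem: "(\<lambda>x. 0) \<in> H"
    and add_mem: "\<And>f g. f \<in> H \<Longrightarrow> g \<in> H \<Longrightarrow> (\<lambda>x. f x + g x) \<in> H"
    and scale_mem: "\<And>c f. f \<in> H \<Longrightarrow> (\<lambda>x. c * f x) \<in> H"
    and ip_add: "\<And>f g h. f \<in> H \<Longrightarrow> g \<in> H \<Longrightarrow> h \<in> H \<Longrightarrow> ip (\<lambda>x. f x + g x) h = ip f h + ip g h"
    and ip_scale: "\<And>c f h. f \<in> H \<Longrightarrow> h \<in> H \<Longrightarrow> ip (\<lambda>x. c * f x) h = c * ip f h"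
    and ip_cnj: "\<And>f g. f \<in> H \<Longrightarrow> g \<in> H \<Longrightarrow> ip g f = cnj (ip f g)"
    and ip_nonneg: "\<And>f. f \<in> H \<Longrightarrow> ip f f \<in> \<real>\<^sub>\<ge>\<^sub>0"
    and ip_definite: "\<And>f. f \<in> H \<Longrightarrow> ip f f = 0 \<Longrightarrow> f = (\<lambda>x. 0)"
    and complete_space: "\<And>F. (\<And>n. F n \<in> H) \<Longrightarrow>
          (\<And>e. e > 0 \<Longrightarrow> \<exists>N. \<forall>m\<ge>N. \<forall>n\<ge>N. hnorm ip (\<lambda>x. F m x - F n x) < e) \<Longrightarrow>
          \<exists>f\<in>H. (\<lambda>n::nat. hnorm ip (\<lambda>x. F n x - f x)) \<longlonglongrightarrow> 0"
    and kernel_mem: "\<And>w. w \<in> X \<Longrightarrow> kernel_fun X k w \<in> H"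
    and reproducing: "\<And>f w. f \<in> H \<Longrightarrow> w \<in> X \<Longrightarrow> ip f (kernel_fun X k w) = f w"

section \<open>Functionals and multipliers\<close>

definition bounded_functional ::
  "('a \<Rightarrow> complex) set \<Rightarrow> (('a \<Rightarrow> complex) \<Rightarrow> ('a \<Rightarrow> complex) \<Rightarrow> complex) \<Rightarrow>
   (('a \<Rightarrow> complex) \<Rightarrow> complex) \<Rightarrow> bool" where
  "bounded_functional H ip \<Lambda> \<longleftrightarrow>
     (\<forall>f\<in>H. \<forall>g\<in>H. \<Lambda> (\<lambda>x. f x + g x) = \<Lambda> f + \<Lambda> g) \<and>
     (\<forall>c. \<forall>f\<in>H. \<Lambda> (\<lambda>x. c * f x) = c * \<Lambda> f) \<and>
     (\<exists>C. \<forall>f\<in>H. norm (\<Lambda> f) \<le> C * hnorm ip f)"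

definition multiplicative_functional ::
  "('a \<Rightarrow> complex) set \<Rightarrow> (('a \<Rightarrow> complex) \<Rightarrow> complex) \<Rightarrow> bool" where
  "multiplicative_functional H \<Lambda> \<longleftrightarrow>
     (\<forall>f\<in>H. \<forall>g\<in>H. (\<lambda>x. f x * g x) \<in> H \<longrightarrow> \<Lambda> (\<lambda>x. f x * g x) = \<Lambda> f * \<Lambda> g)"

text \<open>Holomorphy on an open subset \<open>X\<close> of a finite-dimensional complex vector space, as complex
  Frechet differentiability. The library has no class of complex vector spaces, so the complex
  scalar multiplication \<open>sc\<close> is a parameter; it is \<open>(*s)\<close> on \<open>\<complex>\<^sup>d\<close> and \<open>scale_tuple\<close> on \<open>(\<complex>\<^sup>d)\<^sup>p\<close>.\<close>

definition holomorphic_mv ::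
  "(complex \<Rightarrow> 'a \<Rightarrow> 'a) \<Rightarrow> ('a::real_normed_vector \<Rightarrow> complex) \<Rightarrow> 'a set \<Rightarrow> bool" where
  "holomorphic_mv sc f X \<longleftrightarrow>
     (\<forall>x\<in>X. \<exists>D. (f has_derivative D) (at x) \<and> (\<forall>c v. D (sc c v) = c * D v))"

definition scale_tuple :: "complex \<Rightarrow> complex^'d^'p \<Rightarrow> complex^'d^'p" where
  "scale_tuple c v = (\<chi> j. c *s (v $ j))"

definition multiplier_algebra ::
  "(complex \<Rightarrow> 'a \<Rightarrow> 'a) \<Rightarrow> 'a::real_normed_vector set \<Rightarrow> ('a \<Rightarrow> complex) set \<Rightarrow>
   (('a \<Rightarrow> complex) \<Rightarrow> ('a \<Rightarrow> complex) \<Rightarrow> complex) \<Rightarrow> ('a \<Rightarrow> complex) set" where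
  "multiplier_algebra sc X H ip =
     {\<phi>. (\<forall>x. x \<notin> X \<longrightarrow> \<phi> x = 0) \<and> holomorphic_mv sc \<phi> X \<and>
         (\<forall>f\<in>H. (\<lambda>x. \<phi> x * f x) \<in> H) \<and>
         (\<exists>C. \<forall>f\<in>H. hnorm ip (\<lambda>x. \<phi> x * f x) \<le> C * hnorm ip f)}"

section \<open>Complete Pick kernels\<close>

text \<open>An \<open>m \<times> m\<close> matrix is a function \<open>nat \<Rightarrow> nat \<Rightarrow> complex\<close> of which only the entries with both
  indices below \<open>m\<close> matter.\<close>

definition contractive_matrix :: "nat \<Rightarrow> (nat \<Rightarrow> nat \<Rightarrow> complex) \<Rightarrow> bool" where
  "contractive_matrix m W \<longleftrightarrow>
     (\<forall>v. (\<Sum>a<m. (norm (\<Sum>b<m. W a b * v b))\<^sup>2) \<le> (\<Sum>b<m. (norm (v b))\<^sup>2))"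

text \<open>The elements of \<open>\<H> \<otimes> \<complex>\<^sup>m\<close> are the \<open>m\<close>-tuples in \<open>H\<close>, the square of the norm being the sum of
  the squares of the norms of the components; \<open>\<Phi>\<close> is a matrix-valued function on \<open>X\<close> acting on
  these column vectors by pointwise multiplication.\<close>

definition contractive_matrix_multiplier ::
  "'a set \<Rightarrow> ('a \<Rightarrow> complex) set \<Rightarrow> (('a \<Rightarrow> complex) \<Rightarrow> ('a \<Rightarrow> complex) \<Rightarrow> complex) \<Rightarrow> nat \<Rightarrow>
   ('a \<Rightarrow> nat \<Rightarrow> nat \<Rightarrow> complex) \<Rightarrow> bool" where
  "contractive_matrix_multiplier X H ip m \<Phi> \<longleftrightarrow>
     (\<forall>f. (\<forall>b<m. f b \<in> H) \<longrightarrow>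
        (\<forall>a<m. fun_on X (\<lambda>x. \<Sum>b<m. \<Phi> x a b * f b x) \<in> H) \<and>
        (\<Sum>a<m. (hnorm ip (fun_on X (\<lambda>x. \<Sum>b<m. \<Phi> x a b * f b x)))\<^sup>2)
          \<le> (\<Sum>b<m. (hnorm ip (f b))\<^sup>2))"

text \<open>The block matrix \<open>[(I - W\<^sub>i W\<^sub>j\<^sup>*) s(z\<^sub>i, z\<^sub>j)]\<close>, with rows and columns indexed by pairs (block
  index, index within the block).\<close>

definition pick_matrix ::
  "('a \<Rightarrow> 'a \<Rightarrow> complex) \<Rightarrow> nat \<Rightarrow> (nat \<Rightarrow> 'a) \<Rightarrow> (nat \<Rightarrow> nat \<Rightarrow> nat \<Rightarrow> complex) \<Rightarrow>
   nat \<times> nat \<Rightarrow> nat \<times> nat \<Rightarrow> complex" where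
  "pick_matrix s m z W = (\<lambda>(i, a) (j, b).
     ((if a = b then 1 else 0) - (\<Sum>e<m. W i a e * cnj (W j b e))) * s (z i) (z j))"

text \<open>The space quantified existentially here is unique and exists for every reproducing kernel,
  so it is just the space \<open>\<H>(s)\<close>. The points \<open>z i\<close> need not be distinct.\<close>

definition complete_pick_kernel :: "'a set \<Rightarrow> ('a \<Rightarrow> 'a \<Rightarrow> complex) \<Rightarrow> bool" where
  "complete_pick_kernel X s \<longleftrightarrow>
     (\<exists>H ip. rkhs X s H ip \<and>
       (\<forall>N m z W.
          (\<forall>i<N. z i \<in> X) \<and> (\<forall>i<N. contractive_matrix m (W i)) \<and>
          psd_matrix ({..<N} \<times> {..<m}) (pick_matrix s m z W) \<longrightarrow>
          (\<exists>\<Phi>. contractive_matrix_multiplier X H ip m \<Phi> \<and>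
               (\<forall>i<N. \<forall>a<m. \<forall>b<m. \<Phi> (z i) a b = W i a b))))"

section \<open>Normalized irreducible diagonal holomorphic kernels\<close>

text \<open>Multi-indices in \<open>\<int>\<^sub>+\<^sup>d\<close> are functions \<open>'d \<Rightarrow> nat\<close>.\<close>

definition mono_power :: "complex^'d \<Rightarrow> ('d \<Rightarrow> nat) \<Rightarrow> complex" where
  "mono_power z \<alpha> = (\<Prod>i\<in>UNIV. (z $ i) ^ \<alpha> i)"

text \<open>The power series of \<open>s\<close> at the origin represents \<open>s\<close> near the origin only, since \<open>\<Omega>\<close> is an
  arbitrary domain.\<close>

definition diagonal_expansion ::
  "(complex^'d) set \<Rightarrow> (complex^'d \<Rightarrow> complex^'d \<Rightarrow> complex) \<Rightarrow> (('d \<Rightarrow> nat) \<Rightarrow> real) \<Rightarrow> bool" where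
  "diagonal_expansion \<Omega> s a \<longleftrightarrow>
     (\<forall>\<alpha>. a \<alpha> > 0) \<and>
     (\<exists>r>0. ball 0 r \<subseteq> \<Omega> \<and>
        (\<forall>z\<in>ball 0 r. \<forall>w\<in>ball 0 r.
           ((\<lambda>\<alpha>. of_real (a \<alpha>) * mono_power z \<alpha> * cnj (mono_power w \<alpha>)) has_sum s z w) UNIV))"

definition normalized_diagonal_holomorphic_kernel ::
  "(complex^'d) set \<Rightarrow> (complex^'d \<Rightarrow> complex^'d \<Rightarrow> complex) \<Rightarrow> bool" where
  "normalized_diagonal_holomorphic_kernel \<Omega> s \<longleftrightarrow>
     reproducing_kernel \<Omega> s \<and>
     (\<forall>w\<in>\<Omega>. holomorphic_mv (*s) (\<lambda>z. s z w) \<Omega>) \<and>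
     (\<forall>z\<in>\<Omega>. holomorphic_mv (*s) (\<lambda>w. cnj (s z w)) \<Omega>) \<and>
     (\<exists>a. diagonal_expansion \<Omega> s a \<and> a (\<lambda>i. 0) = 1)"

definition irreducible_kernel :: "'a set \<Rightarrow> ('a \<Rightarrow> 'a \<Rightarrow> complex) \<Rightarrow> bool" where
  "irreducible_kernel X s \<longleftrightarrow>
     (\<forall>z\<in>X. \<forall>w\<in>X. s z w \<noteq> 0) \<and>
     (\<forall>z\<in>X. \<forall>w\<in>X. z \<noteq> w \<longrightarrow>
        (\<forall>a b. (\<forall>x\<in>X. a * s x z + b * s x w = 0) \<longrightarrow> a = 0 \<and> b = 0))"

section \<open>Products of kernels\<close>

definition schur_product ::
  "('p::finite \<Rightarrow> 'a \<Rightarrow> 'a \<Rightarrow> complex) \<Rightarrow> 'a \<Rightarrow> 'a \<Rightarrow> complex" where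
  "schur_product s z w = (\<Prod>j\<in>UNIV. s j z w)"

definition tensor_product ::
  "('p::finite \<Rightarrow> 'a \<Rightarrow> 'a \<Rightarrow> complex) \<Rightarrow> 'a^'p \<Rightarrow> 'a^'p \<Rightarrow> complex" where
  "tensor_product s z w = (\<Prod>j\<in>UNIV. s j (z $ j) (w $ j))"

definition tuples_in :: "'a set \<Rightarrow> ('a^'p) set" where
  "tuples_in \<Omega> = {z. \<forall>j. z $ j \<in> \<Omega>}"

end

theory Submission
  imports Defs "HOL-Complex_Analysis.Complex_Analysis"
begin

text \<open>By the McCullough-Quiggin theorem, \<open>s\<^sub>j = 1 / (1 - b\<^sub>j)\<close> with \<open>b\<^sub>j\<close> positive semidefinite. Hence
  \<open>(b\<^sub>j(w, w) - b\<^sub>j(z, w) b\<^sub>j(w, z')) k(z, z')\<close> is positive semidefinite, so that \<open>1 / s\<^sub>j\<^sub>,\<^sub>w = 1 - b\<^sub>j\<^sub>,\<^sub>w\<close>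
  is a multiplier, and a multiplicative functional can be applied to the factors of
  \<open>k\<^sub>w \<cdot> \<Prod>\<^sub>j 1 / s\<^sub>j\<^sub>,\<^sub>w = 1\<close> one at a time.

  For the converse write, near the origin, \<open>k = \<Sum> \<kappa>\<^sub>\<alpha> z\<^sup>\<alpha> w\<^sup>*\<^sup>\<alpha>\<close> and \<open>b\<^sub>j = \<Sum> c\<^sub>j\<^sub>,\<^sub>\<alpha> z\<^sup>\<alpha> w\<^sup>*\<^sup>\<alpha>\<close>. The identity
  \<open>\<Lambda>(k\<^sub>w) \<Prod>\<^sub>j (1 - \<Lambda>(b\<^sub>j\<^sub>,\<^sub>w)) = 1\<close> also holds with \<open>\<mu>\<^sup>\<alpha>\<close> in place of \<open>\<Lambda>(z\<^sup>\<alpha>)\<close>, where \<open>\<mu>\<^sub>i = \<Lambda>(z\<^sub>i)\<close>, and comparing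
  coefficients at the first \<open>\<alpha>\<close> at which the two differ gives
  \<open>(\<kappa>\<^sub>\<alpha> - \<Sum>\<^sub>j c\<^sub>j\<^sub>,\<^sub>\<alpha>) (\<Lambda>(z\<^sup>\<alpha>) - \<mu>\<^sup>\<alpha>) = 0\<close>. The first factor is positive when \<open>|\<alpha>| \<ge> 2\<close>, because
  \<open>k - 1 - \<Sum>\<^sub>j b\<^sub>j\<close> dominates \<open>b\<^sub>j (k - 1)\<close> for each \<open>j\<close>. So \<open>\<Lambda>(z\<^sup>\<alpha>) = \<mu>\<^sup>\<alpha>\<close> for all \<open>\<alpha>\<close>, and since
  \<open>\<Lambda>(f) = \<Sum> f\<^sub>\<alpha> \<mu>\<^sup>\<alpha>\<close> converges absolutely, multiplicativity is the Cauchy product.\<close>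

section \<open>Positive semidefinite matrices and kernels\<close>

text \<open>The power series hold only near the origin, while \<Lambda> acts on functions on all of
  \<Omega>. The converse is therefore proved on a small polydisc: an element of the space that
  vanishes near the base point is zero, so restriction is injective and carries the Hilbert space,
  \<Lambda> and the identity over. "First" refers to a total order of the multi-indices compatible
  with addition, given by coding \<alpha> as a product of prime powers; the comparison becomes a
  limit along points with coordinates \<open>p_i ^ (-n)\<close>. The identity holds for the powers
  of \<mu> because a diagonal kernel depends only on the products of \<open>z_i\<close> with the
  conjugate of \<open>w_i\<close>: \<mu> may lie far outside the domain, but its entries are
  absorbed by a large \<open>n\<close>. A coefficient of a single \<open>b_j\<close> at a variable
  can be zero, as in the tensor product, where each factor sees only its own block. The linear part
  of the identity gives for each variable some \<open>j\<close> with a positive coefficient, and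
  then \<open>b_j (k - 1)\<close> has a positive coefficient at every index of degree at least 2
  that contains this variable.\<close>

lemma cnj_mult_self: "cnj z * z = of_real ((norm z)\<^sup>2)"
  by (metis complex_norm_square mult.commute)

text \<open>The Cauchy-Schwarz argument freed of any inner product. It serves matrices and the
  Hilbert space, and also the perturbation step in \<open>membership_criterion\<close>, where only a
  quadratic lower bound is at hand.\<close>

lemma quadratic_nonneg_imp_cs:
  fixes a q :: real and s :: complex
  assumes "\<And>t. 0 \<le> q - 2 * Re (cnj t * s) + (norm t)\<^sup>2 * a" and "0 \<le> a"
  shows "(norm s)\<^sup>2 \<le> a * q"
proof (cases "a = 0")
  case True
  show ?thesis
  proof (cases "s = 0")
    case False
    \<comment> \<open>With \<open>a = 0\<close> nothing compensates the linear term, and this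
      multiple of \<open>s\<close> makes it exceed \<open>q\<close>.\<close>
    define t where "t = complex_of_real ((\<bar>q\<bar> + 1) / (norm s)\<^sup>2) * s"
    have "cnj t * s = of_real ((\<bar>q\<bar> + 1) / (norm s)\<^sup>2) * (cnj s * s)"
      by (simp add: t_def)
    also have "\<dots> = of_real (\<bar>q\<bar> + 1)"
      unfolding cnj_mult_self of_real_mult[symmetric] using False by simp
    finally have "cnj t * s = of_real (\<bar>q\<bar> + 1)" .
    then have "Re (cnj t * s) = \<bar>q\<bar> + 1" by simp
    then show ?thesis using assms(1)[of t] True by simp
  qed (use True in simp)
next
  case False
  then have a: "a > 0" using assms(2) by simp
  define t where "t = s / of_real a"
  have "Re (cnj t * s) = (norm s)\<^sup>2 / a"
    using complex_norm_square[of s, symmetric] by (simp add: t_def mult.commute)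
  moreover have "(norm t)\<^sup>2 * a = (norm s)\<^sup>2 / a"
    using a by (simp add: t_def norm_divide power_divide power2_eq_square)
  ultimately have "0 \<le> q - (norm s)\<^sup>2 / a" using assms(1)[of t] by simp
  then show ?thesis using a by (simp add: field_simps)
qed

definition sesq :: "'i set \<Rightarrow> ('i \<Rightarrow> 'i \<Rightarrow> complex) \<Rightarrow> ('i \<Rightarrow> complex) \<Rightarrow> ('i \<Rightarrow> complex) \<Rightarrow> complex" where
  "sesq I A c d = (\<Sum>i\<in>I. \<Sum>j\<in>I. cnj (c i) * A i j * d j)"

lemma psd_matrix_sesq: "psd_matrix I A \<longleftrightarrow> (\<forall>c. sesq I A c c \<in> \<real>\<^sub>\<ge>\<^sub>0)"
  by (simp add: psd_matrix_def sesq_def)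

lemma psd_sesq: "psd_matrix I A \<Longrightarrow> sesq I A c c \<in> \<real>\<^sub>\<ge>\<^sub>0"
  by (simp add: psd_matrix_sesq)

lemma sesq_add_right: "sesq I A c (\<lambda>i. d i + e i) = sesq I A c d + sesq I A c e"
  by (simp add: sesq_def sum.distrib algebra_simps)

lemma sesq_add_left: "sesq I A (\<lambda>i. c i + d i) e = sesq I A c e + sesq I A d e"
  by (simp add: sesq_def sum.distrib algebra_simps)

lemma sesq_scale_right: "sesq I A c (\<lambda>i. t * d i) = t * sesq I A c d"
  by (simp add: sesq_def sum_distrib_left mult_ac)

lemma sesq_scale_left: "sesq I A (\<lambda>i. t * c i) d = cnj t * sesq I A c d"
  by (simp add: sesq_def sum_distrib_left mult_ac)

lemma sesq_cong:
  "(\<And>i j. i \<in> I \<Longrightarrow> j \<in> I \<Longrightarrow> A i j = B i j) \<Longrightarrow> sesq I A c d = sesq I B c d"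
  unfolding sesq_def by (intro sum.cong) auto

lemma psd_matrix_cong:
  "(\<And>i j. i \<in> I \<Longrightarrow> j \<in> I \<Longrightarrow> A i j = B i j) \<Longrightarrow> psd_matrix I A = psd_matrix I B"
  unfolding psd_matrix_sesq using sesq_cong[of I A B] by simp

lemma sesq_unit_left:
  assumes "finite I" "i \<in> I"
  shows "sesq I A (\<lambda>x. if x = i then 1 else 0) d = (\<Sum>j\<in>I. A i j * d j)"
proof -
  have "sesq I A (\<lambda>x. if x = i then 1 else 0) d
      = (\<Sum>x\<in>I. if x = i then (\<Sum>j\<in>I. A i j * d j) else 0)"
    unfolding sesq_def by (intro sum.cong) auto
  then show ?thesis using assms by simp
qed

lemma sesq_unit_unit:
  assumes "finite I" "i \<in> I" "j \<in> I"
  shows "sesq I A (\<lambda>x. if x = i then 1 else 0) (\<lambda>x. if x = j then 1 else 0) = A i j"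
proof -
  have "(\<Sum>x\<in>I. A i x * (if x = j then 1 else 0)) = (\<Sum>x\<in>I. if x = j then A i j else 0)"
    by (intro sum.cong) auto
  then show ?thesis using assms by (simp add: sesq_unit_left)
qed

text \<open>\<open>psd_matrix\<close> only says that the quadratic form is real and nonnegative.
  Polarization, with the form real at \<open>c + d\<close> and at \<open>c + \<i> d\<close>, turns
  this into hermitian symmetry.\<close>

lemma psd_sesq_hermitian:
  assumes "psd_matrix I A"
  shows "sesq I A d c = cnj (sesq I A c d)"
proof -
  have q: "Im (sesq I A u u) = 0" for u
    using psd_sesq[OF assms, of u] by (simp add: complex_nonneg_Reals_iff)
  have 1: "sesq I A (\<lambda>i. c i + d i) (\<lambda>i. c i + d i)
      = sesq I A c c + sesq I A c d + sesq I A d c + sesq I A d d"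
    by (simp add: sesq_add_left sesq_add_right)
  have 2: "sesq I A (\<lambda>i. c i + \<i> * d i) (\<lambda>i. c i + \<i> * d i)
      = sesq I A c c + \<i> * sesq I A c d - \<i> * sesq I A d c + sesq I A d d"
    by (simp add: sesq_add_left sesq_add_right sesq_scale_left sesq_scale_right algebra_simps)
  show ?thesis
    using q[of "\<lambda>i. c i + d i", unfolded 1] q[of "\<lambda>i. c i + \<i> * d i", unfolded 2] q[of c] q[of d]
    by (simp add: complex_eq_iff)
qed

lemma psd_sesq_cs:
  assumes "psd_matrix I A"
  shows "(norm (sesq I A c d))\<^sup>2 \<le> Re (sesq I A c c) * Re (sesq I A d d)"
proof (rule quadratic_nonneg_imp_cs)
  show "0 \<le> Re (sesq I A c c)"
    using psd_sesq[OF assms, of c] by (simp add: complex_nonneg_Reals_iff)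
  fix t
  have "sesq I A (\<lambda>i. d i + (- t) * c i) (\<lambda>i. d i + (- t) * c i)
     = sesq I A d d - t * sesq I A d c - cnj t * sesq I A c d + cnj t * t * sesq I A c c"
    by (simp only: sesq_add_left sesq_add_right sesq_scale_left sesq_scale_right)
      (simp add: algebra_simps)
  also have "t * sesq I A d c = cnj (cnj t * sesq I A c d)"
    using psd_sesq_hermitian[OF assms, of d c] by simp
  also have "cnj t * t = of_real ((norm t)\<^sup>2)"
    by (rule cnj_mult_self)
  finally have "Re (sesq I A (\<lambda>i. d i + (- t) * c i) (\<lambda>i. d i + (- t) * c i))
      = Re (sesq I A d d) - 2 * Re (cnj t * sesq I A c d) + (norm t)\<^sup>2 * Re (sesq I A c c)"
    by simp
  moreover have "0 \<le> Re (sesq I A (\<lambda>i. d i + (- t) * c i) (\<lambda>i. d i + (- t) * c i))"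
    using psd_sesq[OF assms] by (simp add: complex_nonneg_Reals_iff)
  ultimately show "0 \<le> Re (sesq I A d d) - 2 * Re (cnj t * sesq I A c d)
      + (norm t)\<^sup>2 * Re (sesq I A c c)" by simp
qed

lemma psd_matrix_hermitian:
  assumes "psd_matrix I A" "finite I" "i \<in> I" "j \<in> I"
  shows "A j i = cnj (A i j)"
  using psd_sesq_hermitian[OF assms(1), of "\<lambda>x. if x = j then 1 else 0" "\<lambda>x. if x = i then 1 else 0"]
  by (simp add: sesq_unit_unit assms)

lemma psd_matrix_diag:
  assumes "psd_matrix I A" "finite I" "i \<in> I"
  shows "A i i \<in> \<real>\<^sub>\<ge>\<^sub>0"
  using psd_sesq[OF assms(1), of "\<lambda>x. if x = i then 1 else 0"] by (simp add: sesq_unit_unit assms)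

lemma psd_matrix_row_cs:
  assumes "psd_matrix I A" "finite I" "i \<in> I"
  shows "(norm (\<Sum>j\<in>I. A i j * d j))\<^sup>2 \<le> Re (A i i) * Re (sesq I A d d)"
  using psd_sesq_cs[OF assms(1), of "\<lambda>x. if x = i then 1 else 0" d]
  unfolding sesq_unit_unit[OF assms(2,3,3)] sesq_unit_left[OF assms(2,3)] .

lemma psd_matrix_subset:
  assumes "psd_matrix I A" "finite I" "J \<subseteq> I"
  shows "psd_matrix J A"
  unfolding psd_matrix_sesq
proof
  fix c
  have "sesq I A (\<lambda>i. if i \<in> J then c i else 0) (\<lambda>i. if i \<in> J then c i else 0) = sesq J A c c"
  proof -
    have "sesq I A (\<lambda>i. if i \<in> J then c i else 0) (\<lambda>i. if i \<in> J then c i else 0)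
        = (\<Sum>i\<in>J. \<Sum>j\<in>I. cnj (c i) * A i j * (if j \<in> J then c j else 0))"
      unfolding sesq_def using assms by (intro sum.mono_neutral_cong_right) auto
    also have "\<dots> = sesq J A c c"
      unfolding sesq_def using assms by (intro sum.cong sum.mono_neutral_cong_right) auto
    finally show ?thesis .
  qed
  then show "sesq J A c c \<in> \<real>\<^sub>\<ge>\<^sub>0"
    using psd_sesq[OF assms(1)] by metis
qed

lemma sesq_rank1:
  "sesq I (\<lambda>i j. u i * cnj (v j)) c d = (\<Sum>i\<in>I. cnj (c i) * u i) * (\<Sum>j\<in>I. cnj (v j) * d j)"
  unfolding sesq_def sum_product by (simp add: mult_ac)

lemma sesq_diff: "sesq I (\<lambda>i j. A i j - B i j) c d = sesq I A c d - sesq I B c d"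
  by (simp add: sesq_def sum_subtractf algebra_simps)

lemma sesq_cmult: "sesq I (\<lambda>i j. t * A i j) c d = t * sesq I A c d"
  by (simp add: sesq_def sum_distrib_left mult_ac)

lemma sesq_sum: "sesq I (\<lambda>x y. \<Sum>l\<in>L. A l x y) c d = (\<Sum>l\<in>L. sesq I (A l) c d)"
proof -
  have "sesq I (\<lambda>x y. \<Sum>l\<in>L. A l x y) c d
      = (\<Sum>i\<in>I. \<Sum>j\<in>I. \<Sum>l\<in>L. cnj (c i) * A l i j * d j)"
    by (simp add: sesq_def sum_distrib_left sum_distrib_right)
  also have "\<dots> = (\<Sum>i\<in>I. \<Sum>l\<in>L. \<Sum>j\<in>I. cnj (c i) * A l i j * d j)"
    by (intro sum.cong sum.swap refl)
  also have "\<dots> = (\<Sum>l\<in>L. sesq I (A l) c d)"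
    unfolding sesq_def by (rule sum.swap)
  finally show ?thesis .
qed

text \<open>At \<open>c\<close> the form is \<open>A i i\<close> times that of \<open>A\<close>
  minus the squared modulus of row \<open>i\<close> applied to \<open>c\<close>, so this is
  Cauchy-Schwarz against a unit vector. There is no division by \<open>A i i\<close>, which may
  vanish.\<close>

lemma psd_matrix_schur_complement:
  assumes A: "psd_matrix I A" and I: "finite I" "i \<in> I"
  shows "psd_matrix I (\<lambda>x y. A i i * A x y - A x i * A i y)"
  unfolding psd_matrix_sesq
proof
  fix c
  define s where "s = (\<Sum>j\<in>I. A i j * c j)"
  have herm: "A x i = cnj (A i x)" if "x \<in> I" for x
    using psd_matrix_hermitian[OF A I(1)] I(2) that by blast
  have "sesq I (\<lambda>x y. A i i * A x y - A x i * A i y) c c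
      = A i i * sesq I A c c - sesq I (\<lambda>x y. A x i * cnj (A y i)) c c"
    unfolding sesq_cmult[symmetric] sesq_diff[symmetric]
    using herm by (intro sesq_cong) simp
  also have "sesq I (\<lambda>x y. A x i * cnj (A y i)) c c = cnj s * s"
    unfolding sesq_rank1 s_def using herm by (simp add: mult.commute)
  also have "cnj s * s = of_real ((norm s)\<^sup>2)"
    by (rule cnj_mult_self)
  finally have *: "sesq I (\<lambda>x y. A i i * A x y - A x i * A i y) c c
      = A i i * sesq I A c c - of_real ((norm s)\<^sup>2)" .
  have "(norm s)\<^sup>2 \<le> Re (A i i) * Re (sesq I A c c)"
    unfolding s_def by (rule psd_matrix_row_cs[OF A I])
  moreover have "A i i \<in> \<real>\<^sub>\<ge>\<^sub>0" "sesq I A c c \<in> \<real>\<^sub>\<ge>\<^sub>0"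
    using psd_matrix_diag[OF A I] psd_sesq[OF A] by auto
  ultimately show "sesq I (\<lambda>x y. A i i * A x y - A x i * A i y) c c \<in> \<real>\<^sub>\<ge>\<^sub>0"
    unfolding * by (auto simp: complex_nonneg_Reals_iff)
qed

text \<open>Cholesky factorization, eliminating one index at a time.\<close>

lemma psd_matrix_gram:
  assumes "finite I" "psd_matrix I A"
  shows "\<exists>(m::nat) V. \<forall>x\<in>I. \<forall>y\<in>I. A x y = (\<Sum>l<m. V x l * cnj (V y l))"
  using assms
proof (induction I arbitrary: A rule: finite_induct)
  case empty
  then show ?case by simp
next
  case (insert i I)
  let ?J = "insert i I"
  have fin: "finite ?J" and iJ: "i \<in> ?J" using insert.hyps by auto
  have diag: "Re (A i i) \<ge> 0" "A i i = of_real (Re (A i i))"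
    using psd_matrix_diag[OF insert.prems fin iJ] by (auto simp: complex_nonneg_Reals_iff complex_eq_iff)
  have herm: "A x i = cnj (A i x)" if "x \<in> ?J" for x
    using psd_matrix_hermitian[OF insert.prems fin] iJ that by blast
  show ?case
  proof (cases "A i i = 0")
    case True
    \<comment> \<open>By Cauchy-Schwarz a zero diagonal entry kills its row, so the index
      \<open>i\<close> receives the zero vector.\<close>
    have zero: "A i y = 0" if "y \<in> ?J" for y
    proof -
      have "(\<Sum>j\<in>?J. A i j * (if j = y then 1 else 0)) = (\<Sum>j\<in>?J. if j = y then A i y else 0)"
        by (intro sum.cong) auto
      also have "\<dots> = A i y" using that fin by simp
      finally show ?thesis
        using psd_matrix_row_cs[OF insert.prems fin iJ, of "\<lambda>x. if x = y then 1 else 0"] True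
        by simp
    qed
    have zero': "A y i = 0" if "y \<in> ?J" for y
      unfolding herm[OF that] using zero[OF that] by simp
    obtain m :: nat and V where V: "\<forall>x\<in>I. \<forall>y\<in>I. A x y = (\<Sum>l<m. V x l * cnj (V y l))"
      using insert.IH[OF psd_matrix_subset[OF insert.prems fin subset_insertI]] by blast
    have "\<forall>x\<in>?J. \<forall>y\<in>?J. A x y
        = (\<Sum>l<m. (if x = i then 0 else V x l) * cnj (if y = i then 0 else V y l))"
      using V zero zero' insert.hyps(2) by (auto intro!: sum.cong)
    then show ?thesis
      by (intro exI[of _ m] exI[of _ "\<lambda>x l. if x = i then 0 else V x l"]) simp
  next
    case False
    define a where "a = Re (A i i)"
    have aii: "A i i = of_real a" unfolding a_def by (rule diag(2))
    have "a \<noteq> 0" using False unfolding aii by simp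
    moreover have "a \<ge> 0" unfolding a_def by (rule diag(1))
    ultimately have a: "a > 0" by linarith
    have "psd_matrix ?J (\<lambda>x y. A i i * A x y - A x i * A i y)"
      by (rule psd_matrix_schur_complement[OF insert.prems fin iJ])
    then have "psd_matrix I (\<lambda>x y. A i i * A x y - A x i * A i y)"
      by (rule psd_matrix_subset[OF _ fin]) auto
    then obtain m :: nat and V where
      V: "\<forall>x\<in>I. \<forall>y\<in>I. A i i * A x y - A x i * A i y = (\<Sum>l<m. V x l * cnj (V y l))"
      using insert.IH[of "\<lambda>x y. A i i * A x y - A x i * A i y"] by blast
    \<comment> \<open>The new coordinate \<open>m\<close> carries column \<open>i\<close>. The
      others vanish at \<open>i\<close>, because the Schur complement does; dividing by
      \<open>sqrt a\<close> undoes its scaling by \<open>A i i\<close>.\<close>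
    define U where "U = (\<lambda>x l. (if l = m then A x i else if x = i then 0 else V x l)
                                 / complex_of_real (sqrt a))"
    have sq: "complex_of_real (sqrt a) * complex_of_real (sqrt a) = of_real a"
      using a(1) by (metis of_real_mult real_sqrt_mult_self abs_of_pos)
    have "A x y = (\<Sum>l<Suc m. U x l * cnj (U y l))" if xy: "x \<in> ?J" "y \<in> ?J" for x y
    proof -
      have "(\<Sum>l<Suc m. U x l * cnj (U y l)) =
          ((\<Sum>l<m. (if x = i then 0 else V x l) * cnj (if y = i then 0 else V y l))
            + A x i * cnj (A y i)) / of_real a"
        unfolding U_def by (simp add: sq add_divide_distrib sum_divide_distrib[symmetric])
      also have "(\<Sum>l<m. (if x = i then 0 else V x l) * cnj (if y = i then 0 else V y l))
          = A i i * A x y - A x i * A i y"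
        using V xy insert.hyps(2) by (auto intro!: sum.cong)
      also have "cnj (A y i) = A i y" using herm[OF xy(2)] by simp
      finally show ?thesis using a unfolding aii by simp
    qed
    then show ?thesis by blast
  qed
qed

lemma psd_matrix_gramI:
  assumes "finite I" "\<And>x y. x \<in> I \<Longrightarrow> y \<in> I \<Longrightarrow> A x y = (\<Sum>l<(m::nat). V x l * cnj (V y l))"
  shows "psd_matrix I A"
  unfolding psd_matrix_sesq
proof
  fix c
  have "sesq I A c c = sesq I (\<lambda>x y. \<Sum>l<m. V x l * cnj (V y l)) c c"
    using assms(2) by (intro sesq_cong) auto
  also have "\<dots> = (\<Sum>l<m. sesq I (\<lambda>x y. V x l * cnj (V y l)) c c)"
    by (rule sesq_sum)
  also have "\<dots> = (\<Sum>l<m. of_real ((norm (\<Sum>i\<in>I. cnj (c i) * V i l))\<^sup>2))"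
  proof (rule sum.cong[OF refl])
    fix l
    have "(\<Sum>j\<in>I. cnj (V j l) * c j) = cnj (\<Sum>i\<in>I. cnj (c i) * V i l)"
      by (simp add: mult.commute)
    then show "sesq I (\<lambda>x y. V x l * cnj (V y l)) c c
        = of_real ((norm (\<Sum>i\<in>I. cnj (c i) * V i l))\<^sup>2)"
      unfolding sesq_rank1 by (metis cnj_mult_self mult.commute)
  qed
  finally show "sesq I A c c \<in> \<real>\<^sub>\<ge>\<^sub>0"
    by (simp add: complex_nonneg_Reals_iff sum_nonneg del: of_real_power)
qed

section \<open>Operations on reproducing kernels\<close>

lemma reproducing_kernelD:
  "reproducing_kernel X K \<Longrightarrow> finite F \<Longrightarrow> F \<subseteq> X \<Longrightarrow> psd_matrix F K"
  by (simp add: reproducing_kernel_def)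

lemma reproducing_kernel_cong:
  assumes "\<And>x y. x \<in> X \<Longrightarrow> y \<in> X \<Longrightarrow> K x y = L x y"
  shows "reproducing_kernel X K = reproducing_kernel X L"
proof -
  have "psd_matrix F K = psd_matrix F L" if "F \<subseteq> X" for F
    using that assms by (intro psd_matrix_cong) blast
  then show ?thesis unfolding reproducing_kernel_def by blast
qed

lemma reproducing_kernel_congD:
  "reproducing_kernel X K \<Longrightarrow> (\<And>x y. x \<in> X \<Longrightarrow> y \<in> X \<Longrightarrow> K x y = L x y) \<Longrightarrow> reproducing_kernel X L"
  using reproducing_kernel_cong by metis

lemma reproducing_kernel_subset:
  "reproducing_kernel X K \<Longrightarrow> Y \<subseteq> X \<Longrightarrow> reproducing_kernel Y K"
  unfolding reproducing_kernel_def by blast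

lemma reproducing_kernel_hermitian:
  "reproducing_kernel X K \<Longrightarrow> x \<in> X \<Longrightarrow> y \<in> X \<Longrightarrow> K y x = cnj (K x y)"
  using psd_matrix_hermitian[of "{x, y}" K x y] reproducing_kernelD[of X K "{x, y}"] by simp

lemma reproducing_kernel_diag:
  "reproducing_kernel X K \<Longrightarrow> x \<in> X \<Longrightarrow> K x x \<in> \<real>\<^sub>\<ge>\<^sub>0"
  using psd_matrix_diag[of "{x}" K x] reproducing_kernelD[of X K "{x}"] by simp

lemma reproducing_kernel_add:
  "reproducing_kernel X K \<Longrightarrow> reproducing_kernel X L \<Longrightarrow> reproducing_kernel X (\<lambda>x y. K x y + L x y)"
  unfolding reproducing_kernel_def psd_matrix_sesq
  by (simp add: sesq_def algebra_simps sum.distrib nonneg_Reals_add_I)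

lemma reproducing_kernel_scale:
  "reproducing_kernel X K \<Longrightarrow> c \<in> \<real>\<^sub>\<ge>\<^sub>0 \<Longrightarrow> reproducing_kernel X (\<lambda>x y. c * K x y)"
  unfolding reproducing_kernel_def psd_matrix_sesq by (simp add: sesq_cmult nonneg_Reals_mult_I)

lemma reproducing_kernel_rank1: "reproducing_kernel X (\<lambda>x y. f x * cnj (f y))"
  unfolding reproducing_kernel_def
  by (intro allI impI psd_matrix_gramI[where m = 1 and V = "\<lambda>x _. f x"]) auto

lemma reproducing_kernel_zero: "reproducing_kernel X (\<lambda>x y. 0)"
  using reproducing_kernel_rank1[of X "\<lambda>_. 0"] by simp

lemma reproducing_kernel_one: "reproducing_kernel X (\<lambda>x y. 1)"
  using reproducing_kernel_rank1[of X "\<lambda>_. 1"] by simp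

lemma reproducing_kernel_sum:
  "(\<And>j. j \<in> J \<Longrightarrow> reproducing_kernel X (K j)) \<Longrightarrow> reproducing_kernel X (\<lambda>x y. \<Sum>j\<in>J. K j x y)"
  by (induction J rule: infinite_finite_induct) (auto intro: reproducing_kernel_zero reproducing_kernel_add)

text \<open>Schur product theorem: a Gram factorization of \<open>L\<close> writes the form of the
  product as a sum of values of the form of \<open>K\<close>, at \<open>c\<close> multiplied by the
  conjugated factors.\<close>

lemma reproducing_kernel_mult:
  assumes "reproducing_kernel X K" "reproducing_kernel X L"
  shows "reproducing_kernel X (\<lambda>x y. K x y * L x y)"
  unfolding reproducing_kernel_def psd_matrix_sesq
proof (intro allI impI)
  fix F c assume F: "finite F \<and> F \<subseteq> X"
  then obtain m :: nat and V where V: "\<forall>x\<in>F. \<forall>y\<in>F. L x y = (\<Sum>l<m. V x l * cnj (V y l))"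
    using psd_matrix_gram reproducing_kernelD[OF assms(2)] by metis
  have "sesq F (\<lambda>x y. K x y * L x y) c c
      = sesq F (\<lambda>x y. K x y * (\<Sum>l<m. V x l * cnj (V y l))) c c"
    using V by (intro sesq_cong) auto
  also have "\<dots> = (\<Sum>l<m. sesq F (\<lambda>x y. K x y * (V x l * cnj (V y l))) c c)"
    unfolding sum_distrib_left by (rule sesq_sum)
  also have "\<dots> = (\<Sum>l<m. sesq F K (\<lambda>x. cnj (V x l) * c x) (\<lambda>x. cnj (V x l) * c x))"
    unfolding sesq_def by (simp add: mult_ac)
  also have "\<dots> \<in> \<real>\<^sub>\<ge>\<^sub>0"
    using psd_sesq[OF reproducing_kernelD[OF assms(1)]] F
    by (auto simp: complex_nonneg_Reals_iff intro!: sum_nonneg sum.neutral)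
  finally show "sesq F (\<lambda>x y. K x y * L x y) c c \<in> \<real>\<^sub>\<ge>\<^sub>0" .
qed


lemma reproducing_kernel_prod:
  "(\<And>j. j \<in> J \<Longrightarrow> reproducing_kernel X (K j)) \<Longrightarrow> reproducing_kernel X (\<lambda>x y. \<Prod>j\<in>J. K j x y)"
  by (induction J rule: infinite_finite_induct) (auto intro: reproducing_kernel_one reproducing_kernel_mult)

text \<open>As \<open>g\<close> may identify points, the double sum over \<open>F\<close> cannot be
  reindexed; a Gram factorization on the image is composed with \<open>g\<close> instead.\<close>

lemma reproducing_kernel_pullback:
  assumes "reproducing_kernel X K" "\<And>y. y \<in> Y \<Longrightarrow> g y \<in> X"
  shows "reproducing_kernel Y (\<lambda>x y. K (g x) (g y))"
  unfolding reproducing_kernel_def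
proof (intro allI impI)
  fix F assume F: "finite F \<and> F \<subseteq> Y"
  then have "finite (g ` F)" "g ` F \<subseteq> X" using assms(2) by auto
  then obtain m :: nat and V where
    V: "\<forall>x\<in>g ` F. \<forall>y\<in>g ` F. K x y = (\<Sum>l<m. V x l * cnj (V y l))"
    using psd_matrix_gram reproducing_kernelD[OF assms(1)] by metis
  show "psd_matrix F (\<lambda>x y. K (g x) (g y))"
    using F V by (intro psd_matrix_gramI[where V = "\<lambda>x. V (g x)" and m = m]) auto
qed

lemma reproducing_kernel_schur_complement:
  assumes "reproducing_kernel X K" "w \<in> X"
  shows "reproducing_kernel X (\<lambda>x y. K w w * K x y - K x w * K w y)"
  unfolding reproducing_kernel_def
proof (intro allI impI)
  fix F assume F: "finite F \<and> F \<subseteq> X"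
  \<comment> \<open>The matrix version needs \<open>w\<close> among the indices; it is dropped again
    afterwards.\<close>
  then have fin: "finite (insert w F)" and psd: "psd_matrix (insert w F) K"
    using assms(2) by (auto intro: reproducing_kernelD[OF assms(1)])
  show "psd_matrix F (\<lambda>x y. K w w * K x y - K x w * K w y)"
    using psd_matrix_subset[OF psd_matrix_schur_complement[OF psd fin, of w] fin] by blast
qed

lemma reproducing_kernel_cs:
  assumes "reproducing_kernel X K" "x \<in> X" "y \<in> X"
  shows "(norm (K x y))\<^sup>2 \<le> Re (K x x) * Re (K y y)"
proof -
  have "Re (K y y * K x x - K x y * K y x) \<ge> 0"
    using reproducing_kernel_diag[OF reproducing_kernel_schur_complement[OF assms(1,3)] assms(2)]
    by (simp add: complex_nonneg_Reals_iff)
  moreover have "K x y * K y x = of_real ((norm (K x y))\<^sup>2)"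
    using reproducing_kernel_hermitian[OF assms] by (metis cnj_mult_self mult.commute)
  moreover have "Im (K x x) = 0" "Im (K y y) = 0"
    using reproducing_kernel_diag[OF assms(1)] assms(2,3) by (auto simp: complex_nonneg_Reals_iff)
  ultimately show ?thesis by (simp add: mult.commute)
qed

section \<open>Kernels given by infinite sums\<close>

lemma has_sum_nonneg_Reals:
  fixes f :: "'b \<Rightarrow> complex"
  assumes "(f has_sum s) A" "\<And>x. x \<in> A \<Longrightarrow> f x \<in> \<real>\<^sub>\<ge>\<^sub>0"
  shows "s \<in> \<real>\<^sub>\<ge>\<^sub>0"
proof -
  have "0 \<le> Re s"
    using has_sum_nonneg[OF has_sum_Re[OF assms(1)]] assms(2) by (simp add: complex_nonneg_Reals_iff)
  moreover have "((\<lambda>x. 0) has_sum Im s) A"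
    using has_sum_Im[OF assms(1)] assms(2)
    by (subst has_sum_cong[of A _ "\<lambda>x. Im (f x)"]) (auto simp: complex_nonneg_Reals_iff)
  then have "Im s = 0" using has_sum_0_simp has_sum_unique by blast
  ultimately show ?thesis by (simp add: complex_nonneg_Reals_iff)
qed

lemma has_sum_finite_sum:
  fixes f :: "'b \<Rightarrow> 'c \<Rightarrow> 'd::{topological_comm_monoid_add}"
  assumes "\<And>i. i \<in> I \<Longrightarrow> (f i has_sum s i) L"
  shows "((\<lambda>l. \<Sum>i\<in>I. f i l) has_sum (\<Sum>i\<in>I. s i)) L"
  using assms by (induction I rule: infinite_finite_induct) (auto intro: has_sum_add)

lemma sesq_has_sum:
  assumes "finite I" "\<And>i j. i \<in> I \<Longrightarrow> j \<in> I \<Longrightarrow> ((\<lambda>l. A l i j) has_sum B i j) L"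
  shows "((\<lambda>l. sesq I (A l) c d) has_sum sesq I B c d) L"
  unfolding sesq_def using assms
  by (intro has_sum_finite_sum has_sum_cmult_left has_sum_cmult_right) auto

lemma reproducing_kernel_has_sum:
  assumes "\<And>l. l \<in> L \<Longrightarrow> reproducing_kernel X (K l)"
    and "\<And>x y. x \<in> X \<Longrightarrow> y \<in> X \<Longrightarrow> ((\<lambda>l. K l x y) has_sum M x y) L"
  shows "reproducing_kernel X M"
  unfolding reproducing_kernel_def psd_matrix_sesq
proof (intro allI impI)
  fix F c assume F: "finite F \<and> F \<subseteq> X"
  then have "((\<lambda>l. sesq F (K l) c c) has_sum sesq F M c c) L"
    using assms(2) by (intro sesq_has_sum) auto
  then show "sesq F M c c \<in> \<real>\<^sub>\<ge>\<^sub>0"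
  proof (rule has_sum_nonneg_Reals)
    fix l assume "l \<in> L"
    then show "sesq F (K l) c c \<in> \<real>\<^sub>\<ge>\<^sub>0"
      using F by (intro psd_sesq reproducing_kernelD[OF assms(1)]) auto
  qed
qed

section \<open>Reproducing kernel Hilbert spaces\<close>

lemma kernel_fun_apply: "w \<in> X \<Longrightarrow> z \<in> X \<Longrightarrow> kernel_fun X k w z = k z w"
  by (simp add: kernel_fun_def fun_on_def)

context rkhs
begin

lemma uminus_mem: "f \<in> H \<Longrightarrow> (\<lambda>x. - f x) \<in> H"
  using scale_mem[of f "-1"] by simp

lemma diff_mem: "f \<in> H \<Longrightarrow> g \<in> H \<Longrightarrow> (\<lambda>x. f x - g x) \<in> H"
  using add_mem[of f "\<lambda>x. - g x"] uminus_mem[of g] by simp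

lemma sum_mem: "(\<And>i. i \<in> I \<Longrightarrow> f i \<in> H) \<Longrightarrow> (\<lambda>x. \<Sum>i\<in>I. f i x) \<in> H"
  by (induction I rule: infinite_finite_induct) (auto intro: zero_mem add_mem)

lemma ip_zero: "h \<in> H \<Longrightarrow> ip (\<lambda>x. 0) h = 0"
  using ip_scale[of "\<lambda>x. 0" h 0] zero_mem by simp

lemma ip_sum:
  "(\<And>i. i \<in> I \<Longrightarrow> f i \<in> H) \<Longrightarrow> h \<in> H \<Longrightarrow> ip (\<lambda>x. \<Sum>i\<in>I. f i x) h = (\<Sum>i\<in>I. ip (f i) h)"
  by (induction I rule: infinite_finite_induct) (auto simp: ip_zero ip_add sum_mem)

lemma ip_add_right:
  "f \<in> H \<Longrightarrow> g \<in> H \<Longrightarrow> h \<in> H \<Longrightarrow> ip h (\<lambda>x. f x + g x) = ip h f + ip h g"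
  using ip_cnj[of "\<lambda>x. f x + g x" h] ip_cnj[of f h] ip_cnj[of g h] add_mem[of f g] ip_add[of f g h]
  by simp

lemma ip_scale_right: "f \<in> H \<Longrightarrow> h \<in> H \<Longrightarrow> ip h (\<lambda>x. c * f x) = cnj c * ip h f"
  using ip_cnj[of "\<lambda>x. c * f x" h] ip_cnj[of f h] scale_mem[of f c] ip_scale[of f h c] by simp

lemma ip_sum_right:
  "(\<And>i. i \<in> I \<Longrightarrow> f i \<in> H) \<Longrightarrow> h \<in> H \<Longrightarrow> ip h (\<lambda>x. \<Sum>i\<in>I. f i x) = (\<Sum>i\<in>I. ip h (f i))"
proof -
  assume a: "\<And>i. i \<in> I \<Longrightarrow> f i \<in> H" "h \<in> H"
  have "ip h (\<lambda>x. \<Sum>i\<in>I. f i x) = cnj (\<Sum>i\<in>I. ip (f i) h)"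
    using ip_cnj[of "\<lambda>x. \<Sum>i\<in>I. f i x" h] sum_mem[of I f] ip_sum[of I f h] a by simp
  also have "\<dots> = (\<Sum>i\<in>I. ip h (f i))"
    unfolding cnj_sum using a by (intro sum.cong) (simp_all flip: ip_cnj)
  finally show ?thesis .
qed

lemma ip_diff: "f \<in> H \<Longrightarrow> g \<in> H \<Longrightarrow> h \<in> H \<Longrightarrow> ip (\<lambda>x. f x - g x) h = ip f h - ip g h"
  using ip_add[of f "\<lambda>x. - 1 * g x" h] scale_mem[of g "-1"] ip_scale[of g h "-1"] by simp

lemma ip_diff_right: "f \<in> H \<Longrightarrow> g \<in> H \<Longrightarrow> h \<in> H \<Longrightarrow> ip h (\<lambda>x. f x - g x) = ip h f - ip h g"
  using ip_add_right[of f "\<lambda>x. - 1 * g x" h] scale_mem[of g "-1"] ip_scale_right[of g h "-1"] by simp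

lemma hnorm_nonneg: "f \<in> H \<Longrightarrow> 0 \<le> hnorm ip f"
  using ip_nonneg[of f] by (simp add: hnorm_def complex_nonneg_Reals_iff)

lemma hnorm_sq: "f \<in> H \<Longrightarrow> (hnorm ip f)\<^sup>2 = Re (ip f f)"
  using ip_nonneg[of f] by (simp add: hnorm_def complex_nonneg_Reals_iff)

lemma ip_self: "f \<in> H \<Longrightarrow> ip f f = of_real ((hnorm ip f)\<^sup>2)"
  using ip_nonneg[of f] by (simp add: hnorm_sq complex_nonneg_Reals_iff complex_eq_iff del: of_real_power)

lemma hnorm_sq_add_scale:
  assumes "f \<in> H" "g \<in> H"
  shows "(hnorm ip (\<lambda>x. f x + t * g x))\<^sup>2
    = (hnorm ip f)\<^sup>2 + 2 * Re (cnj t * ip f g) + (norm t)\<^sup>2 * (hnorm ip g)\<^sup>2"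
proof -
  note m = assms scale_mem[OF assms(2), of t] add_mem[OF assms(1) scale_mem[OF assms(2), of t]]
  have "ip (\<lambda>x. f x + t * g x) (\<lambda>x. f x + t * g x)
      = ip f f + cnj t * ip f g + t * ip g f + cnj t * t * ip g g"
    using m by (simp add: ip_add ip_add_right ip_scale ip_scale_right algebra_simps)
  also have "t * ip g f = cnj (cnj t * ip f g)"
    using ip_cnj[OF assms] by simp
  also have "cnj t * t = of_real ((norm t)\<^sup>2)" by (rule cnj_mult_self)
  finally show ?thesis using m by (simp add: hnorm_sq)
qed

lemma ip_cs:
  assumes "f \<in> H" "g \<in> H"
  shows "norm (ip f g) \<le> hnorm ip f * hnorm ip g"
proof -
  have "(norm (ip f g))\<^sup>2 \<le> (hnorm ip g)\<^sup>2 * (hnorm ip f)\<^sup>2"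
  proof (rule quadratic_nonneg_imp_cs)
    fix t
    have "0 \<le> (hnorm ip (\<lambda>x. f x + (- t) * g x))\<^sup>2" by simp
    then show "0 \<le> (hnorm ip f)\<^sup>2 - 2 * Re (cnj t * ip f g) + (norm t)\<^sup>2 * (hnorm ip g)\<^sup>2"
      unfolding hnorm_sq_add_scale[OF assms] by simp
  qed simp
  then have "(norm (ip f g))\<^sup>2 \<le> (hnorm ip f * hnorm ip g)\<^sup>2" by (simp add: power_mult_distrib mult.commute)
  then show ?thesis
    using hnorm_nonneg assms by (meson mult_nonneg_nonneg power2_le_imp_le)
qed

lemma hnorm_zero: "hnorm ip (\<lambda>x. 0) = 0"
  using ip_zero[OF zero_mem] by (simp add: hnorm_def)

lemma hnorm_scale: "f \<in> H \<Longrightarrow> hnorm ip (\<lambda>x. c * f x) = norm c * hnorm ip f"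
proof -
  assume f: "f \<in> H"
  have "(hnorm ip (\<lambda>x. c * f x))\<^sup>2 = (norm c * hnorm ip f)\<^sup>2"
    using hnorm_sq_add_scale[OF zero_mem f, of c] ip_zero[OF f]
    by (simp add: hnorm_zero power_mult_distrib)
  then show ?thesis
    using hnorm_nonneg[OF f] hnorm_nonneg[OF scale_mem[OF f]] by (simp add: power2_eq_iff_nonneg)
qed

lemma hnorm_triangle:
  assumes "f \<in> H" "g \<in> H"
  shows "hnorm ip (\<lambda>x. f x + g x) \<le> hnorm ip f + hnorm ip g"
proof -
  have "(hnorm ip (\<lambda>x. f x + g x))\<^sup>2 = (hnorm ip f)\<^sup>2 + 2 * Re (ip f g) + (hnorm ip g)\<^sup>2"
    using hnorm_sq_add_scale[OF assms, of 1] by simp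
  also have "Re (ip f g) \<le> hnorm ip f * hnorm ip g"
    using ip_cs[OF assms] complex_Re_le_cmod[of "ip f g"] by linarith
  finally have "(hnorm ip (\<lambda>x. f x + g x))\<^sup>2 \<le> (hnorm ip f + hnorm ip g)\<^sup>2"
    by (simp add: power2_sum algebra_simps)
  then show ?thesis
    using hnorm_nonneg assms by (meson add_nonneg_nonneg power2_le_imp_le)
qed

lemma hnorm_minus_commute: "f \<in> H \<Longrightarrow> g \<in> H \<Longrightarrow> hnorm ip (\<lambda>x. f x - g x) = hnorm ip (\<lambda>x. g x - f x)"
  using hnorm_scale[of "\<lambda>x. f x - g x" "-1"] diff_mem[of f g] by simp

lemma hnorm_diff_triangle:
  assumes "f \<in> H" "g \<in> H" "h \<in> H"
  shows "hnorm ip (\<lambda>x. f x - h x) \<le> hnorm ip (\<lambda>x. f x - g x) + hnorm ip (\<lambda>x. g x - h x)"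
  using hnorm_triangle[OF diff_mem[OF assms(1,2)] diff_mem[OF assms(2,3)]] by simp

lemma eval_bound:
  assumes "f \<in> H" "w \<in> X"
  shows "norm (f w) \<le> hnorm ip f * hnorm ip (kernel_fun X k w)"
  using ip_cs[OF assms(1) kernel_mem[OF assms(2)]] reproducing[OF assms] by simp

lemma hnorm_kernel:
  assumes "w \<in> X"
  shows "(hnorm ip (kernel_fun X k w))\<^sup>2 = Re (k w w)"
  using hnorm_sq[OF kernel_mem[OF assms]] reproducing[OF kernel_mem[OF assms] assms] assms
  by (simp add: kernel_fun_apply)

section \<open>Finite combinations of kernel functions, given by their coefficients\<close>

definition coeffs :: "('a \<Rightarrow> complex) set" where
  "coeffs = {c. finite {w. c w \<noteq> 0} \<and> {w. c w \<noteq> 0} \<subseteq> X}"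

definition kspan :: "('a \<Rightarrow> complex) \<Rightarrow> 'a \<Rightarrow> complex" where
  "kspan c x = (\<Sum>w | c w \<noteq> 0. c w * kernel_fun X k w x)"

lemma kspan_eq:
  "finite F \<Longrightarrow> {w. c w \<noteq> 0} \<subseteq> F \<Longrightarrow> kspan c = (\<lambda>x. \<Sum>w\<in>F. c w * kernel_fun X k w x)"
  unfolding kspan_def by (intro ext sum.mono_neutral_left) auto

lemma kspan_mem: "c \<in> coeffs \<Longrightarrow> kspan c \<in> H"
  unfolding kspan_def coeffs_def by (intro sum_mem scale_mem kernel_mem) auto

lemma ip_kspan:
  assumes "f \<in> H" "c \<in> coeffs"
  shows "ip f (kspan c) = (\<Sum>w | c w \<noteq> 0. cnj (c w) * f w)"
proof -
  have "w \<in> X" if "c w \<noteq> 0" for w using that assms(2) by (auto simp: coeffs_def)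
  then show ?thesis
    unfolding kspan_def using assms
    by (subst ip_sum_right) (auto simp: scale_mem kernel_mem ip_scale_right reproducing)
qed

lemma coeffs_add_scale:
  assumes "c \<in> coeffs" "d \<in> coeffs"
  shows "(\<lambda>w. c w + t * d w) \<in> coeffs"
proof -
  have "{w. c w + t * d w \<noteq> 0} \<subseteq> {w. c w \<noteq> 0} \<union> {w. d w \<noteq> 0}" by auto
  then show ?thesis
    using assms unfolding coeffs_def by (auto intro: finite_subset)
qed

text \<open>One computation for linear and conjugate-linear sums: \<sigma> is the identity for
  \<open>kspan\<close> and conjugation for pairings with \<open>kspan\<close>. The support of the
  combination may shrink by cancellation, hence the detour through the union.\<close>

lemma sum_supp_add_scale:
  fixes L :: "'a \<Rightarrow> complex" and \<sigma> :: "complex \<Rightarrow> complex"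
  assumes "c \<in> coeffs" "d \<in> coeffs" and \<sigma>: "\<And>a b. \<sigma> (a + t * b) = \<sigma> a + \<sigma>' * \<sigma> b" "\<sigma> 0 = 0"
  shows "(\<Sum>w | c w + t * d w \<noteq> 0. \<sigma> (c w + t * d w) * L w)
    = (\<Sum>w | c w \<noteq> 0. \<sigma> (c w) * L w) + \<sigma>' * (\<Sum>w | d w \<noteq> 0. \<sigma> (d w) * L w)"
proof -
  let ?F = "{w. c w \<noteq> 0} \<union> {w. d w \<noteq> 0}"
  have F: "finite ?F" using assms by (auto simp: coeffs_def)
  have "(\<Sum>w | c w + t * d w \<noteq> 0. \<sigma> (c w + t * d w) * L w) = (\<Sum>w\<in>?F. \<sigma> (c w + t * d w) * L w)"
    using F \<sigma>(2) by (intro sum.mono_neutral_left) auto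
  also have "\<dots> = (\<Sum>w\<in>?F. \<sigma> (c w) * L w) + \<sigma>' * (\<Sum>w\<in>?F. \<sigma> (d w) * L w)"
    by (simp only: \<sigma>(1)) (simp add: algebra_simps sum.distrib sum_distrib_left)
  also have "(\<Sum>w\<in>?F. \<sigma> (c w) * L w) = (\<Sum>w | c w \<noteq> 0. \<sigma> (c w) * L w)"
    using F \<sigma>(2) by (intro sum.mono_neutral_right) auto
  also have "(\<Sum>w\<in>?F. \<sigma> (d w) * L w) = (\<Sum>w | d w \<noteq> 0. \<sigma> (d w) * L w)"
    using F \<sigma>(2) by (intro sum.mono_neutral_right) auto
  finally show ?thesis .
qed

lemma kspan_add_scale:
  assumes "c \<in> coeffs" "d \<in> coeffs"
  shows "kspan (\<lambda>w. c w + t * d w) = (\<lambda>x. kspan c x + t * kspan d x)"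
  unfolding kspan_def using sum_supp_add_scale[OF assms, of "\<lambda>a. a" t t] by (intro ext) simp

lemma kspan_unit: "w \<in> X \<Longrightarrow> (\<lambda>v. if v = w then 1 else 0) \<in> coeffs"
    "kspan (\<lambda>v. if v = w then 1 else 0) = kernel_fun X k w"
proof -
  have "{v. (if v = w then 1 else 0 :: complex) \<noteq> 0} = {w}" by auto
  then show "kspan (\<lambda>v. if v = w then 1 else 0) = kernel_fun X k w"
    by (intro ext) (simp only: kspan_def, simp)
  show "(\<lambda>v. if v = w then 1 else 0) \<in> coeffs" if "w \<in> X"
    using that by (simp add: coeffs_def)
qed

lemma hnorm_kspan_sq:
  assumes "finite F" "F \<subseteq> X" "\<And>w. w \<notin> F \<Longrightarrow> c w = 0"
  shows "(hnorm ip (kspan c))\<^sup>2 = Re (sesq F k c c)"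
proof -
  have c: "c \<in> coeffs" and F: "{w. c w \<noteq> 0} \<subseteq> F"
    using assms by (auto simp: coeffs_def intro: finite_subset)
  have "ip (kspan c) (kspan c) = (\<Sum>w\<in>F. cnj (c w) * kspan c w)"
    unfolding ip_kspan[OF kspan_mem[OF c] c] using assms F by (intro sum.mono_neutral_left) auto
  also have "\<dots> = (\<Sum>w\<in>F. cnj (c w) * (\<Sum>v\<in>F. c v * k w v))"
    unfolding kspan_eq[OF assms(1) F] using assms(2)
    by (intro sum.cong refl arg_cong2[where f = "(*)"]) (auto simp: kernel_fun_apply subset_iff)
  also have "\<dots> = sesq F k c c"
    by (simp add: sesq_def sum_distrib_left mult_ac)
  finally show ?thesis using hnorm_sq[OF kspan_mem[OF c]] by simp
qed

text \<open>The quadratic form at \<open>c\<close> is the squared norm of the combination of kernel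
  functions with coefficients \<open>c\<close>.\<close>

lemma reproducing_kernel: "reproducing_kernel X k"
  unfolding reproducing_kernel_def psd_matrix_sesq
proof (intro allI impI)
  fix F and c :: "'a \<Rightarrow> complex" assume F: "finite F \<and> F \<subseteq> X"
  define d where "d = (\<lambda>w. if w \<in> F then c w else 0)"
  have d: "d \<in> coeffs" and sub: "{w. d w \<noteq> 0} \<subseteq> F"
    using F by (auto simp: coeffs_def d_def)
  have "ip (kspan d) (kspan d) = (\<Sum>w\<in>F. cnj (d w) * kspan d w)"
    unfolding ip_kspan[OF kspan_mem[OF d] d] using F sub by (intro sum.mono_neutral_left) auto
  also have "\<dots> = (\<Sum>w\<in>F. cnj (c w) * (\<Sum>v\<in>F. c v * k w v))"
    unfolding kspan_eq[OF conjunct1[OF F] sub] using F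
    by (intro sum.cong refl arg_cong2[where f = "(*)"]) (auto simp: kernel_fun_apply d_def subset_iff)
  also have "\<dots> = sesq F k c c"
    by (simp add: sesq_def sum_distrib_left mult_ac)
  finally show "sesq F k c c \<in> \<real>\<^sub>\<ge>\<^sub>0" using ip_nonneg[OF kspan_mem[OF d]] by simp
qed

text \<open>A function is in the space as soon as evaluation of it is bounded on combinations of kernel
  functions: it is the limit of a minimizing sequence for \<open>\<parallel>g\<parallel>\<^sup>2 - 2 Re \<langle>h, g\<rangle>\<close>, a functional that
  makes sense for \<open>g\<close> in the span of the kernel functions without knowing that \<open>h\<close> is in the space.\<close>

lemma membership_criterion:
  assumes supp: "\<And>x. x \<notin> X \<Longrightarrow> h x = 0" and C: "0 \<le> C"
    and bound: "\<And>c. c \<in> coeffs \<Longrightarrow> norm (\<Sum>w | c w \<noteq> 0. cnj (c w) * h w) \<le> C * hnorm ip (kspan c)"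
  shows "h \<in> H" and "hnorm ip h \<le> C" and "\<And>e. e > 0 \<Longrightarrow> \<exists>c\<in>coeffs. hnorm ip (\<lambda>x. h x - kspan c x) < e"
proof -
  define L where "L = (\<lambda>c. \<Sum>w | c w \<noteq> 0. cnj (c w) * h w)"
  define J where "J = (\<lambda>c. (hnorm ip (kspan c))\<^sup>2 - 2 * Re (L c))"
  have L_add: "L (\<lambda>w. c w + t * d w) = L c + cnj t * L d" if "c \<in> coeffs" "d \<in> coeffs" for c d t
    unfolding L_def by (rule sum_supp_add_scale[OF that]) auto
  have J_add: "J (\<lambda>w. c w + t * d w) = J c + 2 * Re (cnj t * (ip (kspan c) (kspan d) - L d))
      + (norm t)\<^sup>2 * (hnorm ip (kspan d))\<^sup>2" if "c \<in> coeffs" "d \<in> coeffs" for c d t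
    unfolding J_def kspan_add_scale[OF that] L_add[OF that] hnorm_sq_add_scale[OF that[THEN kspan_mem]]
    by (simp add: algebra_simps)
  \<comment> \<open>Completing the square; this is where boundedness of the evaluation enters,
    making the infimum of \<open>J\<close> finite.\<close>
  have J_lower: "- C\<^sup>2 \<le> J c" if "c \<in> coeffs" for c
  proof -
    have "Re (L c) \<le> C * hnorm ip (kspan c)"
      using bound[OF that] complex_Re_le_cmod[of "L c"] unfolding L_def by linarith
    moreover have "0 \<le> (hnorm ip (kspan c) - C)\<^sup>2" by simp
    ultimately show ?thesis unfolding J_def by (simp add: power2_diff algebra_simps)
  qed
  have zero: "(\<lambda>w. 0) \<in> coeffs" by (simp add: coeffs_def)
  define m where "m = (INF c\<in>coeffs. J c)"
  have bdd: "bdd_below (J ` coeffs)" using J_lower by (intro bdd_belowI2[of _ "- C\<^sup>2"])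
  have m_le: "m \<le> J c" if "c \<in> coeffs" for c
    unfolding m_def by (rule cINF_lower[OF bdd that])
  have "\<exists>c\<in>coeffs. J c < m + inverse (real (Suc n))" for n
    using cINF_less_iff[of coeffs J "m + inverse (real (Suc n))"] zero bdd unfolding m_def[symmetric] by auto
  then obtain c where c: "\<And>n. c n \<in> coeffs" "\<And>n. J (c n) < m + inverse (real (Suc n))" by metis
  \<comment> \<open>Parallelogram law: \<open>J\<close> is at least \<open>m\<close> at the midpoint
    of two coefficient families, so near-minimizers are close to each other.\<close>
  have dist: "(hnorm ip (\<lambda>x. kspan (c i) x - kspan (c j) x))\<^sup>2 \<le> 2 * (J (c i) - m) + 2 * (J (c j) - m)" for i j
  proof -
    let ?a = "kspan (c i)" and ?b = "kspan (c j)"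
    have ab: "?a \<in> H" "?b \<in> H" using c kspan_mem by auto
    have "m \<le> J (\<lambda>w. c i w + (1 / 2) * (c j w + (- 1) * c i w))"
      using c by (intro m_le coeffs_add_scale)
    also have "\<dots> = J (c i) + Re (ip ?a (kspan (\<lambda>w. c j w + (- 1) * c i w)) - L (\<lambda>w. c j w + (- 1) * c i w))
      + (1 / 4) * (hnorm ip (kspan (\<lambda>w. c j w + (- 1) * c i w)))\<^sup>2"
      by (subst J_add[OF c(1) coeffs_add_scale[OF c(1) c(1)]]) (simp add: power2_eq_square)
    also have "kspan (\<lambda>w. c j w + (- 1) * c i w) = (\<lambda>x. ?b x + (- 1) * ?a x)"
      by (rule kspan_add_scale[OF c(1) c(1)])
    also have "L (\<lambda>w. c j w + (- 1) * c i w) = L (c j) - L (c i)"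
      using L_add[OF c(1) c(1), of j "-1" i] by simp
    also have "ip ?a (\<lambda>x. ?b x + (- 1) * ?a x) = ip ?a ?b - of_real ((hnorm ip ?a)\<^sup>2)"
      using ip_diff_right[OF ab(2,1,1)] ip_self[OF ab(1)] by simp
    finally have 1: "m \<le> J (c i) + Re (ip ?a ?b) - (hnorm ip ?a)\<^sup>2 - Re (L (c j)) + Re (L (c i))
       + (1 / 4) * (hnorm ip (\<lambda>x. ?b x + (- 1) * ?a x))\<^sup>2" by simp
    have 2: "(hnorm ip (\<lambda>x. ?b x + (- 1) * ?a x))\<^sup>2 = (hnorm ip (\<lambda>x. ?a x - ?b x))\<^sup>2"
      using hnorm_minus_commute[OF ab] by simp
    have 3: "(hnorm ip (\<lambda>x. ?a x - ?b x))\<^sup>2 = (hnorm ip ?a)\<^sup>2 - 2 * Re (ip ?a ?b) + (hnorm ip ?b)\<^sup>2"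
      using hnorm_sq_add_scale[OF ab, of "-1"] by simp
    have arith: "D \<le> 2 * (A - 2 * a - m) + 2 * (B - 2 * b - m)"
      if "m \<le> A - 2 * a + R - A - b + a + (1 / 4) * D" "D = A - 2 * R + B" for A B D R a b m :: real
      using that by argo
    show ?thesis using 1 3 unfolding 2 J_def by (rule arith)
  qed
  have "\<exists>g\<in>H. (\<lambda>n. hnorm ip (\<lambda>x. kspan (c n) x - g x)) \<longlonglongrightarrow> 0"
  proof (rule complete_space)
    show "kspan (c n) \<in> H" for n using c kspan_mem by auto
    fix e :: real assume e: "e > 0"
    obtain N where N: "inverse (real (Suc N)) < e\<^sup>2 / 4"
      using reals_Archimedean[of "e\<^sup>2 / 4"] e by auto
    have "hnorm ip (\<lambda>x. kspan (c i) x - kspan (c j) x) < e" if "i \<ge> N" "j \<ge> N" for i j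
    proof -
      have small: "J (c n) - m < e\<^sup>2 / 4" if "n \<ge> N" for n
      proof -
        have "inverse (real (Suc n)) \<le> inverse (real (Suc N))" using that by simp
        then show ?thesis using c(2)[of n] N by linarith
      qed
      then have "(hnorm ip (\<lambda>x. kspan (c i) x - kspan (c j) x))\<^sup>2 < e\<^sup>2"
        using dist[of i j] small[OF that(1)] small[OF that(2)] by argo
      then show ?thesis using e by (intro power2_less_imp_less[of _ e]) auto
    qed
    then show "\<exists>N. \<forall>m\<ge>N. \<forall>n\<ge>N. hnorm ip (\<lambda>x. kspan (c m) x - kspan (c n) x) < e" by blast
  qed
  then obtain g where g: "g \<in> H" "(\<lambda>n. hnorm ip (\<lambda>x. kspan (c n) x - g x)) \<longlonglongrightarrow> 0" by blast
  have ip_lim: "(\<lambda>n. ip f (kspan (c n))) \<longlonglongrightarrow> ip f g" if "f \<in> H" for f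
  proof (rule Lim_null_comparison[THEN LIM_zero_cancel])
    show "\<forall>\<^sub>F n in sequentially. norm (ip f (kspan (c n)) - ip f g)
        \<le> hnorm ip f * hnorm ip (\<lambda>x. kspan (c n) x - g x)"
      using ip_cs[OF that diff_mem[OF kspan_mem[OF c(1)] g(1)]] g(1) that c(1)
      by (simp add: ip_diff_right kspan_mem)
    show "(\<lambda>n. hnorm ip f * hnorm ip (\<lambda>x. kspan (c n) x - g x)) \<longlonglongrightarrow> 0"
      using tendsto_mult_right_zero[OF g(2)] by simp
  qed
  have J_lim: "(\<lambda>n. J (c n) - m) \<longlonglongrightarrow> 0"
  proof (rule Lim_null_comparison)
    show "\<forall>\<^sub>F n in sequentially. norm (J (c n) - m) \<le> inverse (real (Suc n))"
      using c m_le by (intro always_eventually allI) (smt (verit) real_norm_def)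
  qed (rule LIMSEQ_inverse_real_of_nat)
  have "g w = h w" for w
  proof (cases "w \<in> X")
    case True
    let ?u = "\<lambda>v. if v = w then 1 else 0 :: complex"
    note u = kspan_unit(1)[OF True] kspan_unit(2)[of w]
    let ?K = "(hnorm ip (kernel_fun X k w))\<^sup>2"
    \<comment> \<open>First variation of \<open>J\<close> in the direction of the kernel function at
      \<open>w\<close>: a near-minimizer can gain little from any multiple \<open>t\<close> of it,
      so its value at \<open>w\<close> is close to \<open>h w\<close>.\<close>
    have "(norm (- (ip (kspan (c n)) (kspan ?u) - L ?u)))\<^sup>2 \<le> ?K * (J (c n) - m)" for n
    proof (rule quadratic_nonneg_imp_cs)
      fix t
      have "m \<le> J (\<lambda>v. c n v + t * ?u v)" using c u by (intro m_le coeffs_add_scale)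
      then show "0 \<le> J (c n) - m - 2 * Re (cnj t * - (ip (kspan (c n)) (kspan ?u) - L ?u)) + (norm t)\<^sup>2 * ?K"
        unfolding J_add[OF c(1) u(1)] using u(2) by (simp add: algebra_simps)
    qed simp
    moreover have "ip (kspan (c n)) (kspan ?u) = kspan (c n) w" for n
      unfolding u(2) using c kspan_mem reproducing True by auto
    moreover have "L ?u = h w" by (simp add: L_def)
    ultimately have *: "(norm (kspan (c n) w - h w))\<^sup>2 \<le> ?K * (J (c n) - m)" for n
      by (metis norm_minus_cancel)
    have "(\<lambda>n. (norm (kspan (c n) w - h w))\<^sup>2) \<longlonglongrightarrow> 0"
    proof (rule Lim_null_comparison)
      show "\<forall>\<^sub>F n in sequentially. norm ((norm (kspan (c n) w - h w))\<^sup>2) \<le> ?K * (J (c n) - m)"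
        using * by simp
      show "(\<lambda>n. ?K * (J (c n) - m)) \<longlonglongrightarrow> 0" using tendsto_mult_right_zero[OF J_lim] by simp
    qed
    then have "(\<lambda>n. sqrt ((norm (kspan (c n) w - h w))\<^sup>2)) \<longlonglongrightarrow> sqrt 0"
      by (rule tendsto_real_sqrt)
    then have "(\<lambda>n. norm (kspan (c n) w - h w)) \<longlonglongrightarrow> 0"
      by (simp only: real_sqrt_zero real_sqrt_abs abs_norm_cancel)
    then have "(\<lambda>n. kspan (c n) w - h w) \<longlonglongrightarrow> 0"
      by (rule tendsto_norm_zero_cancel)
    then have "(\<lambda>n. kspan (c n) w) \<longlonglongrightarrow> h w" by (simp add: LIM_zero_iff)
    moreover have "(\<lambda>n. kspan (c n) w) \<longlonglongrightarrow> g w"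
    proof (rule Lim_null_comparison[THEN LIM_zero_cancel])
      show "\<forall>\<^sub>F n in sequentially. norm (kspan (c n) w - g w)
          \<le> hnorm ip (\<lambda>x. kspan (c n) x - g x) * hnorm ip (kernel_fun X k w)"
        using eval_bound[OF diff_mem[OF kspan_mem[OF c(1)] g(1)] True] by simp
      show "(\<lambda>n. hnorm ip (\<lambda>x. kspan (c n) x - g x) * hnorm ip (kernel_fun X k w)) \<longlonglongrightarrow> 0"
        using tendsto_mult_left_zero[OF g(2)] by simp
    qed
    ultimately show ?thesis using LIMSEQ_unique by blast
  qed (simp add: support[OF g(1)] supp)
  then have gh: "g = h" by auto
  show hH: "h \<in> H" using g gh by simp
  show "\<exists>c\<in>coeffs. hnorm ip (\<lambda>x. h x - kspan c x) < e" if "e > 0" for e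
  proof -
    have "\<forall>\<^sub>F n in sequentially. hnorm ip (\<lambda>x. kspan (c n) x - g x) < e"
      using order_tendstoD(2)[OF g(2) that] .
    then obtain n where "hnorm ip (\<lambda>x. kspan (c n) x - g x) < e"
      by (meson eventually_happens' sequentially_bot)
    then show ?thesis
      using hnorm_minus_commute[OF kspan_mem[OF c(1)] g(1)] c(1) gh by auto
  qed
  \<comment> \<open>The hypothesis is applied to the combinations \<open>c n\<close>, which converge
    to \<open>h\<close>, and the limit is taken.\<close>
  have "(hnorm ip h)\<^sup>2 \<le> C * hnorm ip h"
  proof (rule LIMSEQ_le)
    have "(\<lambda>n. norm (ip h (kspan (c n)))) \<longlonglongrightarrow> norm (ip h h)"
      using tendsto_norm[OF ip_lim[OF hH]] gh by simp
    also have "norm (ip h h) = (hnorm ip h)\<^sup>2" using ip_self[OF hH] by (simp add: norm_power)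
    finally show "(\<lambda>n. norm (ip h (kspan (c n)))) \<longlonglongrightarrow> (hnorm ip h)\<^sup>2" .
    show "(\<lambda>n. C * (hnorm ip h + hnorm ip (\<lambda>x. kspan (c n) x - h x))) \<longlonglongrightarrow> C * hnorm ip h"
      using tendsto_mult[OF tendsto_const tendsto_add[OF tendsto_const g(2)], of C "hnorm ip h"] gh by simp
    have "norm (ip h (kspan (c n))) \<le> C * (hnorm ip h + hnorm ip (\<lambda>x. kspan (c n) x - h x))" for n
    proof -
      have "norm (ip h (kspan (c n))) \<le> C * hnorm ip (kspan (c n))"
        unfolding ip_kspan[OF hH c(1)] by (rule bound[OF c(1)])
      moreover have "hnorm ip (kspan (c n)) \<le> hnorm ip h + hnorm ip (\<lambda>x. kspan (c n) x - h x)"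
        using hnorm_triangle[OF hH diff_mem[OF kspan_mem[OF c(1)] hH], of n] by simp
      ultimately show ?thesis using C by (meson mult_left_mono order_trans)
    qed
    then show "\<exists>N. \<forall>n\<ge>N. norm (ip h (kspan (c n))) \<le> C * (hnorm ip h + hnorm ip (\<lambda>x. kspan (c n) x - h x))"
      by blast
  qed
  then show "hnorm ip h \<le> C"
    using hnorm_nonneg[OF hH] C by (cases "hnorm ip h = 0") (auto simp: power2_eq_square)
qed

text \<open>An element of the space satisfies the hypotheses of \<open>membership_criterion\<close>
  with its own norm as constant, and the minimizing sequence constructed there approximates
  it.\<close>

lemma kspan_dense:
  assumes "f \<in> H" "e > 0"
  shows "\<exists>c\<in>coeffs. hnorm ip (\<lambda>x. f x - kspan c x) < e"
proof (rule membership_criterion(3)[OF _ _ _ assms(2)])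
  show "f x = 0" if "x \<notin> X" for x using support[OF assms(1) that] .
  show "0 \<le> hnorm ip f" by (rule hnorm_nonneg[OF assms(1)])
  show "norm (\<Sum>w | c w \<noteq> 0. cnj (c w) * f w) \<le> hnorm ip f * hnorm ip (kspan c)" if "c \<in> coeffs" for c
    using ip_cs[OF assms(1) kspan_mem[OF that]] ip_kspan[OF assms(1) that] by simp
qed

text \<open>Positivity bounds the pairing of \<open>h\<close> with each combination by
  \<open>C\<close> times the norm of the combination, as \<open>membership_criterion\<close>
  demands. Together with the converse \<open>dominated_by_norm\<close> it reduces membership and
  norm estimates to positivity of kernels.\<close>

lemma kernel_dominated_mem:
  assumes "\<And>x. x \<notin> X \<Longrightarrow> h x = 0" "0 \<le> C"
    and psd: "reproducing_kernel X (\<lambda>x y. of_real (C\<^sup>2) * k x y - h x * cnj (h y))"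
  shows "h \<in> H" and "hnorm ip h \<le> C"
proof -
  have "norm (\<Sum>w | c w \<noteq> 0. cnj (c w) * h w) \<le> C * hnorm ip (kspan c)" if c: "c \<in> coeffs" for c
  proof -
    let ?F = "{w. c w \<noteq> 0}" and ?s = "\<Sum>w | c w \<noteq> 0. cnj (c w) * h w"
    have F: "finite ?F" "?F \<subseteq> X" using c by (auto simp: coeffs_def)
    have nrm: "(hnorm ip (kspan c))\<^sup>2 = Re (sesq ?F k c c)" by (rule hnorm_kspan_sq[OF F]) simp
    have "(\<Sum>j | c j \<noteq> 0. cnj (h j) * c j) = cnj ?s" by (simp add: mult.commute)
    then have "sesq ?F (\<lambda>x y. of_real (C\<^sup>2) * k x y - h x * cnj (h y)) c c
        = of_real (C\<^sup>2) * sesq ?F k c c - cnj ?s * ?s"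
      unfolding sesq_diff sesq_cmult sesq_rank1 by (simp only: mult.commute[of ?s])
    moreover have "Re (sesq ?F (\<lambda>x y. of_real (C\<^sup>2) * k x y - h x * cnj (h y)) c c) \<ge> 0"
      using psd_sesq[OF reproducing_kernelD[OF psd F], of c] unfolding complex_nonneg_Reals_iff by (rule conjunct1)
    ultimately have "0 \<le> Re (of_real (C\<^sup>2) * sesq ?F k c c - of_real ((norm ?s)\<^sup>2))"
      unfolding cnj_mult_self by (simp only:)
    then have "(norm ?s)\<^sup>2 \<le> C\<^sup>2 * (hnorm ip (kspan c))\<^sup>2"
      unfolding nrm by simp
    then have "(norm ?s)\<^sup>2 \<le> (C * hnorm ip (kspan c))\<^sup>2" by (simp add: power_mult_distrib)
    then show ?thesis
      using assms(2) hnorm_nonneg[OF kspan_mem[OF c]] by (meson mult_nonneg_nonneg power2_le_imp_le)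
  qed
  note bound = this
  show "h \<in> H" by (rule membership_criterion(1)[OF assms(1,2) bound])
  show "hnorm ip h \<le> C" by (rule membership_criterion(2)[OF assms(1,2) bound])
qed

lemma dominated_by_norm:
  assumes "f \<in> H"
  shows "reproducing_kernel X (\<lambda>x y. of_real ((hnorm ip f)\<^sup>2) * k x y - f x * cnj (f y))"
  unfolding reproducing_kernel_def psd_matrix_sesq
proof (intro allI impI)
  fix F and c :: "'a \<Rightarrow> complex" assume F: "finite F \<and> F \<subseteq> X"
  define d where "d = (\<lambda>w. if w \<in> F then c w else 0)"
  have d: "d \<in> coeffs" and sub: "{w. d w \<noteq> 0} \<subseteq> F"
    using F by (auto simp: coeffs_def d_def)
  let ?s = "\<Sum>w\<in>F. cnj (c w) * f w"
  have "ip f (kspan d) = (\<Sum>w\<in>F. cnj (d w) * f w)"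
    unfolding ip_kspan[OF assms d] using F sub by (intro sum.mono_neutral_left) auto
  also have "\<dots> = ?s" by (simp add: d_def)
  finally have 1: "ip f (kspan d) = ?s" .
  have "sesq F k d d = sesq F k c c" unfolding sesq_def d_def by (intro sum.cong) auto
  then have 2: "(hnorm ip (kspan d))\<^sup>2 = Re (sesq F k c c)"
    using hnorm_kspan_sq[of F d] F unfolding d_def by presburger
  have 3: "(norm ?s)\<^sup>2 \<le> (hnorm ip f)\<^sup>2 * Re (sesq F k c c)"
    using power_mono[OF ip_cs[OF assms kspan_mem[OF d]], of 2] unfolding 1
    by (simp add: power_mult_distrib 2)
  have "(\<Sum>j\<in>F. cnj (f j) * c j) = cnj ?s" by (simp add: mult.commute)
  then have "sesq F (\<lambda>x y. of_real ((hnorm ip f)\<^sup>2) * k x y - f x * cnj (f y)) c c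
        = of_real ((hnorm ip f)\<^sup>2) * sesq F k c c - cnj ?s * ?s"
    unfolding sesq_diff sesq_cmult sesq_rank1 by (simp only: mult.commute[of ?s])
  then have "sesq F (\<lambda>x y. of_real ((hnorm ip f)\<^sup>2) * k x y - f x * cnj (f y)) c c
        = of_real ((hnorm ip f)\<^sup>2) * sesq F k c c - of_real ((norm ?s)\<^sup>2)"
    unfolding cnj_mult_self .
  moreover have "sesq F k c c \<in> \<real>\<^sub>\<ge>\<^sub>0"
    using F by (intro psd_sesq reproducing_kernelD[OF reproducing_kernel]) auto
  ultimately show "sesq F (\<lambda>x y. of_real ((hnorm ip f)\<^sup>2) * k x y - f x * cnj (f y)) c c \<in> \<real>\<^sub>\<ge>\<^sub>0"
    using 3 by (simp add: complex_nonneg_Reals_iff del: of_real_power)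
qed

end

section \<open>From contractive multipliers to positive kernels\<close>

context rkhs
begin

text \<open>The adjoint of a contraction is a contraction, in elementary form. With \<open>h\<close>
  the first row of \<open>\<Phi> f\<close>, one has \<open>T = ip h (kspan d)\<close>, while
  contractivity gives \<open>(hnorm ip h)\<^sup>2 \<le> T\<close>; Cauchy-Schwarz then bounds
  \<open>T\<close> by the squared norm of \<open>kspan d\<close>.\<close>

lemma contractive_multiplier_psd:
  assumes \<Phi>: "contractive_matrix_multiplier X H ip m \<Phi>" and m: "0 < m"
  shows "reproducing_kernel X (\<lambda>x y. (1 - (\<Sum>b<m. \<Phi> x 0 b * cnj (\<Phi> y 0 b))) * k x y)"
  unfolding reproducing_kernel_def psd_matrix_sesq
proof (intro allI impI)
  fix F and c :: "'a \<Rightarrow> complex" assume F: "finite F \<and> F \<subseteq> X"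
  define d where "d = (\<lambda>w. if w \<in> F then c w else 0)"
  \<comment> \<open>The combinations \<open>kspan (e b)\<close> are the components of the adjoint of
    the first row of \<Phi> applied to \<open>kspan d\<close>.\<close>
  define e where "e = (\<lambda>b w. cnj (\<Phi> w 0 b) * d w)"
  define f where "f = (\<lambda>b. kspan (e b))"
  define h where "h = fun_on X (\<lambda>x. \<Sum>b<m. \<Phi> x 0 b * f b x)"
  define T where "T = (\<Sum>b<m. (hnorm ip (f b))\<^sup>2)"
  have dF: "d w = 0" if "w \<notin> F" for w using that by (simp add: d_def)
  have eF: "e b w = 0" if "w \<notin> F" for b w using that by (simp add: e_def dF)
  have d: "d \<in> coeffs" and e: "e b \<in> coeffs" for b
    using F dF eF by (auto simp: coeffs_def intro!: finite_subset[of _ F])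
  have fH: "f b \<in> H" for b unfolding f_def by (rule kspan_mem[OF e])
  have h: "h \<in> H" and hT: "(hnorm ip h)\<^sup>2 \<le> T"
  proof -
    have *: "(\<forall>a<m. fun_on X (\<lambda>x. \<Sum>b<m. \<Phi> x a b * f b x) \<in> H)"
        "(\<Sum>a<m. (hnorm ip (fun_on X (\<lambda>x. \<Sum>b<m. \<Phi> x a b * f b x)))\<^sup>2) \<le> T"
      using \<Phi> fH unfolding contractive_matrix_multiplier_def T_def by blast+
    then show "h \<in> H" using m unfolding h_def by blast
    have "(hnorm ip h)\<^sup>2 \<le> (\<Sum>a<m. (hnorm ip (fun_on X (\<lambda>x. \<Sum>b<m. \<Phi> x a b * f b x)))\<^sup>2)"
      unfolding h_def using m by (intro member_le_sum[of 0 "{..<m}" "\<lambda>a. (hnorm ip (fun_on X (\<lambda>x. \<Sum>b<m. \<Phi> x a b * f b x)))\<^sup>2"]) auto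
    then show "(hnorm ip h)\<^sup>2 \<le> T" using *(2) by linarith
  qed
  have ipF: "ip g (kspan q) = (\<Sum>w\<in>F. cnj (q w) * g w)"
    if "g \<in> H" "q \<in> coeffs" "\<And>w. w \<notin> F \<Longrightarrow> q w = 0" for g q
    unfolding ip_kspan[OF that(1,2)] using that(3) F by (intro sum.mono_neutral_left) auto
  have "of_real T = (\<Sum>b<m. ip (f b) (f b))"
    unfolding T_def of_real_sum using ip_self[OF fH] by (intro sum.cong refl) simp
  also have "\<dots> = (\<Sum>b<m. \<Sum>w\<in>F. cnj (e b w) * f b w)"
  proof (rule sum.cong[OF refl])
    fix b
    show "ip (f b) (f b) = (\<Sum>w\<in>F. cnj (e b w) * f b w)"
      using ipF[OF fH e eF, of b b] unfolding f_def .
  qed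
  also have "\<dots> = (\<Sum>w\<in>F. \<Sum>b<m. cnj (e b w) * f b w)" by (rule sum.swap)
  also have "\<dots> = (\<Sum>w\<in>F. cnj (d w) * h w)"
  proof (rule sum.cong[OF refl])
    fix w assume "w \<in> F"
    then have "w \<in> X" using F by blast
    then show "(\<Sum>b<m. cnj (e b w) * f b w) = cnj (d w) * h w"
      by (simp add: e_def h_def fun_on_def sum_distrib_left mult_ac)
  qed
  also have "\<dots> = ip h (kspan d)" by (rule ipF[OF h d dF, symmetric])
  finally have T: "of_real T = ip h (kspan d)" .
  have T0: "0 \<le> T" unfolding T_def by (intro sum_nonneg) auto
  have "norm (complex_of_real T) \<le> hnorm ip h * hnorm ip (kspan d)"
    unfolding T by (rule ip_cs[OF h kspan_mem[OF d]])
  then have "T \<le> hnorm ip h * hnorm ip (kspan d)" using T0 by simp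
  then have "T\<^sup>2 \<le> (hnorm ip h)\<^sup>2 * (hnorm ip (kspan d))\<^sup>2"
    unfolding power_mult_distrib[symmetric] using T0 by (intro power_mono)
  also have "\<dots> \<le> T * (hnorm ip (kspan d))\<^sup>2" using hT by (simp add: mult_right_mono)
  finally have Tg: "T \<le> (hnorm ip (kspan d))\<^sup>2"
    using T0 by (cases "T = 0") (auto simp: power2_eq_square)
  have nd: "(hnorm ip (kspan d))\<^sup>2 = Re (sesq F k c c)"
  proof -
    have "sesq F k d d = sesq F k c c" unfolding sesq_def d_def by (intro sum.cong) auto
    then show ?thesis using hnorm_kspan_sq[OF _ _ dF] F by auto
  qed
  have ne: "(hnorm ip (f b))\<^sup>2 = Re (sesq F (\<lambda>x y. \<Phi> x 0 b * cnj (\<Phi> y 0 b) * k x y) c c)" for b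
  proof -
    have "sesq F k (e b) (e b) = sesq F (\<lambda>x y. \<Phi> x 0 b * cnj (\<Phi> y 0 b) * k x y) c c"
      unfolding sesq_def e_def d_def by (intro sum.cong) (auto simp: mult_ac)
    moreover have "(hnorm ip (kspan (e b)))\<^sup>2 = Re (sesq F k (e b) (e b))"
      using F by (intro hnorm_kspan_sq eF) auto
    ultimately show ?thesis unfolding f_def by simp
  qed
  define S where "S = sesq F (\<lambda>x y. (1 - (\<Sum>b<m. \<Phi> x 0 b * cnj (\<Phi> y 0 b))) * k x y) c c"
  have S: "S = sesq F k c c - (\<Sum>b<m. sesq F (\<lambda>x y. \<Phi> x 0 b * cnj (\<Phi> y 0 b) * k x y) c c)"
    unfolding S_def sesq_sum[symmetric] sesq_diff[symmetric]
    by (intro sesq_cong) (simp add: algebra_simps sum_distrib_left)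
  have "Re S \<ge> 0"
    using Tg unfolding S T_def nd ne by simp
  moreover have "Im S = 0"
  proof -
    have k: "reproducing_kernel X (\<lambda>x y. \<Phi> x 0 b * cnj (\<Phi> y 0 b) * k x y)" for b
      by (rule reproducing_kernel_mult[OF reproducing_kernel_rank1 reproducing_kernel])
    have "Im (sesq F k c c) = 0"
      using psd_sesq[OF reproducing_kernelD[OF reproducing_kernel], of F c] F
      by (simp add: complex_nonneg_Reals_iff)
    moreover have "Im (sesq F (\<lambda>x y. \<Phi> x 0 b * cnj (\<Phi> y 0 b) * k x y) c c) = 0" for b
      using psd_sesq[OF reproducing_kernelD[OF k[of b]], of F c] F
      by (simp add: complex_nonneg_Reals_iff)
    ultimately show ?thesis unfolding S by simp
  qed
  ultimately show "sesq F (\<lambda>x y. (1 - (\<Sum>b<m. \<Phi> x 0 b * cnj (\<Phi> y 0 b))) * k x y) c c \<in> \<real>\<^sub>\<ge>\<^sub>0"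
    unfolding S_def[symmetric] by (simp add: complex_nonneg_Reals_iff)
qed

end

section \<open>Necessity in the McCullough-Quiggin theorem\<close>

text \<open>The Pick property speaks of square matrices, so a row vector is padded by zero rows;
  contractivity is then Cauchy-Schwarz.\<close>

lemma contractive_matrix_row:
  assumes "(\<Sum>b<m. (norm (B b))\<^sup>2) \<le> 1"
  shows "contractive_matrix m (\<lambda>a b. if a = (0::nat) then B b else 0)"
  unfolding contractive_matrix_def
proof
  fix v
  have "(norm (\<Sum>b<m. B b * v b))\<^sup>2 \<le> (\<Sum>b<m. norm (B b) * norm (v b))\<^sup>2"
    by (intro power_mono order_trans[OF norm_sum]) (auto simp: norm_mult)
  also have "\<dots> \<le> (\<Sum>b<m. (norm (B b))\<^sup>2) * (\<Sum>b<m. (norm (v b))\<^sup>2)"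
    by (rule Cauchy_Schwarz_ineq_sum)
  also have "\<dots> \<le> 1 * (\<Sum>b<m. (norm (v b))\<^sup>2)"
    using assms by (intro mult_right_mono sum_nonneg) auto
  finally have *: "(norm (\<Sum>b<m. B b * v b))\<^sup>2 \<le> (\<Sum>b<m. (norm (v b))\<^sup>2)" by simp
  have "(\<Sum>a<m. (norm (\<Sum>b<m. (if a = 0 then B b else 0) * v b))\<^sup>2)
      = (\<Sum>a<m. if a = 0 then (norm (\<Sum>b<m. B b * v b))\<^sup>2 else 0)"
    by (intro sum.cong) auto
  also have "\<dots> \<le> (\<Sum>b<m. (norm (v b))\<^sup>2)"
    using * by (cases "0 < m") (auto intro: sum_nonneg)
  finally show "(\<Sum>a<m. (norm (\<Sum>b<m. (if a = 0 then B b else 0) * v b))\<^sup>2) \<le> (\<Sum>b<m. (norm (v b))\<^sup>2)" .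
qed

text \<open>The argument is Knese's. If row vectors \<open>B\<^sub>i\<close> factor \<open>1 - 1 / s\<close> on a finite set containing the
  base point, then \<open>(1 - B\<^sub>i B\<^sub>j\<^sup>*) s(z\<^sub>i, z\<^sub>j) = 1\<close>, so they are interpolated by a contractive
  multiplier. Its value at one more point adds a row and a column to the all-ones matrix, and positivity
  forces the new off-diagonal entries to be equal to the one at the base point, which is \<open>1\<close>.\<close>

lemma complete_pick_kernel_psd:
  assumes pick: "complete_pick_kernel X s" and o: "p \<in> X"
    and norm1: "\<And>z. z \<in> X \<Longrightarrow> s z p = 1" and nz: "\<And>z w. z \<in> X \<Longrightarrow> w \<in> X \<Longrightarrow> s z w \<noteq> 0"
  shows "reproducing_kernel X (\<lambda>z w. 1 - 1 / s z w)"
proof -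
  obtain H ip where R: "rkhs X s H ip" and P0:
    "\<forall>N m z W. (\<forall>i<N. z i \<in> X) \<and> (\<forall>i<N. contractive_matrix m (W i)) \<and>
          psd_matrix ({..<N} \<times> {..<m}) (pick_matrix s m z W) \<longrightarrow>
          (\<exists>\<Phi>. contractive_matrix_multiplier X H ip m \<Phi> \<and>
               (\<forall>i<N. \<forall>a<m. \<forall>b<m. \<Phi> (z i) a b = W i a b))"
    using pick unfolding complete_pick_kernel_def by (elim exE conjE)
  have P: "\<exists>\<Phi>. contractive_matrix_multiplier X H ip m \<Phi> \<and>
               (\<forall>i<N. \<forall>a<m. \<forall>b<m. \<Phi> (z i) a b = W i a b)"
    if "\<forall>i<N. z i \<in> X" "\<forall>i<N. contractive_matrix m (W i)"
      "psd_matrix ({..<N} \<times> {..<m}) (pick_matrix s m z W)" for N m z W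
    using P0[THEN spec[of _ N], THEN spec[of _ m], THEN spec[of _ z], THEN spec[of _ W]] that by fast
  interpret rkhs X s H ip by (rule R)
  note rk = reproducing_kernel
  have sdiag: "s z z = of_real (Re (s z z))" "Re (s z z) > 0" if "z \<in> X" for z
  proof -
    have "Re (s z z) \<ge> 0" "Im (s z z) = 0" "s z z \<noteq> 0"
      using reproducing_kernel_diag[OF rk that] nz[OF that that] by (auto simp: complex_nonneg_Reals_iff)
    then show "s z z = of_real (Re (s z z))" "Re (s z z) > 0"
      by (auto simp: complex_eq_iff less_le)
  qed
  have snorm1: "s p z = 1" if "z \<in> X" for z
    using reproducing_kernel_hermitian[OF rk that o] norm1[OF that] by simp
  \<comment> \<open>Points are added one at a time, each lengthening the vectors by one coordinate;
    \<open>0 < m\<close> guarantees that the padded matrices have a first row. The base point stays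
    at index \<open>0\<close>.\<close>
  have main: "\<exists>(m::nat) B. 0 < m \<and> (\<forall>i\<le>n. \<forall>j\<le>n. (\<Sum>e<m. B i e * cnj (B j e)) = 1 - 1 / s (z i) (z j))"
    if "\<forall>i\<le>n. z i \<in> X" "z 0 = p" for n :: nat and z
    using that
  proof (induction n)
    case 0
    then show ?case using norm1[OF o] by (intro exI[of _ 1] exI[of _ "\<lambda>_ _. 0"]) auto
  next
    case (Suc n)
    have "\<exists>(m::nat) B. 0 < m \<and> (\<forall>i\<le>n. \<forall>j\<le>n. (\<Sum>e<m. B i e * cnj (B j e)) = 1 - 1 / s (z i) (z j))"
      using Suc.prems by (intro Suc.IH) auto
    then obtain m :: nat and B where m: "0 < m"
      and B: "\<And>i j. i \<le> n \<Longrightarrow> j \<le> n \<Longrightarrow> (\<Sum>e<m. B i e * cnj (B j e)) = 1 - 1 / s (z i) (z j)" by blast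
    have zX: "z i \<in> X" if "i \<le> Suc n" for i using Suc.prems that by blast
    have Bsq: "(\<Sum>e<m. B i e * cnj (B i e)) = of_real (\<Sum>e<m. (norm (B i e))\<^sup>2)" for i
      by (simp add: complex_norm_square del: of_real_power)
    define W where "W = (\<lambda>i a b. if a = (0::nat) then B i b else 0)"
    define w where "w = z (Suc n)"
    have wX: "w \<in> X" unfolding w_def by (rule zX) simp
    have "\<exists>\<Phi>. contractive_matrix_multiplier X H ip m \<Phi> \<and>
               (\<forall>i<Suc n. \<forall>a<m. \<forall>b<m. \<Phi> (z i) a b = W i a b)"
    proof (rule P)
      show "\<forall>i<Suc n. z i \<in> X" using zX by simp
      show "\<forall>i<Suc n. contractive_matrix m (W i)"
      proof (intro allI impI)
        fix i assume "i < Suc n"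
        then have i: "i \<le> n" "z i \<in> X" using zX by auto
        have "complex_of_real (\<Sum>e<m. (norm (B i e))\<^sup>2) = 1 - 1 / of_real (Re (s (z i) (z i)))"
          unfolding Bsq[symmetric] B[OF i(1,1)] using sdiag(1)[OF i(2)] by argo
        also have "\<dots> = of_real (1 - 1 / Re (s (z i) (z i)))" by simp
        finally have "(\<Sum>e<m. (norm (B i e))\<^sup>2) = 1 - 1 / Re (s (z i) (z i))"
          unfolding of_real_eq_iff .
        then have "(\<Sum>e<m. (norm (B i e))\<^sup>2) \<le> 1" using sdiag(2)[OF i(2)] by simp
        then show "contractive_matrix m (W i)" unfolding W_def by (rule contractive_matrix_row)
      qed
      \<comment> \<open>The Pick matrix is block diagonal in the inner index: all ones in block
        \<open>0\<close>, where the factorization cancels \<open>s\<close>, and \<open>s\<close>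
        itself in the zero rows. \<open>K l\<close> is block \<open>l\<close>.\<close>
      define K where "K = (\<lambda>l (pa::nat \<times> nat) (qb::nat \<times> nat).
          (if snd pa = l then 1 else 0) * cnj (if snd qb = l then 1 else 0)
            * (if l = 0 then 1 else s (z (fst pa)) (z (fst qb))))"
      have "reproducing_kernel ({..<Suc n} \<times> {..<m}) (\<lambda>pa qb. \<Sum>l<m. K l pa qb)"
      proof (rule reproducing_kernel_sum)
        fix l :: nat
        have "reproducing_kernel ({..<Suc n} \<times> {..<m}) (\<lambda>pa qb. if l = 0 then 1 else s (z (fst pa)) (z (fst qb)))"
          using reproducing_kernel_pullback[OF rk, of "{..<Suc n} \<times> {..<m}" "\<lambda>pa. z (fst pa)"] zX
          by (cases "l = 0") (auto intro: reproducing_kernel_one)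
        then show "reproducing_kernel ({..<Suc n} \<times> {..<m}) (K l)"
          unfolding K_def
          by (rule reproducing_kernel_mult[OF reproducing_kernel_rank1[of _ "\<lambda>pa. if snd pa = l then 1 else 0"]])
      qed
      then have psd: "psd_matrix ({..<Suc n} \<times> {..<m}) (\<lambda>pa qb. \<Sum>l<m. K l pa qb)"
        by (rule reproducing_kernelD) auto
      have pm: "pick_matrix s m z W pa qb = (\<Sum>l<m. K l pa qb)"
        if "pa \<in> {..<Suc n} \<times> {..<m}" "qb \<in> {..<Suc n} \<times> {..<m}" for pa qb
      proof -
        obtain i a j b where ab: "pa = (i, a)" "qb = (j, b)" by fastforce
        have ij: "i \<le> n" "j \<le> n" "a < m" "b < m" using that ab by auto
        have "(\<Sum>l<m. K l pa qb) = (\<Sum>l<m. if l = a then (if b = a then (if a = 0 then 1 else s (z i) (z j)) else 0) else 0)"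
          unfolding K_def ab by (intro sum.cong) auto
        also have "\<dots> = (if b = a then (if a = 0 then 1 else s (z i) (z j)) else 0)"
          using ij by simp
        also have "\<dots> = pick_matrix s m z W pa qb"
        proof (cases "a = 0 \<and> b = 0")
          case True
          then show ?thesis
            unfolding pick_matrix_def ab W_def using B[OF ij(1,2)] nz[OF zX zX, of i j] ij by simp
        next
          case False
          then show ?thesis unfolding pick_matrix_def ab W_def by auto
        qed
        finally show ?thesis by simp
      qed
      have "psd_matrix ({..<Suc n} \<times> {..<m}) (pick_matrix s m z W)
          = psd_matrix ({..<Suc n} \<times> {..<m}) (\<lambda>pa qb. \<Sum>l<m. K l pa qb)"
        by (rule psd_matrix_cong) (rule pm)
      then show "psd_matrix ({..<Suc n} \<times> {..<m}) (pick_matrix s m z W)"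
        using psd by (simp only:)
    qed
    then obtain \<Phi> where \<Phi>: "contractive_matrix_multiplier X H ip m \<Phi>"
      and \<Phi>B: "\<And>i b. i \<le> n \<Longrightarrow> b < m \<Longrightarrow> \<Phi> (z i) 0 b = B i b"
      using m unfolding W_def by fastforce
    define K where "K = (\<lambda>x y. (1 - (\<Sum>b<m. \<Phi> x 0 b * cnj (\<Phi> y 0 b))) * s x y)"
    have K: "reproducing_kernel X K" unfolding K_def by (rule contractive_multiplier_psd[OF \<Phi> m])
    have K1: "K (z i) (z j) = 1" if "i \<le> n" "j \<le> n" for i j
      using B[OF that] nz[OF zX zX, of i j] that unfolding K_def by (simp add: \<Phi>B)
    have K1p: "K p p = 1" "K (z i) p = 1" "K p (z i) = 1" if "i \<le> n" for i
      using K1[of 0 0] K1[of i 0] K1[of 0 i] that Suc.prems(2) by auto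
    \<comment> \<open>The vector at the base point has squared norm
      \<open>1 - 1 / s p p = 0\<close>, so it is orthogonal to the unknown value at
      \<open>w\<close>.\<close>
    have B0: "B 0 e = 0" if "e < m" for e
    proof -
      have "complex_of_real (\<Sum>e<m. (norm (B 0 e))\<^sup>2) = 0"
        using B[of 0 0] unfolding Bsq by (simp add: Suc.prems(2) norm1 o)
      then have "(\<Sum>e<m. (norm (B 0 e))\<^sup>2) = 0" unfolding of_real_eq_0_iff .
      then show ?thesis using that by (subst (asm) sum_nonneg_eq_0_iff) auto
    qed
    have Kpw: "K p w = 1"
      using \<Phi>B[of 0] B0 snorm1[OF wX] Suc.prems(2) unfolding K_def by simp
    then have Kwp: "K w p = 1" using reproducing_kernel_hermitian[OF K o wX] by simp
    \<comment> \<open>Subtracting the part determined by the base point leaves zero diagonal entries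
      at the old points, and Cauchy-Schwarz makes their entries against \<open>w\<close> vanish as
      well.\<close>
    have K': "reproducing_kernel X (\<lambda>x y. K x y - K x p * K p y)"
      using reproducing_kernel_schur_complement[OF K o] K1p(1)[of 0] by simp
    have Kzw: "K (z i) w = 1" if "i \<le> n" for i
    proof -
      have "(norm (K (z i) w - K (z i) p * K p w))\<^sup>2 \<le> 0"
        using reproducing_kernel_cs[OF K' zX wX, of i] K1p[OF that] K1[OF that that] that by simp
      then show ?thesis using K1p[OF that] Kpw by simp
    qed
    have Kww: "Re (K w w) \<ge> 1" "Im (K w w) = 0"
      using reproducing_kernel_diag[OF K' wX] Kpw Kwp by (auto simp: complex_nonneg_Reals_iff)
    define q where "q = (\<Sum>b<m. (norm (\<Phi> w 0 b))\<^sup>2)"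
    have q: "(\<Sum>b<m. \<Phi> w 0 b * cnj (\<Phi> w 0 b)) = of_real q"
      by (simp add: q_def complex_norm_square del: of_real_power)
    define sw where "sw = Re (s w w)"
    have sw: "s w w = of_real sw" "sw > 0" using sdiag[OF wX] by (auto simp: sw_def)
    have "K w w = of_real ((1 - q) * sw)" unfolding K_def q sw by simp
    then have "(1 - q) * sw \<ge> 1" using Kww by simp
    then have eps: "1 - 1 / sw - q \<ge> 0" using sw(2) by (simp add: field_simps)
    have Kzw': "(\<Sum>e<m. B i e * cnj (\<Phi> w 0 e)) = 1 - 1 / s (z i) w" if "i \<le> n" for i
      using Kzw[OF that] nz[OF zX wX, of i] that unfolding K_def by (simp add: \<Phi>B field_simps)
    have Kwz': "(\<Sum>e<m. \<Phi> w 0 e * cnj (B i e)) = 1 - 1 / s w (z i)" if "i \<le> n" for i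
    proof -
      have "(\<Sum>e<m. \<Phi> w 0 e * cnj (B i e)) = cnj (\<Sum>e<m. B i e * cnj (\<Phi> w 0 e))"
        by (simp add: mult.commute)
      also have "\<dots> = 1 - 1 / s w (z i)"
        unfolding Kzw'[OF that] using reproducing_kernel_hermitian[OF rk zX wX, of i] that by simp
      finally show ?thesis .
    qed
    \<comment> \<open>The interpolated value at \<open>w\<close> has the right inner products with
      the old vectors but may be too short. \<open>K w w \<ge> 1\<close> says exactly that the
      missing squared length is nonnegative, and the new coordinate supplies it.\<close>
    define B' where "B' = (\<lambda>i e. if e < m then (if i = Suc n then \<Phi> w 0 e else B i e)
        else if i = Suc n then complex_of_real (sqrt (1 - 1 / sw - q)) else 0)"
    have sq: "complex_of_real (sqrt (1 - 1 / sw - q)) * of_real (sqrt (1 - 1 / sw - q)) = 1 - 1 / of_real sw - of_real q"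
      using eps unfolding of_real_mult[symmetric] by simp
    have "(\<Sum>e<Suc m. B' i e * cnj (B' j e)) = 1 - 1 / s (z i) (z j)" if ij: "i \<le> Suc n" "j \<le> Suc n" for i j
    proof -
      consider "i \<le> n" "j \<le> n" | "i \<le> n" "j = Suc n" | "i = Suc n" "j \<le> n" | "i = Suc n" "j = Suc n"
        using ij by linarith
      then show ?thesis
      proof cases
        case 1 then show ?thesis using B[OF 1] by (simp add: B'_def)
      next
        case 2 then show ?thesis using Kzw'[of i] by (simp add: B'_def w_def)
      next
        case 3 then show ?thesis using Kwz'[of j] by (simp add: B'_def w_def)
      next
        case 4 then show ?thesis using q sq sw(1) by (simp add: B'_def w_def)
      qed
    qed
    then show ?case by blast
  qed
  show ?thesis
    unfolding reproducing_kernel_def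
  proof (intro allI impI)
    fix F assume F: "finite F \<and> F \<subseteq> X"
    obtain g where g: "bij_betw g {0..<card F} F"
      using ex_bij_betw_nat_finite F by blast
    \<comment> \<open>Index \<open>0\<close> is reserved for the base point, so the points of
      \<open>F\<close> are shifted by one.\<close>
    define z where "z = (\<lambda>i. case i of 0 \<Rightarrow> p | Suc i' \<Rightarrow> if i' < card F then g i' else p)"
    have "\<forall>i\<le>card F. z i \<in> X"
      using g F o by (auto simp: z_def bij_betw_def split: nat.splits)
    moreover have "z 0 = p" by (simp add: z_def)
    ultimately obtain m :: nat and B where
      B: "\<And>i j. i \<le> card F \<Longrightarrow> j \<le> card F \<Longrightarrow> (\<Sum>e<m. B i e * cnj (B j e)) = 1 - 1 / s (z i) (z j)"
      using main[of "card F" z] by blast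
    define r where "r = (\<lambda>x. Suc (inv_into {0..<card F} g x))"
    have r: "r x \<le> card F" "z (r x) = x" if "x \<in> F" for x
    proof -
      have "inv_into {0..<card F} g x \<in> {0..<card F}" "g (inv_into {0..<card F} g x) = x"
        using that g inv_into_into[of x g "{0..<card F}"] f_inv_into_f[of x g "{0..<card F}"]
        by (auto simp: bij_betw_def)
      then show "r x \<le> card F" "z (r x) = x" by (auto simp: r_def z_def)
    qed
    show "psd_matrix F (\<lambda>z w. 1 - 1 / s z w)"
    proof (rule psd_matrix_gramI[where m = m and V = "\<lambda>x. B (r x)"])
      fix x y assume "x \<in> F" "y \<in> F"
      then show "1 - 1 / s x y = (\<Sum>l<m. B (r x) l * cnj (B (r y) l))"
        using B[OF r(1) r(1), of x y] by (simp add: r(2))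
    qed (use F in simp)
  qed
qed

section \<open>Multipliers\<close>

context rkhs
begin

text \<open>With \<open>n\<close> the norm of \<open>f\<close>, the kernel dominating
  \<open>\<phi> f\<close> splits as \<open>n\<^sup>2\<close> times the assumed kernel plus
  \<open>\<phi> \<phi>\<^sup>*\<close> times the kernel of \<open>dominated_by_norm\<close>.\<close>

lemma multiplier_criterion:
  assumes supp: "\<And>x. x \<notin> X \<Longrightarrow> \<phi> x = 0" and C: "0 \<le> C"
    and psd: "reproducing_kernel X (\<lambda>x y. (of_real (C\<^sup>2) - \<phi> x * cnj (\<phi> y)) * k x y)"
    and f: "f \<in> H"
  shows "(\<lambda>x. \<phi> x * f x) \<in> H" and "hnorm ip (\<lambda>x. \<phi> x * f x) \<le> C * hnorm ip f"
proof -
  let ?n = "hnorm ip f"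
  have "reproducing_kernel X (\<lambda>x y. of_real (?n\<^sup>2) * ((of_real (C\<^sup>2) - \<phi> x * cnj (\<phi> y)) * k x y)
      + \<phi> x * cnj (\<phi> y) * (of_real (?n\<^sup>2) * k x y - f x * cnj (f y)))"
    by (intro reproducing_kernel_add reproducing_kernel_scale reproducing_kernel_mult
        reproducing_kernel_rank1 psd dominated_by_norm[OF f])
      (simp add: complex_nonneg_Reals_iff del: of_real_power)
  also have "(\<lambda>x y. of_real (?n\<^sup>2) * ((of_real (C\<^sup>2) - \<phi> x * cnj (\<phi> y)) * k x y)
      + \<phi> x * cnj (\<phi> y) * (of_real (?n\<^sup>2) * k x y - f x * cnj (f y)))
    = (\<lambda>x y. of_real ((C * ?n)\<^sup>2) * k x y - (\<phi> x * f x) * cnj (\<phi> y * f y))"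
    by (intro ext) (simp add: algebra_simps power_mult_distrib)
  finally have "reproducing_kernel X (\<lambda>x y. of_real ((C * ?n)\<^sup>2) * k x y - (\<phi> x * f x) * cnj (\<phi> y * f y))" .
  note K = this
  have 0: "\<phi> x * f x = 0" if "x \<notin> X" for x using supp that by simp
  have 1: "0 \<le> C * ?n" using C hnorm_nonneg[OF f] by simp
  show "(\<lambda>x. \<phi> x * f x) \<in> H" by (rule kernel_dominated_mem(1)[OF 0 1 K])
  show "hnorm ip (\<lambda>x. \<phi> x * f x) \<le> C * hnorm ip f" by (rule kernel_dominated_mem(2)[OF 0 1 K])
qed

text \<open>The factor \<open>b w w - b x w * b w y\<close> is \<open>b w w * (1 - b x y)\<close>
  plus the Schur complement of \<open>b\<close> at \<open>w\<close>; multiplied by \<open>k\<close>,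
  both summands are positive.\<close>

lemma kernel_section_multiplier:
  assumes b: "reproducing_kernel X b" and bk: "reproducing_kernel X (\<lambda>x y. (1 - b x y) * k x y)"
    and w: "w \<in> X" and f: "f \<in> H"
  shows "(\<lambda>x. fun_on X (\<lambda>z. b z w) x * f x) \<in> H"
    and "hnorm ip (\<lambda>x. fun_on X (\<lambda>z. b z w) x * f x) \<le> sqrt (Re (b w w)) * hnorm ip f"
proof -
  let ?\<phi> = "fun_on X (\<lambda>z. b z w)"
  have bw: "b w w \<in> \<real>\<^sub>\<ge>\<^sub>0" by (rule reproducing_kernel_diag[OF b w])
  have rew: "Re (b w w) \<ge> 0" "of_real ((sqrt (Re (b w w)))\<^sup>2) = b w w"
    using bw by (auto simp: complex_nonneg_Reals_iff complex_eq_iff simp del: of_real_power)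
  have "reproducing_kernel X (\<lambda>x y. b w w * ((1 - b x y) * k x y) + (b w w * b x y - b x w * b w y) * k x y)"
    by (intro reproducing_kernel_add reproducing_kernel_scale reproducing_kernel_mult bk bw
        reproducing_kernel_schur_complement[OF b w] reproducing_kernel)
  moreover have "b w w * ((1 - b x y) * k x y) + (b w w * b x y - b x w * b w y) * k x y
      = (of_real ((sqrt (Re (b w w)))\<^sup>2) - ?\<phi> x * cnj (?\<phi> y)) * k x y" if "x \<in> X" "y \<in> X" for x y
    unfolding rew(2) using that reproducing_kernel_hermitian[OF b that(2) w]
    by (simp add: fun_on_def algebra_simps)
  ultimately have K: "reproducing_kernel X (\<lambda>x y. (of_real ((sqrt (Re (b w w)))\<^sup>2) - ?\<phi> x * cnj (?\<phi> y)) * k x y)"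
    by (rule reproducing_kernel_congD)
  have 0: "?\<phi> x = 0" if "x \<notin> X" for x using that by (simp add: fun_on_def)
  have 1: "0 \<le> sqrt (Re (b w w))" using rew by simp
  show "(\<lambda>x. fun_on X (\<lambda>z. b z w) x * f x) \<in> H" by (rule multiplier_criterion(1)[OF 0 1 K f])
  show "hnorm ip (\<lambda>x. fun_on X (\<lambda>z. b z w) x * f x) \<le> sqrt (Re (b w w)) * hnorm ip f"
    by (rule multiplier_criterion(2)[OF 0 1 K f])
qed

end

text \<open>A tensor product is the Schur product of the kernels pulled back along the coordinate
  projections, so this setting covers both product constructions.\<close>

locale cnp_family =
  fixes X :: "'a set" and t :: "'p::finite \<Rightarrow> 'a \<Rightarrow> 'a \<Rightarrow> complex" and p :: 'a
  assumes base: "p \<in> X"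
    and t_psd: "\<And>j. reproducing_kernel X (t j)"
    and t_nz: "\<And>j z w. z \<in> X \<Longrightarrow> w \<in> X \<Longrightarrow> t j z w \<noteq> 0"
    and t_norm: "\<And>j z. z \<in> X \<Longrightarrow> t j z p = 1"
    and b_psd: "\<And>j. reproducing_kernel X (\<lambda>z w. 1 - 1 / t j z w)"
begin

definition b :: "'p \<Rightarrow> 'a \<Rightarrow> 'a \<Rightarrow> complex" where "b j z w = 1 - 1 / t j z w"

lemma b_kernel: "reproducing_kernel X (b j)"
  using b_psd unfolding b_def[abs_def] .

lemma b_diag:
  assumes "z \<in> X"
  shows "0 \<le> Re (b j z z)" "Re (b j z z) < 1" "Im (b j z z) = 0"
    and "t j z z = of_real (1 / (1 - Re (b j z z)))"
proof -
  show b0: "0 \<le> Re (b j z z)" "Im (b j z z) = 0"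
    using reproducing_kernel_diag[OF b_kernel assms] by (auto simp: complex_nonneg_Reals_iff)
  then have bt: "1 / t j z z = of_real (1 - Re (b j z z))" by (simp add: b_def complex_eq_iff)
  have "t j z z = of_real (Re (t j z z))" "Re (t j z z) \<ge> 0"
    using reproducing_kernel_diag[OF t_psd assms, of j] by (auto simp: complex_nonneg_Reals_iff complex_eq_iff)
  moreover have "t j z z \<noteq> 0" by (rule t_nz[OF assms assms])
  ultimately have "Re (t j z z) > 0" by (metis less_eq_real_def of_real_0)
  then have "1 / Re (t j z z) > 0" by simp
  moreover have "Re (1 / t j z z) = 1 / Re (t j z z)"
    using \<open>t j z z = of_real (Re (t j z z))\<close> by (metis Re_complex_of_real of_real_1 of_real_divide)
  ultimately have "Re (1 / t j z z) > 0" by simp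
  then show "Re (b j z z) < 1" unfolding bt by simp
  show "t j z z = of_real (1 / (1 - Re (b j z z)))"
    using bt by (metis div_by_1 divide_divide_eq_right mult_1 of_real_1 of_real_divide)
qed

text \<open>Cauchy-Schwarz from the diagonal, where \<open>1 - b j z z\<close> is the reciprocal of
  a positive number. The bound is uniform in \<open>w\<close>, which is what the Schwarz lemma will
  use.\<close>

lemma norm_b_less_1:
  assumes "z \<in> X" "w \<in> X"
  shows "norm (b j z w) < 1"
proof -
  have "(norm (b j z w))\<^sup>2 \<le> Re (b j z z) * Re (b j w w)"
    by (rule reproducing_kernel_cs[OF b_kernel assms])
  also have "\<dots> < 1"
    using b_diag(1,2)[OF assms(1), of j] b_diag(1,2)[OF assms(2), of j]
    by (meson less_eq_real_def mult_le_one mult_less_cancel_left1 not_less order_le_less_trans mult_left_le)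
  finally show ?thesis by (metis norm_ge_zero one_power2 power2_less_imp_less zero_le_one)
qed

text \<open>The factor \<open>1 - b j\<close> cancels \<open>t j\<close> and leaves the product of
  the remaining kernels.\<close>

lemma schur_div_psd: "reproducing_kernel X (\<lambda>x y. (1 - b j x y) * schur_product t x y)"
proof -
  have "reproducing_kernel X (\<lambda>x y. \<Prod>i\<in>UNIV - {j}. t i x y)"
    by (intro reproducing_kernel_prod t_psd)
  moreover have "(\<Prod>i\<in>UNIV - {j}. t i x y) = (1 - b j x y) * schur_product t x y"
    if "x \<in> X" "y \<in> X" for x y
    using t_nz[OF that, of j] by (simp add: b_def schur_product_def prod.remove[of UNIV j "\<lambda>i. t i x y"])
  ultimately show ?thesis by (rule reproducing_kernel_congD)
qed

lemma schur_norm: "z \<in> X \<Longrightarrow> schur_product t z p = 1"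
  by (simp add: schur_product_def t_norm)

lemma one_eq_kernel: "fun_on X (\<lambda>z. 1) = kernel_fun X (schur_product t) p"
  by (auto simp: fun_on_def kernel_fun_def schur_norm)

end

locale cnp_space = cnp_family X t p + rkhs X "schur_product t" H ip
  for X :: "'a set" and t :: "'p::finite \<Rightarrow> 'a \<Rightarrow> 'a \<Rightarrow> complex" and p H ip
begin

lemma one_mem: "fun_on X (\<lambda>z. 1) \<in> H"
  unfolding one_eq_kernel by (rule kernel_mem[OF base])

text \<open>\<open>1 / t j\<close> is \<open>1 - b j\<close>, and multiplication by
  \<open>b j\<close> at \<open>w\<close> has norm at most \<open>sqrt (Re (b j w w)) < 1\<close>;
  hence the constant \<open>2\<close>.\<close>

lemma inverse_multiplier:
  assumes w: "w \<in> X" and f: "f \<in> H"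
  shows "(\<lambda>x. fun_on X (\<lambda>z. 1 / t j z w) x * f x) \<in> H"
    and "hnorm ip (\<lambda>x. fun_on X (\<lambda>z. 1 / t j z w) x * f x) \<le> 2 * hnorm ip f"
proof -
  let ?g = "\<lambda>x. fun_on X (\<lambda>z. b j z w) x * f x"
  note g = kernel_section_multiplier[OF b_kernel schur_div_psd w f, of j]
  have eq: "(\<lambda>x. fun_on X (\<lambda>z. 1 / t j z w) x * f x) = (\<lambda>x. f x - ?g x)"
  proof
    fix x
    show "fun_on X (\<lambda>z. 1 / t j z w) x * f x = f x - ?g x"
      by (cases "x \<in> X") (auto simp: fun_on_def b_def support[OF f] algebra_simps)
  qed
  show "(\<lambda>x. fun_on X (\<lambda>z. 1 / t j z w) x * f x) \<in> H"
    unfolding eq by (rule diff_mem[OF f g(1)])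
  have "hnorm ip (\<lambda>x. f x - ?g x) \<le> hnorm ip f + hnorm ip ?g"
    using hnorm_triangle[OF f uminus_mem[OF g(1)]] hnorm_scale[OF g(1), of "-1"] by simp
  also have "hnorm ip ?g \<le> 1 * hnorm ip f"
    using b_diag(1,2)[OF w, of j] hnorm_nonneg[OF f]
    by (intro order_trans[OF g(2)] mult_right_mono) auto
  finally show "hnorm ip (\<lambda>x. fun_on X (\<lambda>z. 1 / t j z w) x * f x) \<le> 2 * hnorm ip f"
    unfolding eq by simp
qed

lemma inverse_mem: "w \<in> X \<Longrightarrow> fun_on X (\<lambda>z. 1 / t j z w) \<in> H"
proof -
  assume w: "w \<in> X"
  have "(\<lambda>x. fun_on X (\<lambda>z. 1 / t j z w) x * fun_on X (\<lambda>z. 1) x) = fun_on X (\<lambda>z. 1 / t j z w)"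
    by (auto simp: fun_on_def)
  then show ?thesis using inverse_multiplier(1)[OF w one_mem, of j] by simp
qed

lemma multiplicative_imp_product:
  assumes mult: "multiplicative_functional H \<Lambda>" and one: "\<Lambda> (fun_on X (\<lambda>z. 1)) = 1" and w: "w \<in> X"
  shows "\<Lambda> (kernel_fun X (schur_product t) w) * (\<Prod>j\<in>UNIV. \<Lambda> (fun_on X (\<lambda>z. 1 / t j z w))) = 1"
proof -
  let ?k = "kernel_fun X (schur_product t) w"
  \<comment> \<open>Membership is part of the induction: multiplicativity of \<Lambda> may be
    invoked only for products that stay in \<open>H\<close>, and the multiplier property ensures
    that.\<close>
  have "(\<lambda>x. ?k x * (\<Prod>j\<in>J. fun_on X (\<lambda>z. 1 / t j z w) x)) \<in> H \<and>
      \<Lambda> (\<lambda>x. ?k x * (\<Prod>j\<in>J. fun_on X (\<lambda>z. 1 / t j z w) x))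
        = \<Lambda> ?k * (\<Prod>j\<in>J. \<Lambda> (fun_on X (\<lambda>z. 1 / t j z w)))" if "finite J" for J :: "'p set"
    using that
  proof induction
    case empty
    then show ?case using kernel_mem[OF w] by simp
  next
    case (insert j J)
    let ?f = "fun_on X (\<lambda>z. 1 / t j z w)"
      and ?g = "\<lambda>x. ?k x * (\<Prod>j\<in>J. fun_on X (\<lambda>z. 1 / t j z w) x)"
    have g: "?g \<in> H" using insert.IH by blast
    have fg: "(\<lambda>x. ?f x * ?g x) \<in> H" by (rule inverse_multiplier(1)[OF w g])
    have "\<Lambda> (\<lambda>x. ?f x * ?g x) = \<Lambda> ?f * \<Lambda> ?g"
      by (rule mult[unfolded multiplicative_functional_def, rule_format, OF inverse_mem[OF w] g fg])
    moreover have "(\<lambda>x. ?k x * (\<Prod>j\<in>insert j J. fun_on X (\<lambda>z. 1 / t j z w) x)) = (\<lambda>x. ?f x * ?g x)"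
      using insert.hyps by (simp add: mult_ac)
    ultimately show ?case using fg insert by simp
  qed
  from this[of UNIV] have
    "\<Lambda> (\<lambda>x. ?k x * (\<Prod>j\<in>UNIV. fun_on X (\<lambda>z. 1 / t j z w) x))
        = \<Lambda> ?k * (\<Prod>j\<in>UNIV. \<Lambda> (fun_on X (\<lambda>z. 1 / t j z w)))" by simp
  moreover have "(\<lambda>x. ?k x * (\<Prod>j\<in>UNIV. fun_on X (\<lambda>z. 1 / t j z w) x)) = fun_on X (\<lambda>z. 1)"
  proof
    fix x
    show "?k x * (\<Prod>j\<in>UNIV. fun_on X (\<lambda>z. 1 / t j z w) x) = fun_on X (\<lambda>z. 1) x"
      by (cases "x \<in> X")
        (simp_all add: fun_on_def kernel_fun_def schur_product_def prod.distrib[symmetric] t_nz w)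
  qed
  ultimately show ?thesis using one by simp
qed

end

section \<open>Complex lines\<close>

text \<open>What the one-variable arguments along complex lines require of a scalar multiplication,
  so that a single development covers points and tuples of points.\<close>

locale complex_scaling =
  fixes sc :: "complex \<Rightarrow> 'a::real_normed_vector \<Rightarrow> 'a"
  assumes sc_linear: "\<And>v. bounded_linear (\<lambda>c. sc c v)"
    and sc_one: "\<And>v. sc 1 v = v"
    and sc_norm: "\<And>c v. norm (sc c v) = norm c * norm v"
begin

lemma sc_zero: "sc 0 v = 0"
  using sc_norm[of 0 v] by simp

lemma line_derivative: "((\<lambda>\<zeta>. a + sc \<zeta> v) has_derivative (\<lambda>h. sc h v)) (at \<zeta>)"
  using has_derivative_add[OF has_derivative_const bounded_linear_imp_has_derivative[OF sc_linear]] by simp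

lemma line_continuous: "continuous_on S (\<lambda>\<zeta>. a + sc \<zeta> v)"
  by (intro continuous_intros bounded_linear.continuous_on[OF sc_linear])

lemma holomorphic_on_line:
  assumes f: "holomorphic_mv sc f X" and S: "\<And>\<zeta>. \<zeta> \<in> S \<Longrightarrow> a + sc \<zeta> v \<in> X"
  shows "(\<lambda>\<zeta>. f (a + sc \<zeta> v)) holomorphic_on S"
  unfolding holomorphic_on_def
proof
  fix \<zeta> assume "\<zeta> \<in> S"
  then obtain D where D: "(f has_derivative D) (at (a + sc \<zeta> v))" "\<And>c v. D (sc c v) = c * D v"
    using f S unfolding holomorphic_mv_def by blast
  have "((\<lambda>\<zeta>. f (a + sc \<zeta> v)) has_derivative (\<lambda>h. D (sc h v))) (at \<zeta>)"
    by (rule has_derivative_compose[OF line_derivative D(1)])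
  moreover have "(\<lambda>h. D (sc h v)) = (*) (D v)" using D(2) by (auto simp: mult.commute)
  ultimately have "((\<lambda>\<zeta>. f (a + sc \<zeta> v)) has_field_derivative D v) (at \<zeta>)"
    by (simp add: has_field_derivative_def)
  then show "(\<lambda>\<zeta>. f (a + sc \<zeta> v)) field_differentiable at \<zeta> within S"
    using field_differentiable_at_within field_differentiable_def by blast
qed

text \<open>The part of a complex line inside a ball is convex; its connectedness is needed for
  analytic continuation along the line.\<close>

lemma line_ball:
  fixes S defines "S \<equiv> \<lambda>a v c r. {\<zeta>. a + sc \<zeta> v \<in> ball c r}"
  shows "open (S a v c r)" and "connected (S a v c r)"
proof -
  have "open ((\<lambda>\<zeta>. a + sc \<zeta> v) -` ball c r)"
    using line_continuous by (intro open_vimage) auto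
  then show "open (S a v c r)" by (simp add: S_def vimage_def)
  have "convex ((\<lambda>\<zeta>. sc \<zeta> v) -` ((+) (- a) ` ball c r))"
    using sc_linear by (intro convex_linear_vimage bounded_linear.linear convex_translation convex_ball)
  also have "(\<lambda>\<zeta>. sc \<zeta> v) -` ((+) (- a) ` ball c r) = S a v c r"
  proof -
    have "x \<in> (+) (- a) ` ball c r \<longleftrightarrow> a + x \<in> ball c r" for x
      by (metis (no_types, lifting) add.left_inverse add.assoc add_0 image_iff minus_add_cancel)
    then show ?thesis by (auto simp: S_def)
  qed
  finally show "connected (S a v c r)" by (rule convex_connected)
qed

text \<open>Schwarz lemma on the disc of the complex line through \<open>a\<close> and
  \<open>z\<close>. The difference \<open>f - f a\<close> is bounded by 2, so it is halved first,
  whence the factor \<open>2\<close>. The constant depends only on \<open>R\<close> and is therefore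
  common to all functions \<open>b j\<close> with fixed second argument.\<close>

lemma bounded_holomorphic_lipschitz:
  assumes f: "holomorphic_mv sc f X" and X: "ball a R \<subseteq> X" and R: "0 < R"
    and bd: "\<And>z. z \<in> X \<Longrightarrow> norm (f z) < 1" and z: "z \<in> ball a R"
  shows "norm (f z - f a) \<le> 2 * norm (z - a) / R"
proof (cases "z = a")
  case False
  define v where "v = z - a"
  have v: "norm v > 0" "norm v < R" using False z by (auto simp: v_def dist_norm norm_minus_commute)
  define \<rho> where "\<rho> = complex_of_real (R / norm v)"
  have in_ball: "a + sc (\<rho> * \<zeta>) v \<in> ball a R" if "norm \<zeta> < 1" for \<zeta>
    using that v R by (simp add: dist_norm sc_norm \<rho>_def norm_mult norm_divide)
  define g where "g = (\<lambda>\<zeta>. (f (a + sc (\<rho> * \<zeta>) v) - f a) / 2)"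
  have hol: "(\<lambda>\<zeta>. f (a + sc \<zeta> v)) holomorphic_on ((*) \<rho> ` ball 0 1)"
    using in_ball X by (intro holomorphic_on_line[OF f]) auto
  have "((\<lambda>\<zeta>. f (a + sc \<zeta> v)) \<circ> (*) \<rho>) holomorphic_on ball 0 1"
    by (rule holomorphic_on_compose[OF _ hol]) (intro holomorphic_intros)
  then have "g holomorphic_on ball 0 1"
    unfolding g_def comp_def by (intro holomorphic_intros) auto
  moreover have "g 0 = 0" by (simp add: g_def sc_zero)
  moreover have "norm (g \<zeta>) < 1" if "norm \<zeta> < 1" for \<zeta>
  proof -
    have "norm (f (a + sc (\<rho> * \<zeta>) v)) < 1" using bd in_ball[OF that] X by blast
    moreover have "norm (f a) < 1" using X R by (intro bd) auto
    ultimately have "norm (f (a + sc (\<rho> * \<zeta>) v) - f a) < 2"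
      using norm_triangle_ineq4[of "f (a + sc (\<rho> * \<zeta>) v)" "f a"] by linarith
    then show ?thesis by (simp add: g_def norm_divide)
  qed
  moreover define \<xi> where "\<xi> = complex_of_real (norm v / R)"
  moreover have "norm \<xi> < 1" using v R by (simp add: \<xi>_def norm_divide)
  ultimately have "norm (g \<xi>) \<le> norm \<xi>" using Schwarz_Lemma(1) by blast
  moreover have "\<rho> * \<xi> = 1" using v R by (simp add: \<rho>_def \<xi>_def)
  ultimately have "norm (f z - f a) / 2 \<le> norm v / R"
    using R by (simp add: g_def sc_one v_def norm_divide \<xi>_def)
  then show ?thesis by (simp add: v_def mult.commute)
qed simp

end

section \<open>Uniqueness\<close>

locale cnp_holomorphic = cnp_family X t p + complex_scaling sc
  for X :: "'a::real_normed_vector set" and t :: "'p::finite \<Rightarrow> 'a \<Rightarrow> 'a \<Rightarrow> complex" and p sc +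
  assumes X_open: "open X" and X_conn: "connected X"
    and t_holo: "\<And>j w. w \<in> X \<Longrightarrow> holomorphic_mv sc (\<lambda>z. t j z w) X"
begin

lemma inverse_holo:
  assumes "w \<in> X"
  shows "holomorphic_mv sc (\<lambda>z. 1 / t j z w) X"
  unfolding holomorphic_mv_def
proof
  fix x assume x: "x \<in> X"
  then obtain D where D: "((\<lambda>z. t j z w) has_derivative D) (at x)" "\<And>c v. D (sc c v) = c * D v"
    using t_holo[OF assms] unfolding holomorphic_mv_def by blast
  have "((\<lambda>z. inverse (t j z w)) has_derivative (\<lambda>h. - (inverse (t j x w) * D h * inverse (t j x w)))) (at x)"
    by (rule Deriv.has_derivative_inverse[OF t_nz[OF x assms] D(1)])
  then show "\<exists>D. ((\<lambda>z. 1 / t j z w) has_derivative D) (at x) \<and> (\<forall>c v. D (sc c v) = c * D v)"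
    using D(2) by (intro exI[of _ "\<lambda>h. - (inverse (t j x w) * D h * inverse (t j x w))"])
      (simp add: inverse_eq_divide)
qed

lemma b_holo:
  assumes "w \<in> X"
  shows "holomorphic_mv sc (\<lambda>z. b j z w) X"
  unfolding holomorphic_mv_def
proof
  fix x assume x: "x \<in> X"
  then obtain D where D: "((\<lambda>z. 1 / t j z w) has_derivative D) (at x)" "\<And>c v. D (sc c v) = c * D v"
    using inverse_holo[OF assms] unfolding holomorphic_mv_def by blast
  have "((\<lambda>z. b j z w) has_derivative (\<lambda>h. - D h)) (at x)"
    unfolding b_def using has_derivative_diff[OF has_derivative_const D(1), of 1] by simp
  then show "\<exists>D. ((\<lambda>z. b j z w) has_derivative D) (at x) \<and> (\<forall>c v. D (sc c v) = c * D v)"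
    using D(2) by (intro exI[of _ "\<lambda>h. - D h"]) simp
qed

text \<open>Holomorphy is given in each variable separately, which does not directly control the
  diagonal. The Lipschitz bound for \<open>b\<close>, uniform in the other variable, keeps
  \<open>b j z z\<close> away from \<open>1\<close>, and \<open>t j z z\<close> is
  \<open>1 / (1 - b j z z)\<close>.\<close>

lemma t_locally_bounded:
  assumes z0: "z0 \<in> X"
  shows "\<exists>r>0. \<exists>M. ball z0 r \<subseteq> X \<and> (\<forall>z\<in>ball z0 r. norm (t j z z) \<le> M)"
proof -
  obtain R where R: "R > 0" "ball z0 R \<subseteq> X" using X_open z0 open_contains_ball by blast
  define \<beta> where "\<beta> = Re (b j z0 z0)"
  have \<beta>: "\<beta> < 1" unfolding \<beta>_def by (rule b_diag(2)[OF z0])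
  \<comment> \<open>Moving both arguments from \<open>z0\<close> to \<open>z\<close> costs at most
    \<open>4 * r / R\<close>; the factor \<open>8\<close> makes this half of the gap
    \<open>1 - \<beta>\<close>.\<close>
  define r where "r = min R (R * (1 - \<beta>) / 8)"
  have r: "0 < r" "r \<le> R" "r \<le> R * (1 - \<beta>) / 8" using R \<beta> by (auto simp: r_def)
  have "norm (t j z z) \<le> 2 / (1 - \<beta>)" if "z \<in> ball z0 r" for z
  proof -
    have zR: "z \<in> ball z0 R" and zX: "z \<in> X" using that r R by auto
    have lip: "norm (b j z w - b j z0 w) \<le> 2 * norm (z - z0) / R" if "w \<in> X" for w
      by (rule bounded_holomorphic_lipschitz[OF b_holo[OF that] R(2,1) norm_b_less_1[OF _ that] zR])
    have "norm (b j z0 z - b j z0 z0) = norm (b j z z0 - b j z0 z0)"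
    proof -
      have "b j z0 z - b j z0 z0 = cnj (b j z z0 - b j z0 z0)"
        using reproducing_kernel_hermitian[OF b_kernel zX z0, of j] reproducing_kernel_hermitian[OF b_kernel z0 z0, of j]
        by simp
      then show ?thesis by (metis complex_mod_cnj)
    qed
    then have "norm (b j z z - b j z0 z0) \<le> 4 * norm (z - z0) / R"
      using lip[OF zX] lip[OF z0] norm_triangle_ineq[of "b j z z - b j z0 z" "b j z0 z - b j z0 z0"] by simp
    also have "\<dots> \<le> 4 * r / R"
      using that R(1) by (intro divide_right_mono mult_left_mono) (auto simp: dist_norm norm_minus_commute)
    also have "\<dots> \<le> (1 - \<beta>) / 2" using r(3) R(1) by (simp add: field_simps)
    finally have "Re (b j z z - b j z0 z0) \<le> (1 - \<beta>) / 2"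
      using complex_Re_le_cmod order_trans by blast
    then have bz: "1 - Re (b j z z) \<ge> (1 - \<beta>) / 2" by (simp add: \<beta>_def field_simps)
    have "norm (t j z z) = 1 / (1 - Re (b j z z))"
      using b_diag(2)[OF zX, of j] by (subst b_diag(4)[OF zX]) (simp only: norm_of_real, simp)
    also have "\<dots> \<le> 1 / ((1 - \<beta>) / 2)"
      using bz \<beta> by (intro divide_left_mono mult_pos_pos) auto
    finally show ?thesis by simp
  qed
  moreover have "ball z0 r \<subseteq> X" using r(2) R(2) by (meson subset_ball subset_trans)
  ultimately show ?thesis using r(1) by blast
qed

lemma schur_locally_bounded:
  assumes z0: "z0 \<in> X"
  shows "\<exists>r>0. \<exists>M. ball z0 r \<subseteq> X \<and> (\<forall>z\<in>ball z0 r. norm (schur_product t z z) \<le> M)"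
proof -
  obtain r M where r: "\<And>j. r j > 0" "\<And>j. ball z0 (r j) \<subseteq> X"
    and M: "\<And>j z. z \<in> ball z0 (r j) \<Longrightarrow> norm (t j z z) \<le> M j"
    using t_locally_bounded[OF z0] by metis
  define r' where "r' = Min (range r)"
  have r': "r' > 0" "\<And>j. r' \<le> r j" using r by (auto simp: r'_def)
  have "norm (schur_product t z z) \<le> (\<Prod>j\<in>UNIV. M j)" if "z \<in> ball z0 r'" for z
    unfolding schur_product_def prod_norm[symmetric]
  proof (intro prod_mono conjI norm_ge_zero M)
    fix j show "z \<in> ball z0 (r j)" using that r'(2)[of j] by auto
  qed
  moreover have "ball z0 r' \<subseteq> X" using r(2) r'(2) by (meson subset_ball subset_trans)
  ultimately show ?thesis using r' by blast
qed

lemma schur_holo_line: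
  assumes w: "w \<in> X" and S: "\<And>\<zeta>. \<zeta> \<in> S \<Longrightarrow> a + sc \<zeta> v \<in> X"
  shows "(\<lambda>\<zeta>. schur_product t (a + sc \<zeta> v) w) holomorphic_on S"
  unfolding schur_product_def by (intro holomorphic_on_prod holomorphic_on_line[OF t_holo[OF w] S])

text \<open>Approximation in norm by combinations of kernel functions is uniform where
  \<open>k z z\<close> is bounded, so \<open>f\<close> is a locally uniform limit of holomorphic
  functions on the line.\<close>

lemma mem_holo_line:
  assumes "rkhs X (schur_product t) H ip" and f: "f \<in> H"
    and B: "ball z0 r \<subseteq> X" "\<And>z. z \<in> ball z0 r \<Longrightarrow> norm (schur_product t z z) \<le> M"
  shows "(\<lambda>\<zeta>. f (a + sc \<zeta> v)) holomorphic_on {\<zeta>. a + sc \<zeta> v \<in> ball z0 r}"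
proof -
  interpret rkhs X "schur_product t" H ip by (rule assms(1))
  let ?S = "{\<zeta>. a + sc \<zeta> v \<in> ball z0 r}"
  have "\<exists>c\<in>coeffs. hnorm ip (\<lambda>x. f x - kspan c x) < inverse (real (Suc n))" for n
    by (rule kspan_dense[OF f]) simp
  then obtain c where c: "\<And>n. c n \<in> coeffs"
    "\<And>n. hnorm ip (\<lambda>x. f x - kspan (c n) x) < inverse (real (Suc n))" by metis
  have SX: "a + sc \<zeta> v \<in> X" if "\<zeta> \<in> ?S" for \<zeta> using that B by auto
  have open_S: "open ?S" by (rule line_ball)
  have bound: "norm (kspan (c n) z - f z) \<le> inverse (real (Suc n)) * sqrt M" if "z \<in> ball z0 r" for n z
  proof -
    have z: "z \<in> X" using that B by auto
    have "Re (schur_product t z z) \<le> M" using B(2)[OF that] complex_Re_le_cmod order_trans by blast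
    then have "(hnorm ip (kernel_fun X (schur_product t) z))\<^sup>2 \<le> M" using hnorm_kernel[OF z] by simp
    then have "hnorm ip (kernel_fun X (schur_product t) z) \<le> sqrt M" by (rule real_le_rsqrt)
    then have "norm (f z - kspan (c n) z) \<le> inverse (real (Suc n)) * sqrt M"
      using eval_bound[OF diff_mem[OF f kspan_mem[OF c(1)]] z, of n] c(2)[of n] hnorm_nonneg[OF kernel_mem[OF z]]
      by (meson less_imp_le mult_mono order_trans inverse_nonnegative_iff_nonnegative of_nat_0_le_iff)
    then show ?thesis by (simp add: norm_minus_commute)
  qed
  show ?thesis
  proof (rule holomorphic_uniform_sequence[OF open_S])
    show "(\<lambda>\<zeta>. kspan (c n) (a + sc \<zeta> v)) holomorphic_on ?S" for n
    proof -
      have "(\<lambda>\<zeta>. \<Sum>w | c n w \<noteq> 0. c n w * schur_product t (a + sc \<zeta> v) w) holomorphic_on ?S"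
        using c(1)[of n] SX by (intro holomorphic_on_sum holomorphic_on_mult holomorphic_on_const schur_holo_line)
          (auto simp: coeffs_def)
      then show ?thesis
      proof (rule holomorphic_transform)
        fix \<zeta> assume "\<zeta> \<in> ?S"
        then show "(\<Sum>w | c n w \<noteq> 0. c n w * schur_product t (a + sc \<zeta> v) w) = kspan (c n) (a + sc \<zeta> v)"
          using SX unfolding kspan_def by (simp add: kernel_fun_def fun_on_def)
      qed
    qed
    fix \<zeta>0 assume "\<zeta>0 \<in> ?S"
    then obtain d where d: "d > 0" "cball \<zeta>0 d \<subseteq> ?S" using open_S open_contains_cball by blast
    have "uniform_limit (cball \<zeta>0 d) (\<lambda>n \<zeta>. kspan (c n) (a + sc \<zeta> v)) (\<lambda>\<zeta>. f (a + sc \<zeta> v)) sequentially"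
    proof (rule uniform_limitI)
      fix e :: real assume e: "e > 0"
      have "(\<lambda>n. inverse (real (Suc n)) * sqrt M) \<longlonglongrightarrow> 0"
        using tendsto_mult_left_zero[OF LIMSEQ_inverse_real_of_nat] .
      then have "\<forall>\<^sub>F n in sequentially. inverse (real (Suc n)) * sqrt M < e"
        using e by (rule order_tendstoD(2))
      then show "\<forall>\<^sub>F n in sequentially. \<forall>\<zeta>\<in>cball \<zeta>0 d. dist (kspan (c n) (a + sc \<zeta> v)) (f (a + sc \<zeta> v)) < e"
      proof eventually_elim
        case (elim n)
        show ?case
        proof
          fix \<zeta> assume "\<zeta> \<in> cball \<zeta>0 d"
          then have "a + sc \<zeta> v \<in> ball z0 r" using d by blast
          then show "dist (kspan (c n) (a + sc \<zeta> v)) (f (a + sc \<zeta> v)) < e"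
            using bound[of "a + sc \<zeta> v" n] elim by (simp add: dist_norm)
        qed
      qed
    qed
    then show "\<exists>d>0. cball \<zeta>0 d \<subseteq> ?S \<and>
        uniform_limit (cball \<zeta>0 d) (\<lambda>n \<zeta>. kspan (c n) (a + sc \<zeta> v)) (\<lambda>\<zeta>. f (a + sc \<zeta> v)) sequentially"
      using d by blast
  qed
qed

end

context complex_scaling
begin

text \<open>If \<open>f\<close> vanishes near one point of a ball, it vanishes on the whole ball, by
  continuation along the line from that point to any other. Connectedness of \<open>X\<close> does
  the rest.\<close>

lemma identity_principle:
  assumes X: "open X" "connected X"
    and hol: "\<And>z0. z0 \<in> X \<Longrightarrow> \<exists>r>0. ball z0 r \<subseteq> X \<and>
        (\<forall>a v. (\<lambda>\<zeta>. f (a + sc \<zeta> v)) holomorphic_on {\<zeta>. a + sc \<zeta> v \<in> ball z0 r})"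
    and e0: "e > 0" "p \<in> X" "\<And>z. z \<in> ball p e \<Longrightarrow> f z = 0" and x: "x \<in> X"
  shows "f x = 0"
proof -
  define A where "A = {z \<in> X. \<exists>e>0. \<forall>y\<in>ball z e. f y = 0}"
  have key: "f y = 0" if "ball z0 r \<subseteq> X"
    "\<And>a v. (\<lambda>\<zeta>. f (a + sc \<zeta> v)) holomorphic_on {\<zeta>. a + sc \<zeta> v \<in> ball z0 r}"
    "a \<in> A" "a \<in> ball z0 r" "y \<in> ball z0 r" for z0 r a y
  proof -
    let ?S = "{\<zeta>. a + sc \<zeta> (y - a) \<in> ball z0 r}"
    obtain e where e: "e > 0" "\<And>u. u \<in> ball a e \<Longrightarrow> f u = 0" using \<open>a \<in> A\<close> by (auto simp: A_def)
    let ?U = "?S \<inter> {\<zeta>. a + sc \<zeta> (y - a) \<in> ball a e}"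
    have "f (a + sc 1 (y - a)) = 0"
    proof (rule analytic_continuation_open[where s = ?U and s' = ?S and g = "\<lambda>_. 0" and f = "\<lambda>\<zeta>. f (a + sc \<zeta> (y - a))"])
      show "open ?S" "connected ?S" by (rule line_ball)+
      then show "open ?U" using line_ball(1) by (intro open_Int)
      have "0 \<in> ?U" using that e by (simp add: sc_zero)
      then show "?U \<noteq> {}" by blast
      show "?U \<subseteq> ?S" by blast
      show "(\<lambda>\<zeta>. f (a + sc \<zeta> (y - a))) holomorphic_on ?S" by (rule that(2))
      show "1 \<in> ?S" using that by (simp add: sc_one)
      show "f (a + sc \<zeta> (y - a)) = 0" if "\<zeta> \<in> ?U" for \<zeta> using that e(2) by blast
    qed auto
    then show ?thesis by (simp add: sc_one)
  qed
  \<comment> \<open>This dichotomy yields openness of \<open>A\<close> and of its complement at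
    once.\<close>
  have local: "(\<exists>r>0. ball z0 r \<subseteq> A) \<or> (\<exists>r>0. ball z0 r \<subseteq> X - A)" if z0: "z0 \<in> X" for z0
  proof -
    obtain r where r: "r > 0" "ball z0 r \<subseteq> X"
      "\<And>a v. (\<lambda>\<zeta>. f (a + sc \<zeta> v)) holomorphic_on {\<zeta>. a + sc \<zeta> v \<in> ball z0 r}"
      using hol[OF z0] by blast
    show ?thesis
    proof (cases "A \<inter> ball z0 r = {}")
      case True
      then have "ball z0 r \<subseteq> X - A" using r by blast
      then show ?thesis using r by blast
    next
      case False
      then obtain a where a: "a \<in> A" "a \<in> ball z0 r" by blast
      have zero: "f y = 0" if "y \<in> ball z0 r" for y by (rule key[OF r(2,3) a that])
      have "ball z0 r \<subseteq> A"
      proof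
        fix y assume y: "y \<in> ball z0 r"
        then obtain e where "e > 0" "ball y e \<subseteq> ball z0 r" using open_ball open_contains_ball by blast
        then show "y \<in> A" unfolding A_def using zero r y by blast
      qed
      then show ?thesis using r by blast
    qed
  qed
  have self: "z \<in> ball z r" if "r > 0" for z :: 'a and r using that by simp
  have "open A" unfolding open_contains_ball
  proof
    fix z assume z: "z \<in> A"
    then have "z \<in> X" by (simp add: A_def)
    then show "\<exists>e>0. ball z e \<subseteq> A" using local[of z] z self by blast
  qed
  moreover have "open (X - A)" unfolding open_contains_ball
  proof
    fix z assume z: "z \<in> X - A"
    then show "\<exists>e>0. ball z e \<subseteq> X - A" using local[of z] self by blast
  qed
  moreover have "p \<in> A" unfolding A_def using e0 by blast
  ultimately have "X - A = {}"
    using connectedD[OF X(2), of A "X - A"] \<open>p \<in> X\<close> by blast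
  then have "x \<in> A" using x by blast
  then obtain e where "e > 0" "\<forall>y\<in>ball x e. f y = 0" by (auto simp: A_def)
  then show ?thesis by simp
qed

end

lemma (in cnp_holomorphic) mem_identity:
  assumes R: "rkhs X (schur_product t) H ip" and f: "f \<in> H"
    and e: "e > 0" "\<And>z. z \<in> ball p e \<Longrightarrow> f z = 0"
  shows "f = (\<lambda>x. 0)"
proof
  fix x
  interpret rkhs X "schur_product t" H ip by (rule R)
  show "f x = 0"
  proof (cases "x \<in> X")
    case True
    show ?thesis
    proof (rule identity_principle[OF X_open X_conn _ e(1) base e(2) True])
      fix z0 assume "z0 \<in> X"
      from schur_locally_bounded[OF this] obtain r M where r: "r > 0" "ball z0 r \<subseteq> X"
        "\<And>z. z \<in> ball z0 r \<Longrightarrow> norm (schur_product t z z) \<le> M" by blast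
      show "\<exists>r>0. ball z0 r \<subseteq> X \<and>
        (\<forall>a v. (\<lambda>\<zeta>. f (a + sc \<zeta> v)) holomorphic_on {\<zeta>. a + sc \<zeta> v \<in> ball z0 r})"
        using mem_holo_line[OF R f r(2,3)] r by blast
    qed
  qed (rule support[OF f])
qed

section \<open>Restriction to a set of uniqueness\<close>

context rkhs
begin

context
  fixes Y :: "'b set" and v :: "'b \<Rightarrow> 'a"
  assumes v: "\<And>y. y \<in> Y \<Longrightarrow> v y \<in> X"
    and unique: "\<And>f. f \<in> H \<Longrightarrow> (\<And>y. y \<in> Y \<Longrightarrow> f (v y) = 0) \<Longrightarrow> f = (\<lambda>x. 0)"
begin

definition restr :: "('a \<Rightarrow> complex) \<Rightarrow> 'b \<Rightarrow> complex" where
  "restr f = fun_on Y (\<lambda>y. f (v y))"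

definition extend :: "('b \<Rightarrow> complex) \<Rightarrow> 'a \<Rightarrow> complex" where
  "extend = inv_into H restr"

lemma restr_inj: "inj_on restr H"
proof (rule inj_onI)
  fix f g assume fg: "f \<in> H" "g \<in> H" "restr f = restr g"
  have "(\<lambda>x. f x - g x) = (\<lambda>x. 0)"
  proof (rule unique[OF diff_mem[OF fg(1,2)]])
    fix y assume "y \<in> Y"
    then show "f (v y) - g (v y) = 0"
      using fun_cong[OF fg(3), of y] by (simp add: restr_def fun_on_def)
  qed
  then show "f = g" by (metis eq_iff_diff_eq_0 ext)
qed

lemma extend_restr: "f \<in> H \<Longrightarrow> extend (restr f) = f"
  unfolding extend_def by (rule inv_into_f_f[OF restr_inj])

lemma restr_add: "(\<lambda>y. restr f y + restr g y) = restr (\<lambda>x. f x + g x)"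
  and restr_diff: "(\<lambda>y. restr f y - restr g y) = restr (\<lambda>x. f x - g x)"
  and restr_scale: "(\<lambda>y. c * restr f y) = restr (\<lambda>x. c * f x)"
  and restr_mult: "(\<lambda>y. restr f y * restr g y) = restr (\<lambda>x. f x * g x)"
  and restr_zero: "(\<lambda>y. 0) = restr (\<lambda>x. 0)"
  by (auto simp: restr_def fun_on_def)

lemma restr_kernel: "y \<in> Y \<Longrightarrow> kernel_fun Y (\<lambda>y y'. k (v y) (v y')) y = restr (kernel_fun X k (v y))"
  using v by (auto simp: restr_def kernel_fun_def fun_on_def)

text \<open>In general the restricted space carries a quotient norm. Here restriction is injective,
  so the inner product is transported by the inverse map and completeness comes along.\<close>

lemma rkhs_restr: "rkhs Y (\<lambda>y y'. k (v y) (v y')) (restr ` H) (\<lambda>f g. ip (extend f) (extend g))"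
proof
  let ?ip = "\<lambda>f g. ip (extend f) (extend g)"
  note E = extend_restr add_mem diff_mem scale_mem restr_add restr_diff restr_scale
  show "f y = 0" if "f \<in> restr ` H" "y \<notin> Y" for f y
    using that by (auto simp: restr_def fun_on_def)
  show "(\<lambda>x. 0) \<in> restr ` H" unfolding restr_zero by (rule imageI[OF zero_mem])
  show "(\<lambda>x. f x + g x) \<in> restr ` H" if "f \<in> restr ` H" "g \<in> restr ` H" for f g
    using that by (auto simp: E intro!: imageI)
  show "(\<lambda>x. c * f x) \<in> restr ` H" if "f \<in> restr ` H" for c f
    using that by (auto simp: E intro!: imageI)
  show "?ip (\<lambda>x. f x + g x) h = ?ip f h + ?ip g h" if "f \<in> restr ` H" "g \<in> restr ` H" "h \<in> restr ` H" for f g h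
    using that by (auto simp: E ip_add)
  show "?ip (\<lambda>x. c * f x) h = c * ?ip f h" if "f \<in> restr ` H" "h \<in> restr ` H" for c f h
    using that by (auto simp: E ip_scale)
  show "?ip g f = cnj (?ip f g)" if "f \<in> restr ` H" "g \<in> restr ` H" for f g
    using that by (auto simp: E intro!: ip_cnj)
  show "?ip f f \<in> \<real>\<^sub>\<ge>\<^sub>0" if "f \<in> restr ` H" for f
    using that by (auto simp: E intro!: ip_nonneg)
  show "f = (\<lambda>x. 0)" if f: "f \<in> restr ` H" "?ip f f = 0" for f
  proof -
    obtain g where g: "g \<in> H" "f = restr g" using f(1) by blast
    then have "g = (\<lambda>x. 0)" using f(2) by (intro ip_definite) (simp_all add: extend_restr)
    then show ?thesis using g restr_zero by simp
  qed
  show "\<exists>f\<in>restr ` H. (\<lambda>n. hnorm ?ip (\<lambda>x. F n x - f x)) \<longlonglongrightarrow> 0"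
    if F: "\<And>n. F n \<in> restr ` H"
      "\<And>e. e > 0 \<Longrightarrow> \<exists>N. \<forall>m\<ge>N. \<forall>n\<ge>N. hnorm ?ip (\<lambda>x. F m x - F n x) < e" for F :: "nat \<Rightarrow> 'b \<Rightarrow> complex"
  proof -
    define G where "G = (\<lambda>n. extend (F n))"
    have G: "G n \<in> H" "F n = restr (G n)" for n
      using inv_into_into[OF F(1)] f_inv_into_f[OF F(1)] by (simp_all add: G_def extend_def)
    have hn: "hnorm ?ip (restr f) = hnorm ip f" if "f \<in> H" for f
      using that by (simp add: hnorm_def extend_restr)
    have "\<exists>g\<in>H. (\<lambda>n. hnorm ip (\<lambda>x. G n x - g x)) \<longlonglongrightarrow> 0"
    proof (rule complete_space[OF G(1)])
      fix e :: real assume "e > 0"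
      from F(2)[OF this] show "\<exists>N. \<forall>m\<ge>N. \<forall>n\<ge>N. hnorm ip (\<lambda>x. G m x - G n x) < e"
        unfolding G(2) restr_diff hn[OF diff_mem[OF G(1) G(1)]] .
    qed
    then obtain g where g: "g \<in> H" "(\<lambda>n. hnorm ip (\<lambda>x. G n x - g x)) \<longlonglongrightarrow> 0" by blast
    have "(\<lambda>n. hnorm ?ip (\<lambda>x. F n x - restr g x)) \<longlonglongrightarrow> 0"
      unfolding G(2) restr_diff hn[OF diff_mem[OF G(1) g(1)]] by (rule g(2))
    then show ?thesis using g(1) by blast
  qed
  show "kernel_fun Y (\<lambda>y y'. k (v y) (v y')) y \<in> restr ` H" if "y \<in> Y" for y
    unfolding restr_kernel[OF that] using kernel_mem v that by blast
  show "?ip f (kernel_fun Y (\<lambda>y y'. k (v y) (v y')) y) = f y" if "f \<in> restr ` H" "y \<in> Y" for f y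
    unfolding restr_kernel[OF that(2)] using that v
    by (auto simp: extend_restr kernel_mem reproducing) (simp add: restr_def fun_on_def)
qed

lemma bounded_functional_restr:
  assumes "bounded_functional H ip \<Lambda>"
  shows "bounded_functional (restr ` H) (\<lambda>f g. ip (extend f) (extend g)) (\<lambda>f. \<Lambda> (extend f))"
  using assms unfolding bounded_functional_def hnorm_def
  by (auto simp: restr_add restr_scale extend_restr add_mem scale_mem)

lemma multiplicative_restr:
  assumes "multiplicative_functional (restr ` H) (\<lambda>f. \<Lambda> (extend f))"
  shows "multiplicative_functional H \<Lambda>"
  unfolding multiplicative_functional_def
proof (intro ballI impI)
  fix f g assume fg: "f \<in> H" "g \<in> H" "(\<lambda>x. f x * g x) \<in> H"
  have "(\<lambda>y. restr f y * restr g y) \<in> restr ` H" unfolding restr_mult by (rule imageI[OF fg(3)])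
  then have "\<Lambda> (extend (\<lambda>y. restr f y * restr g y)) = \<Lambda> (extend (restr f)) * \<Lambda> (extend (restr g))"
    using assms fg unfolding multiplicative_functional_def by blast
  then show "\<Lambda> (\<lambda>x. f x * g x) = \<Lambda> f * \<Lambda> g"
    unfolding restr_mult using fg by (simp add: extend_restr)
qed

end

end

section \<open>Power series in finitely many variables\<close>

text \<open>Monomials in variables indexed by any finite type, because the tensor product has
  variables indexed by pairs.\<close>

definition mpow :: "('i::finite \<Rightarrow> complex) \<Rightarrow> ('i \<Rightarrow> nat) \<Rightarrow> complex" where
  "mpow x \<alpha> = (\<Prod>i\<in>UNIV. x i ^ \<alpha> i)"

lemma mpow_zero_index: "mpow x (\<lambda>i. 0) = 1"
  by (simp add: mpow_def)

lemma mpow_add: "mpow x (\<lambda>i. \<alpha> i + \<beta> i) = mpow x \<alpha> * mpow x \<beta>"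
  by (simp add: mpow_def power_add prod.distrib)

lemma mpow_mult: "mpow (\<lambda>i. x i * y i) \<alpha> = mpow x \<alpha> * mpow y \<alpha>"
  by (simp add: mpow_def power_mult_distrib prod.distrib)

lemma cnj_mpow: "cnj (mpow x \<alpha>) = mpow (\<lambda>i. cnj (x i)) \<alpha>"
  by (simp add: mpow_def)

lemma mpow_zero: "mpow (\<lambda>i. 0) \<alpha> = (if \<alpha> = (\<lambda>i. 0) then 1 else 0)"
proof (cases "\<alpha> = (\<lambda>i. 0)")
  case False
  then obtain i where "\<alpha> i \<noteq> 0" by blast
  then show ?thesis using False unfolding mpow_def by (auto intro!: prod_zero bexI[of _ i])
qed (simp add: mpow_zero_index)

definition polydisc :: "real \<Rightarrow> ('i::finite \<Rightarrow> complex) set" where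
  "polydisc r = {x. \<forall>i. norm (x i) < r}"

lemma polydisc_eventually:
  assumes "\<And>i. (\<lambda>n. x n i) \<longlonglongrightarrow> 0" "0 < r"
  shows "\<forall>\<^sub>F n in sequentially. x n \<in> polydisc r"
proof -
  have "\<forall>\<^sub>F n in sequentially. norm (x n i) < r" for i
    using order_tendstoD(2)[OF tendsto_norm_zero[OF assms(1)] assms(2)] .
  then have "\<forall>\<^sub>F n in sequentially. \<forall>i. norm (x n i) < r" by (rule eventually_all_finite)
  then show ?thesis by (simp add: polydisc_def)
qed

lemma has_sum_diff_general:
  fixes f :: "'b \<Rightarrow> complex"
  shows "(f has_sum a) A \<Longrightarrow> (g has_sum c) A \<Longrightarrow> ((\<lambda>x. f x - g x) has_sum (a - c)) A"
  using has_sum_add[of f A a "\<lambda>x. - 1 * g x" "- 1 * c"] has_sum_cmult_right[of g A c "-1"] by simp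

lemma has_sum_indicator:
  fixes a :: "'c::{comm_monoid_add,topological_space}"
  shows "((\<lambda>x. if x = l then a else 0) has_sum a) UNIV"
  by (rule has_sum_finite_neutralI[of "{l}"]) auto

text \<open>Leading coefficients of Dirichlet series. Evaluating a power series at \<open>x\<^sub>i = p\<^sub>i\<^sup>-\<^sup>n\<close> for
  distinct primes \<open>p\<^sub>i\<close> gives such a series, so that its coefficients can be read off one by one.\<close>

lemma dirichlet_leading_coefficient:
  fixes N :: "'c \<Rightarrow> nat" and q :: "'c \<Rightarrow> complex"
  assumes inj: "inj N" and pos: "\<And>\<alpha>. 0 < N \<alpha>"
    and sums: "\<forall>\<^sub>F n in sequentially. ((\<lambda>\<alpha>. q \<alpha> / of_nat (N \<alpha>) ^ n) has_sum S n) UNIV"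
    and low: "\<And>\<alpha>. N \<alpha> < N \<alpha>0 \<Longrightarrow> q \<alpha> = 0"
  shows "(\<lambda>n. of_nat (N \<alpha>0) ^ n * S n) \<longlonglongrightarrow> q \<alpha>0"
proof -
  obtain m where m: "\<And>n. n \<ge> m \<Longrightarrow> ((\<lambda>\<alpha>. q \<alpha> / of_nat (N \<alpha>) ^ n) has_sum S n) UNIV"
    using sums unfolding eventually_sequentially by blast
  define N0 where "N0 = real (N \<alpha>0)"
  have N0: "N0 > 0" using pos by (simp add: N0_def)
  have "(\<lambda>\<alpha>. norm (q \<alpha> / of_nat (N \<alpha>) ^ m)) summable_on UNIV"
    using m[of m] by (simp flip: summable_on_iff_abs_summable_on_complex add: has_sum_imp_summable)
  then obtain M where M: "((\<lambda>\<alpha>. norm (q \<alpha> / of_nat (N \<alpha>) ^ m)) has_sum M) UNIV"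
    by (auto simp: summable_on_def)
  \<comment> \<open>Codes are integers and distinct, so every later term has code at least
    \<open>N0 + 1\<close> and decays relative to the leading one at least like powers of
    \<rho>.\<close>
  define \<rho> where "\<rho> = N0 / (N0 + 1)"
  have \<rho>: "0 < \<rho>" "\<rho> < 1" using N0 by (auto simp: \<rho>_def)
  \<comment> \<open>The exponent \<open>m\<close> is spent on absolute convergence and the remaining
    \<open>n - m\<close> powers on decay.\<close>
  have bound: "norm (of_nat (N \<alpha>0) ^ n * S n - q \<alpha>0) \<le> \<rho> ^ (n - m) * (N0 ^ m * M)" if n: "n \<ge> m" for n
  proof (rule norm_infsum_le)
    have "((\<lambda>\<alpha>. of_nat (N \<alpha>0) ^ n * (q \<alpha> / of_nat (N \<alpha>) ^ n)) has_sum (of_nat (N \<alpha>0) ^ n * S n)) UNIV"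
      by (rule has_sum_cmult_right[OF m[OF n]])
    then show "((\<lambda>\<alpha>. of_nat (N \<alpha>0) ^ n * (q \<alpha> / of_nat (N \<alpha>) ^ n) - (if \<alpha> = \<alpha>0 then q \<alpha>0 else 0))
        has_sum (of_nat (N \<alpha>0) ^ n * S n - q \<alpha>0)) UNIV"
      by (rule has_sum_diff_general[OF _ has_sum_indicator])
    show "((\<lambda>\<alpha>. \<rho> ^ (n - m) * (N0 ^ m * norm (q \<alpha> / of_nat (N \<alpha>) ^ m))) has_sum (\<rho> ^ (n - m) * (N0 ^ m * M))) UNIV"
      by (intro has_sum_cmult_right M)
    fix \<alpha>
    show "norm (of_nat (N \<alpha>0) ^ n * (q \<alpha> / of_nat (N \<alpha>) ^ n) - (if \<alpha> = \<alpha>0 then q \<alpha>0 else 0))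
        \<le> \<rho> ^ (n - m) * (N0 ^ m * norm (q \<alpha> / of_nat (N \<alpha>) ^ m))"
    proof (cases "\<alpha> = \<alpha>0 \<or> q \<alpha> = 0")
      case True
      then show ?thesis using \<rho> N0 pos[of \<alpha>0] by auto
    next
      case False
      then have "N \<alpha> > N \<alpha>0" using low[of \<alpha>] inj by (metis injD linorder_neqE_nat)
      then have N: "real (N \<alpha>) \<ge> N0 + 1" by (simp add: N0_def)
      have "N0 / N \<alpha> \<le> \<rho>" unfolding \<rho>_def using N N0 by (intro divide_left_mono mult_pos_pos) auto
      then have "(N0 / N \<alpha>) ^ (n - m) \<le> \<rho> ^ (n - m)" using N0 by (intro power_mono) auto
      moreover have "norm (of_nat (N \<alpha>0) ^ n * (q \<alpha> / of_nat (N \<alpha>) ^ n)) = (N0 / N \<alpha>) ^ n * norm (q \<alpha>)"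
        by (simp add: N0_def norm_mult norm_divide norm_power power_divide)
      moreover have "(N0 / N \<alpha>) ^ n = (N0 / N \<alpha>) ^ (n - m) * (N0 / N \<alpha>) ^ m"
        using n by (simp flip: power_add)
      moreover have "N0 ^ m * norm (q \<alpha> / of_nat (N \<alpha>) ^ m) = (N0 / N \<alpha>) ^ m * norm (q \<alpha>)"
        by (simp add: norm_divide norm_power power_divide)
      ultimately show ?thesis using False N0 by (auto simp: mult.assoc intro!: mult_right_mono)
    qed
  qed
  have "(\<lambda>n. of_nat (N \<alpha>0) ^ n * S n - q \<alpha>0) \<longlonglongrightarrow> 0"
  proof (rule Lim_null_comparison)
    show "\<forall>\<^sub>F n in sequentially. norm (of_nat (N \<alpha>0) ^ n * S n - q \<alpha>0) \<le> \<rho> ^ (n - m) * (N0 ^ m * M)"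
      using bound by (auto simp: eventually_sequentially)
    have "(\<lambda>n. \<rho> ^ n * (N0 ^ m * M)) \<longlonglongrightarrow> 0"
      using \<rho> by (intro tendsto_mult_left_zero LIMSEQ_power_zero) auto
    then show "(\<lambda>n. \<rho> ^ (n - m) * (N0 ^ m * M)) \<longlonglongrightarrow> 0"
      using LIMSEQ_offset[of "\<lambda>n. \<rho> ^ (n - m) * (N0 ^ m * M)" m 0] by simp
  qed
  then show ?thesis by (simp add: LIM_zero_iff)
qed

text \<open>Injective by unique factorization, and it turns addition of indices into multiplication
  of integers: its order is total, has least elements, and is compatible with products of
  monomials.\<close>

definition prime_code :: "('i::finite \<Rightarrow> nat) \<Rightarrow> ('i \<Rightarrow> nat) \<Rightarrow> nat" where
  "prime_code P \<alpha> = (\<Prod>i\<in>UNIV. P i ^ \<alpha> i)"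

text \<open>Giving the prime \<open>2\<close> to a chosen variable makes the index of that variable
  the next one after zero in the order of codes, as \<open>linear_coefficients\<close>
  requires.\<close>

lemma ex_distinct_primes:
  "\<exists>P::'i::finite \<Rightarrow> nat. inj P \<and> (\<forall>i. prime (P i)) \<and> P j = 2"
proof -
  have "{p::nat. prime p} \<subseteq> insert 2 {p. prime p \<and> p \<noteq> 2}" by auto
  then have "infinite {p::nat. prime p \<and> p \<noteq> 2}"
    using primes_infinite by (meson finite_insert finite_subset)
  then obtain g :: "nat \<Rightarrow> nat" where g: "inj g" "range g \<subseteq> {p. prime p \<and> p \<noteq> 2}"
    using infinite_countable_subset by blast
  obtain f :: "'i \<Rightarrow> nat" where f: "inj f"
    using finite_imp_inj_to_nat_seg[of "UNIV :: 'i set"] by auto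
  let ?P = "\<lambda>i. if i = j then 2 else g (f i)"
  have gp: "prime (g n)" "g n \<noteq> 2" for n using g(2) by auto
  have "inj ?P"
  proof (rule injI)
    fix i k assume "?P i = ?P k"
    then show "i = k"
      using gp(2)[of "f i"] gp(2)[of "f k"] injD[OF g(1), of "f i" "f k"] injD[OF f, of i k]
      by (cases "i = j"; cases "k = j") auto
  qed
  then show ?thesis using gp(1) by (intro exI[of _ ?P]) auto
qed

context
  fixes P :: "'i::finite \<Rightarrow> nat"
  assumes P: "inj P" "\<And>i. prime (P i)"
begin

lemma prime_code_inj: "inj (prime_code P)"
proof (rule injI)
  fix \<alpha> \<beta> assume eq: "prime_code P \<alpha> = prime_code P \<beta>"
  have mult: "multiplicity (P i) (prime_code P \<gamma>) = \<gamma> i" for i \<gamma>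
  proof -
    have "prime_code P \<gamma> = (\<Prod>p\<in>range P. p ^ \<gamma> (inv P p))"
      unfolding prime_code_def using P(1) by (simp add: prod.reindex)
    also have "multiplicity (P i) \<dots> = \<gamma> (inv P (P i))"
      using P(2) by (subst multiplicity_prod_prime_powers) auto
    finally show ?thesis using P(1) by simp
  qed
  show "\<alpha> = \<beta>" using mult[of _ \<alpha>] mult[of _ \<beta>] eq by auto
qed

lemma prime_code_pos: "0 < prime_code P \<alpha>"
  unfolding prime_code_def using P(2) prime_gt_0_nat by (intro prod_pos) auto

lemma prime_code_zero: "prime_code P (\<lambda>i. 0) = 1"
  by (simp add: prime_code_def)

definition prime_point :: "nat \<Rightarrow> 'i \<Rightarrow> complex" where
  "prime_point n i = 1 / of_nat (P i) ^ n"

lemma mpow_prime_point: "mpow (prime_point n) \<alpha> = 1 / of_nat (prime_code P \<alpha>) ^ n"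
proof -
  have "(\<Prod>i\<in>UNIV. (of_nat (P i) ^ n) ^ \<alpha> i :: complex) = (\<Prod>i\<in>UNIV. of_nat (P i) ^ \<alpha> i) ^ n"
    unfolding prod_power_distrib by (simp add: power_mult[symmetric] mult.commute)
  then show ?thesis
    by (simp add: mpow_def prime_point_def prime_code_def power_divide prod_dividef)
qed

lemma prime_point_tendsto: "(\<lambda>n. prime_point n i) \<longlonglongrightarrow> 0"
proof -
  have "(2::real) \<le> real (P i)" using prime_ge_2_nat[OF P(2)] by (metis of_nat_le_iff of_nat_numeral)
  then have "norm (1 / of_nat (P i) :: complex) < 1" by (simp add: norm_divide)
  from LIMSEQ_power_zero[OF this] show ?thesis
    by (simp add: prime_point_def power_divide)
qed

end

text \<open>A nonzero coefficient of least code would be the limit of a sequence that is constantly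
  zero.\<close>

lemma power_series_unique:
  fixes q :: "('i::finite \<Rightarrow> nat) \<Rightarrow> complex"
  assumes r: "0 < r" and zero: "\<And>x. x \<in> polydisc r \<Longrightarrow> ((\<lambda>\<alpha>. q \<alpha> * mpow x \<alpha>) has_sum 0) UNIV"
  shows "q \<alpha> = 0"
proof (rule ccontr)
  assume "q \<alpha> \<noteq> 0"
  obtain P :: "'i \<Rightarrow> nat" where P: "inj P" "\<And>i. prime (P i)" using ex_distinct_primes[of undefined] by blast
  let ?N = "prime_code P"
  obtain \<alpha>0 where \<alpha>0: "q \<alpha>0 \<noteq> 0" "\<And>\<beta>. q \<beta> \<noteq> 0 \<Longrightarrow> ?N \<alpha>0 \<le> ?N \<beta>"
    using ex_has_least_nat[of "\<lambda>\<beta>. q \<beta> \<noteq> 0" \<alpha> ?N] \<open>q \<alpha> \<noteq> 0\<close> by blast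
  have "(\<lambda>n. of_nat (?N \<alpha>0) ^ n * 0) \<longlonglongrightarrow> q \<alpha>0"
  proof (rule dirichlet_leading_coefficient[OF prime_code_inj[OF P] prime_code_pos[OF P]])
    have "\<forall>\<^sub>F n in sequentially. prime_point P n \<in> polydisc r"
      by (rule polydisc_eventually[OF _ r]) (rule prime_point_tendsto[OF P])
    then show "\<forall>\<^sub>F n in sequentially. ((\<lambda>\<alpha>. q \<alpha> / of_nat (?N \<alpha>) ^ n) has_sum 0) UNIV"
    proof eventually_elim
      case (elim n)
      then show ?case using zero[OF elim] by (simp add: mpow_prime_point[OF P])
    qed
    show "q \<beta> = 0" if "?N \<beta> < ?N \<alpha>0" for \<beta> using \<alpha>0(2)[of \<beta>] that by force
  qed
  then have "q \<alpha>0 = 0" by (simp add: LIMSEQ_const_iff)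
  then show False using \<alpha>0 by simp
qed

text \<open>Averaging over the \<open>n\<close>-th roots of unity in each variable isolates the coefficients whose index
  is congruent to a given one modulo \<open>n\<close>.\<close>

lemma sum_roots_of_unity:
  fixes n a c :: nat
  assumes "0 < n"
  shows "(\<Sum>m<n. cis (2 * pi * real m * (real a - real c) / real n)) = (if a mod n = c mod n then of_nat n else 0)"
proof -
  let ?w = "cis (2 * pi * (real a - real c) / real n)"
  have pow: "cis (2 * pi * real m * (real a - real c) / real n) = ?w ^ m" for m
    by (simp add: Complex.DeMoivre algebra_simps)
  have w1: "?w = 1 \<longleftrightarrow> a mod n = c mod n"
  proof -
    have "?w = 1 \<longleftrightarrow> (\<exists>k::int. 2 * pi * (real a - real c) / real n = 2 * pi * of_int k)"
      unfolding cis_conv_exp exp_eq_1 by (auto simp: mult_ac)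
    also have "\<dots> \<longleftrightarrow> (\<exists>k::int. int a - int c = k * int n)"
    proof (intro ex_cong1)
      fix k :: int
      have "2 * pi * (real a - real c) / real n = 2 * pi * of_int k \<longleftrightarrow> real a - real c = of_int k * real n"
        using assms by (simp add: divide_eq_eq mult.assoc)
      also have "\<dots> \<longleftrightarrow> real_of_int (int a - int c) = real_of_int (k * int n)" by simp
      also have "\<dots> \<longleftrightarrow> int a - int c = k * int n" by (simp only: of_int_eq_iff)
      finally show "2 * pi * (real a - real c) / real n = 2 * pi * of_int k \<longleftrightarrow> int a - int c = k * int n" .
    qed
    also have "\<dots> \<longleftrightarrow> int a mod int n = int c mod int n"
      by (simp add: mod_eq_dvd_iff dvd_def mult.commute)
    also have "\<dots> \<longleftrightarrow> a mod n = c mod n" by (metis zmod_int of_nat_eq_iff)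
    finally show ?thesis .
  qed
  have wn: "?w ^ n = 1"
  proof -
    have "?w ^ n = cis (2 * pi * of_int (int a - int c))" using assms by (simp add: Complex.DeMoivre)
    then show ?thesis by (simp only: cis_multiple_2pi Ints_of_int)
  qed
  show ?thesis
  proof (cases "?w = 1")
    case True
    then show ?thesis unfolding pow using w1 by simp
  next
    case False
    then show ?thesis unfolding pow using w1 wn by (simp add: geometric_sum)
  qed
qed

text \<open>Test the kernel on the torus of radius \<rho> at \<open>n\<close>-th roots of unity,
  with the character of \<alpha> as test vector. Up to a positive factor the form is the sum of the
  weighted coefficients over the indices congruent to \<alpha> modulo \<open>n\<close>. For large
  \<open>n\<close> the index \<alpha> dominates, and the nonnegative reals are closed.\<close>

lemma diagonal_kernel_coeff_nonneg:
  fixes d :: "('i::finite \<Rightarrow> nat) \<Rightarrow> complex"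
  assumes r: "0 < r" and psd: "reproducing_kernel (polydisc r) K"
    and sums: "\<And>z w. z \<in> polydisc r \<Longrightarrow> w \<in> polydisc r \<Longrightarrow>
      ((\<lambda>\<alpha>. d \<alpha> * (mpow z \<alpha> * cnj (mpow w \<alpha>))) has_sum K z w) UNIV"
  shows "d \<alpha> \<in> \<real>\<^sub>\<ge>\<^sub>0"
proof -
  define \<rho> where "\<rho> = r / 2"
  have \<rho>: "0 < \<rho>" "\<rho> < r" using r by (auto simp: \<rho>_def)
  define R where "R = (\<lambda>\<beta>. mpow (\<lambda>i::'i. complex_of_real \<rho>) \<beta>)"
  have R: "R \<beta> = of_real (\<Prod>i\<in>UNIV. \<rho> ^ \<beta> i)" for \<beta> by (simp add: R_def mpow_def)
  define e where "e = (\<lambda>\<beta>. d \<beta> * (R \<beta> * R \<beta>))"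
  define cg where "cg = (\<lambda>n (\<beta>::'i \<Rightarrow> nat). \<forall>i. \<beta> i mod n = \<alpha> i mod n)"
  have avg: "\<exists>s\<in>\<real>\<^sub>\<ge>\<^sub>0. ((\<lambda>\<beta>. if cg n \<beta> then e \<beta> else 0) has_sum s) UNIV" if n: "0 < n" for n
  proof -
    define M where "M = Pi\<^sub>E (UNIV :: 'i set) (\<lambda>_. {..<n})"
    define \<zeta> where "\<zeta> = (\<lambda>m (i::'i). of_real \<rho> * cis (2 * pi * real (m i) / real n))"
    define c where "c = (\<lambda>m. \<Prod>i\<in>(UNIV :: 'i set). cis (2 * pi * real (m i) * real (\<alpha> i) / real n))"
    define T where "T = (\<lambda>\<beta>. if cg n \<beta> then of_nat n ^ CARD('i) * R \<beta> else 0)"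
    have fM: "finite M" unfolding M_def by (rule finite_PiE) auto
    have \<zeta>: "\<zeta> m \<in> polydisc r" for m using \<rho> by (simp add: \<zeta>_def polydisc_def norm_mult)
    have T: "(\<Sum>m\<in>M. cnj (c m) * mpow (\<zeta> m) \<beta>) = T \<beta>" for \<beta>
    proof -
      have "(\<Sum>m\<in>M. cnj (c m) * mpow (\<zeta> m) \<beta>)
          = (\<Sum>m\<in>M. \<Prod>i\<in>UNIV. of_real \<rho> ^ \<beta> i * cis (2 * pi * real (m i) * (real (\<beta> i) - real (\<alpha> i)) / real n))"
      proof (rule sum.cong[OF refl])
        fix m
        have "cnj (c m) * mpow (\<zeta> m) \<beta> = (\<Prod>i\<in>UNIV. cis (- (2 * pi * real (m i) * real (\<alpha> i) / real n))
            * (of_real \<rho> * cis (2 * pi * real (m i) / real n)) ^ \<beta> i)"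
          unfolding c_def mpow_def \<zeta>_def cnj_prod prod.distrib[symmetric] by (simp add: cis_cnj)
        also have "\<dots> = (\<Prod>i\<in>UNIV. of_real \<rho> ^ \<beta> i * cis (2 * pi * real (m i) * (real (\<beta> i) - real (\<alpha> i)) / real n))"
        proof (rule prod.cong[OF refl])
          fix i
          have "cis (- (2 * pi * real (m i) * real (\<alpha> i) / real n)) * cis (real (\<beta> i) * (2 * pi * real (m i) / real n))
             = cis (2 * pi * real (m i) * (real (\<beta> i) - real (\<alpha> i)) / real n)"
            unfolding cis_mult by (rule arg_cong[of _ _ cis]) (simp add: algebra_simps diff_divide_distrib)
          then show "cis (- (2 * pi * real (m i) * real (\<alpha> i) / real n))
            * (of_real \<rho> * cis (2 * pi * real (m i) / real n)) ^ \<beta> i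
            = of_real \<rho> ^ \<beta> i * cis (2 * pi * real (m i) * (real (\<beta> i) - real (\<alpha> i)) / real n)"
            unfolding power_mult_distrib Complex.DeMoivre by (simp add: mult.left_commute)
        qed
        finally show "cnj (c m) * mpow (\<zeta> m) \<beta>
          = (\<Prod>i\<in>UNIV. of_real \<rho> ^ \<beta> i * cis (2 * pi * real (m i) * (real (\<beta> i) - real (\<alpha> i)) / real n))" .
      qed
      also have "\<dots> = (\<Prod>i\<in>UNIV. \<Sum>m<n. of_real \<rho> ^ \<beta> i * cis (2 * pi * real m * (real (\<beta> i) - real (\<alpha> i)) / real n))"
        unfolding M_def by (rule prod_sum_PiE[symmetric]) auto
      also have "\<dots> = (\<Prod>i\<in>UNIV. of_real \<rho> ^ \<beta> i * (if \<beta> i mod n = \<alpha> i mod n then of_nat n else 0))"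
        unfolding sum_distrib_left[symmetric] sum_roots_of_unity[OF n] by (rule refl)
      also have "\<dots> = T \<beta>"
      proof (cases "cg n \<beta>")
        case True
        then show ?thesis by (simp add: T_def cg_def R_def mpow_def prod.distrib mult.commute)
      next
        case False
        then obtain i where "\<beta> i mod n \<noteq> \<alpha> i mod n" by (auto simp: cg_def)
        then show ?thesis using False unfolding T_def by (auto intro!: prod_zero bexI[of _ i])
      qed
      finally show ?thesis .
    qed
    define S where "S = sesq M (\<lambda>m m'. K (\<zeta> m) (\<zeta> m')) c c"
    have S: "S \<in> \<real>\<^sub>\<ge>\<^sub>0" unfolding S_def
      by (rule psd_sesq[OF reproducing_kernelD[OF reproducing_kernel_pullback[OF psd \<zeta>] fM order_refl]])
    have "((\<lambda>\<beta>. sesq M (\<lambda>m m'. d \<beta> * (mpow (\<zeta> m) \<beta> * cnj (mpow (\<zeta> m') \<beta>))) c c) has_sum S) UNIV"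
      unfolding S_def by (intro sesq_has_sum fM sums \<zeta>)
    also have "(\<lambda>\<beta>. sesq M (\<lambda>m m'. d \<beta> * (mpow (\<zeta> m) \<beta> * cnj (mpow (\<zeta> m') \<beta>))) c c)
        = (\<lambda>\<beta>. d \<beta> * (T \<beta> * cnj (T \<beta>)))"
    proof
      fix \<beta>
      have "(\<Sum>m\<in>M. cnj (mpow (\<zeta> m) \<beta>) * c m) = cnj (T \<beta>)"
        unfolding T[symmetric] by (simp add: mult.commute)
      then show "sesq M (\<lambda>m m'. d \<beta> * (mpow (\<zeta> m) \<beta> * cnj (mpow (\<zeta> m') \<beta>))) c c = d \<beta> * (T \<beta> * cnj (T \<beta>))"
        unfolding sesq_cmult sesq_rank1 T by simp
    qed
    finally have "((\<lambda>\<beta>. of_real (1 / real n ^ (2 * CARD('i))) * (d \<beta> * (T \<beta> * cnj (T \<beta>))))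
        has_sum (of_real (1 / real n ^ (2 * CARD('i))) * S)) UNIV"
      by (rule has_sum_cmult_right)
    moreover have "of_real (1 / real n ^ (2 * CARD('i))) * (d \<beta> * (T \<beta> * cnj (T \<beta>))) = (if cg n \<beta> then e \<beta> else 0)" for \<beta>
    proof -
      have "T \<beta> * cnj (T \<beta>) = (if cg n \<beta> then of_nat n ^ (2 * CARD('i)) * (R \<beta> * R \<beta>) else 0)"
        unfolding T_def R by (simp add: power_mult power2_eq_square power_mult_distrib)
      then show ?thesis using n by (simp add: e_def)
    qed
    moreover have "of_real (1 / real n ^ (2 * CARD('i))) * S \<in> \<real>\<^sub>\<ge>\<^sub>0"
      by (rule nonneg_Reals_mult_I[OF _ S]) (simp add: complex_nonneg_Reals_iff del: of_real_divide of_real_power)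
    ultimately show ?thesis by auto
  qed
  have \<rho>mem: "(\<lambda>i. complex_of_real \<rho>) \<in> polydisc r" using \<rho> by (simp add: polydisc_def)
  have "(e has_sum K (\<lambda>i. of_real \<rho>) (\<lambda>i. of_real \<rho>)) UNIV"
    using sums[OF \<rho>mem \<rho>mem] unfolding e_def cnj_mpow R_def by simp
  then have "e summable_on UNIV" by (rule has_sum_imp_summable)
  then have "(\<lambda>\<beta>. norm (e \<beta>)) summable_on UNIV" using summable_on_iff_abs_summable_on_complex by blast
  then obtain E where E: "((\<lambda>\<beta>. norm (e \<beta>)) has_sum E) UNIV" by (auto simp: summable_on_def)
  have "e \<alpha> \<in> \<real>\<^sub>\<ge>\<^sub>0"
  proof (rule closed_approachable[OF closed_nonneg_Reals_complex, THEN iffD1], intro allI impI)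
    fix \<epsilon> :: real assume "\<epsilon> > 0"
    then obtain F where F: "finite F" "dist (\<Sum>\<beta>\<in>F. norm (e \<beta>)) E \<le> \<epsilon> / 2"
      using has_sum_finite_approximation[OF E, of "\<epsilon> / 2"] by auto
    \<comment> \<open>\<open>F\<close> carries all but \<open>\<epsilon> / 2\<close> of the absolute
      sum, and \<open>n\<close> exceeds every entry of \<alpha> and of the indices in
      \<open>F\<close>; among these, congruence modulo \<open>n\<close> is equality.\<close>
    define n where "n = Suc (\<Sum>\<beta>\<in>insert \<alpha> F. \<Sum>i\<in>UNIV. \<beta> i)"
    have small: "\<beta> i < n" if "\<beta> \<in> insert \<alpha> F" for \<beta> i
    proof -
      have "\<beta> i \<le> (\<Sum>i\<in>UNIV. \<beta> i)" by (rule member_le_sum) auto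
      also have "\<dots> \<le> (\<Sum>\<beta>\<in>insert \<alpha> F. \<Sum>i\<in>UNIV. \<beta> i)"
        using F(1) that by (intro member_le_sum[of \<beta> "insert \<alpha> F" "\<lambda>\<beta>. \<Sum>i\<in>UNIV. \<beta> i"]) auto
      finally show ?thesis by (simp add: n_def)
    qed
    obtain s where s: "s \<in> \<real>\<^sub>\<ge>\<^sub>0" "((\<lambda>\<beta>. if cg n \<beta> then e \<beta> else 0) has_sum s) UNIV"
      using avg[of n] by (auto simp: n_def)
    have "norm (s - e \<alpha>) \<le> E - (\<Sum>\<beta>\<in>F. norm (e \<beta>))"
    proof (rule norm_infsum_le)
      show "((\<lambda>\<beta>. (if cg n \<beta> then e \<beta> else 0) - (if \<beta> = \<alpha> then e \<alpha> else 0)) has_sum (s - e \<alpha>)) UNIV"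
        by (rule has_sum_diff_general[OF s(2) has_sum_indicator])
      have "((\<lambda>\<beta>. - (if \<beta> \<in> F then norm (e \<beta>) else 0)) has_sum (- (\<Sum>\<beta>\<in>F. norm (e \<beta>)))) UNIV"
        using F(1) by (intro has_sum_finite_neutralI[of F]) (auto simp: sum_negf)
      from has_sum_add[OF E this]
      show "((\<lambda>\<beta>. norm (e \<beta>) + - (if \<beta> \<in> F then norm (e \<beta>) else 0)) has_sum (E - (\<Sum>\<beta>\<in>F. norm (e \<beta>)))) UNIV"
        by simp
      fix \<beta>
      have F\<alpha>: "\<beta> = \<alpha>" if "\<beta> \<in> F" "cg n \<beta>"
      proof
        fix i
        have "\<beta> i mod n = \<alpha> i mod n" using that(2) by (simp add: cg_def)
        then show "\<beta> i = \<alpha> i" using small[of \<beta> i] small[of \<alpha> i] that(1) by simp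
      qed
      have cg\<alpha>: "cg n \<alpha>" by (simp add: cg_def)
      show "norm ((if cg n \<beta> then e \<beta> else 0) - (if \<beta> = \<alpha> then e \<alpha> else 0))
          \<le> norm (e \<beta>) + - (if \<beta> \<in> F then norm (e \<beta>) else 0)"
      proof (cases "\<beta> = \<alpha>")
        case False
        then have "\<not> cg n \<beta>" if "\<beta> \<in> F" using F\<alpha> that by blast
        then show ?thesis using False by (cases "\<beta> \<in> F") simp_all
      qed (simp add: cg\<alpha>)
    qed
    also have "\<dots> < \<epsilon>" using F(2) \<open>\<epsilon> > 0\<close> unfolding dist_real_def by argo
    finally show "\<exists>y\<in>\<real>\<^sub>\<ge>\<^sub>0. dist y (e \<alpha>) < \<epsilon>" using s(1) by (auto simp: dist_norm)
  qed
  moreover define q where "q = (\<Prod>i\<in>UNIV. \<rho> ^ \<alpha> i)"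
  moreover have "q > 0" unfolding q_def using \<rho> by (intro prod_pos) auto
  ultimately have "of_real (1 / (q * q)) * e \<alpha> \<in> \<real>\<^sub>\<ge>\<^sub>0"
    by (intro nonneg_Reals_mult_I) (simp_all add: complex_nonneg_Reals_iff del: of_real_divide of_real_mult)
  moreover have "R \<alpha> = of_real q" by (simp only: R q_def)
  then have "of_real (1 / (q * q)) * e \<alpha> = d \<alpha>"
    using \<open>q > 0\<close> by (simp add: e_def)
  ultimately show ?thesis by simp
qed

section \<open>Cauchy products and scaled limits of finite products\<close>

lemma finite_multi_index_le: "finite {\<alpha> :: 'i::finite \<Rightarrow> nat. \<forall>i. \<alpha> i \<le> \<gamma> i}"
proof -
  have "{\<alpha> :: 'i \<Rightarrow> nat. \<forall>i. \<alpha> i \<le> \<gamma> i} = Pi\<^sub>E UNIV (\<lambda>i. {..\<gamma> i})" by (auto simp: PiE_def)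
  then show ?thesis by (simp add: finite_PiE)
qed

lemma has_sum_product_complex:
  fixes f :: "'b \<Rightarrow> complex" and g :: "'c \<Rightarrow> complex"
  assumes f: "(f has_sum a) A" and g: "(g has_sum c) B"
  shows "((\<lambda>(x, y). f x * g y) has_sum (a * c)) (A \<times> B)"
proof (rule has_sum_SigmaI)
  show "((\<lambda>y. case (x, y) of (x, y) \<Rightarrow> f x * g y) has_sum (f x * c)) B" for x
    using has_sum_cmult_right[OF g, of "f x"] by simp
  show "((\<lambda>x. f x * c) has_sum (a * c)) A" by (rule has_sum_cmult_left[OF f])
  have nf: "(\<lambda>x. norm (f x)) summable_on A" and ng: "(\<lambda>x. norm (g x)) summable_on B"
    using f g summable_on_iff_abs_summable_on_complex has_sum_imp_summable by blast+
  have "(\<lambda>p. norm (case p of (x, y) \<Rightarrow> f x * g y)) summable_on (A \<times> B)"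
  proof (rule summable_on_SigmaI)
    show "((\<lambda>y. norm (case (x, y) of (x, y) \<Rightarrow> f x * g y)) has_sum (norm (f x) * infsum (\<lambda>y. norm (g y)) B)) B" for x
      using has_sum_cmult_right[OF has_sum_infsum[OF ng], of "norm (f x)"] by (simp add: norm_mult)
    show "(\<lambda>x. norm (f x) * infsum (\<lambda>y. norm (g y)) B) summable_on A"
      by (rule summable_on_cmult_left[OF nf])
  qed auto
  then show "(\<lambda>(x, y). f x * g y) summable_on A \<times> B"
    using summable_on_iff_abs_summable_on_complex by blast
qed

text \<open>Pairs of indices are regrouped by their sum. The truncated subtraction is exact on the
  range of summation.\<close>

lemma has_sum_cauchy_product:
  fixes f g :: "('i::finite \<Rightarrow> nat) \<Rightarrow> complex"
  assumes "(f has_sum a) UNIV" "(g has_sum c) UNIV"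
  shows "((\<lambda>\<gamma>. \<Sum>\<alpha> | \<forall>i. \<alpha> i \<le> \<gamma> i. f \<alpha> * g (\<lambda>i. \<gamma> i - \<alpha> i)) has_sum (a * c)) UNIV"
proof (rule has_sum_SigmaD)
  have "((\<lambda>(x, y). f x * g y) has_sum (a * c)) (UNIV \<times> UNIV)" by (rule has_sum_product_complex[OF assms])
  also have "?this \<longleftrightarrow> ((\<lambda>(\<gamma>, \<alpha>). f \<alpha> * g (\<lambda>i. \<gamma> i - \<alpha> i)) has_sum (a * c))
      (SIGMA \<gamma>:UNIV. {\<alpha>. \<forall>i. \<alpha> i \<le> \<gamma> i})"
    by (rule has_sum_reindex_bij_witness[where j = "\<lambda>(\<alpha>, \<beta>). (\<lambda>i. \<alpha> i + \<beta> i, \<alpha>)"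
          and i = "\<lambda>(\<gamma>, \<alpha>). (\<alpha>, \<lambda>i. \<gamma> i - \<alpha> i)"]) (auto simp: fun_eq_iff)
  finally show "((\<lambda>(\<gamma>, \<alpha>). f \<alpha> * g (\<lambda>i. \<gamma> i - \<alpha> i)) has_sum (a * c))
      (SIGMA \<gamma>:UNIV. {\<alpha>. \<forall>i. \<alpha> i \<le> \<gamma> i})" .
  show "((\<lambda>\<alpha>. case (\<gamma>, \<alpha>) of (\<gamma>, \<alpha>) \<Rightarrow> f \<alpha> * g (\<lambda>i. \<gamma> i - \<alpha> i)) has_sum
      (\<Sum>\<alpha> | \<forall>i. \<alpha> i \<le> \<gamma> i. f \<alpha> * g (\<lambda>i. \<gamma> i - \<alpha> i))) {\<alpha>. \<forall>i. \<alpha> i \<le> \<gamma> i}" for \<gamma>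
    using finite_multi_index_le by (intro has_sum_finiteI) auto
qed

lemma mpow_split: "\<forall>i. \<alpha> i \<le> \<gamma> i \<Longrightarrow> mpow x \<alpha> * mpow x (\<lambda>i. \<gamma> i - \<alpha> i) = mpow x \<gamma>"
  by (simp flip: mpow_add)

text \<open>A product rule: as all factors tend to \<open>1\<close>, telescoping leaves the sum of
  the individual scaled differences. The scale \<open>s n\<close> may be unbounded.\<close>

lemma prod_diff_limit:
  fixes u v :: "'p \<Rightarrow> nat \<Rightarrow> complex"
  assumes "finite J"
    and "\<And>j. j \<in> J \<Longrightarrow> u j \<longlonglongrightarrow> 1" "\<And>j. j \<in> J \<Longrightarrow> v j \<longlonglongrightarrow> 1"
    and "\<And>j. j \<in> J \<Longrightarrow> (\<lambda>n. s n * (u j n - v j n)) \<longlonglongrightarrow> d j"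
  shows "(\<lambda>n. s n * ((\<Prod>j\<in>J. u j n) - (\<Prod>j\<in>J. v j n))) \<longlonglongrightarrow> (\<Sum>j\<in>J. d j)"
  using assms
proof (induction J rule: finite_induct)
  case (insert j J)
  have "(\<lambda>n. \<Prod>j\<in>J. u j n) \<longlonglongrightarrow> (\<Prod>j\<in>J. 1)"
    using insert.prems by (intro tendsto_prod) auto
  then have U: "(\<lambda>n. \<Prod>j\<in>J. u j n) \<longlonglongrightarrow> 1" by simp
  have IH: "(\<lambda>n. s n * ((\<Prod>j\<in>J. u j n) - (\<Prod>j\<in>J. v j n))) \<longlonglongrightarrow> (\<Sum>j\<in>J. d j)"
    using insert.prems by (intro insert.IH) auto
  have dj: "(\<lambda>n. s n * (u j n - v j n)) \<longlonglongrightarrow> d j" and vj: "v j \<longlonglongrightarrow> 1"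
    using insert.prems by auto
  have "(\<lambda>n. (s n * (u j n - v j n)) * (\<Prod>j\<in>J. u j n) + v j n * (s n * ((\<Prod>j\<in>J. u j n) - (\<Prod>j\<in>J. v j n))))
      \<longlonglongrightarrow> d j * 1 + 1 * (\<Sum>j\<in>J. d j)"
    by (intro tendsto_add tendsto_mult dj U vj IH)
  then show ?case using insert.hyps by (simp add: algebra_simps)
qed simp

section \<open>The orthogonal basis of monomials\<close>

locale diag_space = rkhs "polydisc \<rho>" k H ip
  for \<rho> :: real and k :: "('i::finite \<Rightarrow> complex) \<Rightarrow> ('i \<Rightarrow> complex) \<Rightarrow> complex" and H ip +
  fixes \<kappa> :: "('i \<Rightarrow> nat) \<Rightarrow> real"
  assumes radius: "0 < \<rho>" and \<kappa>_pos: "\<And>\<alpha>. 0 < \<kappa> \<alpha>"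
    and k_sum: "\<And>z w. z \<in> polydisc \<rho> \<Longrightarrow> w \<in> polydisc \<rho> \<Longrightarrow>
      ((\<lambda>\<alpha>. of_real (\<kappa> \<alpha>) * (mpow z \<alpha> * cnj (mpow w \<alpha>))) has_sum k z w) UNIV"
begin

abbreviation "Y \<equiv> polydisc \<rho> :: ('i \<Rightarrow> complex) set"

definition e :: "('i \<Rightarrow> nat) \<Rightarrow> ('i \<Rightarrow> complex) \<Rightarrow> complex" where
  "e \<alpha> = fun_on Y (\<lambda>x. mpow x \<alpha>)"

definition partial :: "('i \<Rightarrow> nat) set \<Rightarrow> ('i \<Rightarrow> complex) \<Rightarrow> ('i \<Rightarrow> complex) \<Rightarrow> complex" where
  "partial F z w = (\<Sum>\<alpha>\<in>F. of_real (\<kappa> \<alpha>) * (mpow z \<alpha> * cnj (mpow w \<alpha>)))"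

lemma term_psd: "reproducing_kernel Y (\<lambda>z w. of_real (\<kappa> \<alpha>) * (mpow z \<alpha> * cnj (mpow w \<alpha>)))"
  using \<kappa>_pos[of \<alpha>]
  by (intro reproducing_kernel_scale reproducing_kernel_rank1) (simp add: complex_nonneg_Reals_iff)

lemma partial_psd: "reproducing_kernel Y (partial F)"
  unfolding partial_def[abs_def] by (intro reproducing_kernel_sum term_psd)

lemma remainder_psd:
  assumes "finite F"
  shows "reproducing_kernel Y (\<lambda>z w. k z w - partial F z w)"
proof (rule reproducing_kernel_has_sum)
  show "reproducing_kernel Y (\<lambda>z w. if \<alpha> \<in> F then 0 else of_real (\<kappa> \<alpha>) * (mpow z \<alpha> * cnj (mpow w \<alpha>)))" for \<alpha>
    using term_psd reproducing_kernel_zero by (cases "\<alpha> \<in> F") simp_all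
  fix z w assume "z \<in> Y" "w \<in> Y"
  have "((\<lambda>\<alpha>. if \<alpha> \<in> F then of_real (\<kappa> \<alpha>) * (mpow z \<alpha> * cnj (mpow w \<alpha>)) else 0) has_sum partial F z w) UNIV"
    unfolding partial_def using assms by (intro has_sum_finite_neutralI[of F]) auto
  from has_sum_diff_general[OF k_sum[OF \<open>z \<in> Y\<close> \<open>w \<in> Y\<close>] this]
  show "((\<lambda>\<alpha>. if \<alpha> \<in> F then 0 else of_real (\<kappa> \<alpha>) * (mpow z \<alpha> * cnj (mpow w \<alpha>)))
      has_sum (k z w - partial F z w)) UNIV"
    by (rule has_sum_cong[THEN iffD1, rotated]) simp
qed

text \<open>The kernel \<open>k\<close> dominates each single term of its expansion.\<close>

lemma e_mem: "e \<alpha> \<in> H"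
proof (rule kernel_dominated_mem(1))
  show "e \<alpha> x = 0" if "x \<notin> Y" for x using that by (simp add: e_def fun_on_def)
  show "0 \<le> sqrt (1 / \<kappa> \<alpha>)" using \<kappa>_pos[of \<alpha>] by simp
  have "reproducing_kernel Y (\<lambda>z w. of_real (1 / \<kappa> \<alpha>) * (k z w - partial {\<alpha>} z w))"
    using \<kappa>_pos[of \<alpha>] by (intro reproducing_kernel_scale remainder_psd) (simp_all add: complex_nonneg_Reals_iff)
  then show "reproducing_kernel Y (\<lambda>x y. of_real ((sqrt (1 / \<kappa> \<alpha>))\<^sup>2) * k x y - e \<alpha> x * cnj (e \<alpha> y))"
  proof (rule reproducing_kernel_congD)
    fix z w assume zw: "z \<in> Y" "w \<in> Y"
    have "of_real (1 / \<kappa> \<alpha>) * partial {\<alpha>} z w = e \<alpha> z * cnj (e \<alpha> w)"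
      using \<kappa>_pos[of \<alpha>] zw by (simp add: partial_def e_def fun_on_def)
    moreover have "(sqrt (1 / \<kappa> \<alpha>))\<^sup>2 = 1 / \<kappa> \<alpha>" using \<kappa>_pos[of \<alpha>] by simp
    ultimately show "of_real (1 / \<kappa> \<alpha>) * (k z w - partial {\<alpha>} z w)
        = of_real ((sqrt (1 / \<kappa> \<alpha>))\<^sup>2) * k z w - e \<alpha> z * cnj (e \<alpha> w)"
      by (simp only: right_diff_distrib)
  qed
qed

definition proj :: "(('i \<Rightarrow> nat) \<Rightarrow> complex) \<Rightarrow> ('i \<Rightarrow> nat) set \<Rightarrow> ('i \<Rightarrow> complex) \<Rightarrow> complex" where
  "proj d F = (\<lambda>x. \<Sum>\<alpha>\<in>F. d \<alpha> * e \<alpha> x)"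

lemma proj_mem: "proj d F \<in> H"
  unfolding proj_def by (intro sum_mem scale_mem e_mem)

definition kcoef :: "('i \<Rightarrow> complex) \<Rightarrow> ('i \<Rightarrow> nat) \<Rightarrow> complex" where
  "kcoef w \<alpha> = of_real (\<kappa> \<alpha>) * cnj (mpow w \<alpha>)"

text \<open>The difference is the section at \<open>w\<close> of the remainder kernel
  \<open>R\<close>. Its domination by \<open>R w w * k\<close> splits into \<open>R w w\<close>
  times the partial sum and the Schur complement of \<open>R\<close> at \<open>w\<close>.\<close>

lemma kernel_remainder:
  assumes w: "w \<in> Y" and F: "finite F"
  shows "hnorm ip (\<lambda>x. kernel_fun Y k w x - proj (kcoef w) F x) \<le> sqrt (Re (k w w - partial F w w))"
proof (rule kernel_dominated_mem(2))
  let ?R = "\<lambda>z w. k z w - partial F z w"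
  note R = remainder_psd[OF F]
  have Rw: "?R w w \<in> \<real>\<^sub>\<ge>\<^sub>0" by (rule reproducing_kernel_diag[OF R w])
  show "kernel_fun Y k w x - proj (kcoef w) F x = 0" if "x \<notin> Y" for x
    using that by (simp add: kernel_fun_def fun_on_def proj_def e_def)
  show "0 \<le> sqrt (Re (?R w w))" using Rw by (simp add: complex_nonneg_Reals_iff)
  have C: "complex_of_real ((sqrt (Re (?R w w)))\<^sup>2) = ?R w w"
    using Rw by (simp add: complex_nonneg_Reals_iff complex_eq_iff del: of_real_power)
  have val: "kernel_fun Y k w x - proj (kcoef w) F x = ?R x w" if "x \<in> Y" for x
    using that by (simp add: kernel_fun_def fun_on_def proj_def e_def partial_def kcoef_def mult_ac)
  have "reproducing_kernel Y (\<lambda>x y. ?R w w * partial F x y + (?R w w * ?R x y - ?R x w * ?R w y))"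
    by (intro reproducing_kernel_add reproducing_kernel_scale partial_psd Rw
        reproducing_kernel_schur_complement[OF R w])
  then show "reproducing_kernel Y (\<lambda>x y. of_real ((sqrt (Re (?R w w)))\<^sup>2) * k x y
      - (kernel_fun Y k w x - proj (kcoef w) F x) * cnj (kernel_fun Y k w y - proj (kcoef w) F y))"
  proof (rule reproducing_kernel_congD)
    fix x y assume xy: "x \<in> Y" "y \<in> Y"
    have herm: "cnj (?R y w) = ?R w y" using reproducing_kernel_hermitian[OF R xy(2) w] by simp
    then show "?R w w * partial F x y + (?R w w * ?R x y - ?R x w * ?R w y)
      = of_real ((sqrt (Re (?R w w)))\<^sup>2) * k x y
      - (kernel_fun Y k w x - proj (kcoef w) F x) * cnj (kernel_fun Y k w y - proj (kcoef w) F y)"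
      unfolding C val[OF xy(1)] val[OF xy(2)] herm by (simp add: algebra_simps)
  qed
qed

lemma kernel_remainder_tendsto:
  assumes w: "w \<in> Y"
  shows "((\<lambda>F. hnorm ip (\<lambda>x. kernel_fun Y k w x - proj (kcoef w) F x)) \<longlongrightarrow> 0) (finite_subsets_at_top UNIV)"
proof (rule Lim_null_comparison)
  have "((\<lambda>F. partial F w w) \<longlongrightarrow> k w w) (finite_subsets_at_top UNIV)"
    using k_sum[OF w w] unfolding partial_def has_sum_def .
  then have "((\<lambda>F. sqrt (Re (k w w - partial F w w))) \<longlongrightarrow> sqrt (Re (k w w - k w w))) (finite_subsets_at_top UNIV)"
    by (intro tendsto_intros)
  then show "((\<lambda>F. sqrt (Re (k w w - partial F w w))) \<longlongrightarrow> 0) (finite_subsets_at_top UNIV)" by simp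
  show "\<forall>\<^sub>F F in finite_subsets_at_top UNIV. norm (hnorm ip (\<lambda>x. kernel_fun Y k w x - proj (kcoef w) F x))
      \<le> sqrt (Re (k w w - partial F w w))"
  proof (rule eventually_finite_subsets_at_top_weakI)
    fix F :: "('i \<Rightarrow> nat) set" assume "finite F"
    then show "norm (hnorm ip (\<lambda>x. kernel_fun Y k w x - proj (kcoef w) F x)) \<le> sqrt (Re (k w w - partial F w w))"
      using kernel_remainder[OF w] hnorm_nonneg[OF diff_mem[OF kernel_mem[OF w] proj_mem]] by simp
  qed
qed

text \<open>Orthogonality is read off from the reproducing property: pairing
  \<open>e \<alpha>\<close> with the expansion of the kernel function at \<open>w\<close> is a power
  series in \<open>w\<close> whose sum is the monomial \<open>mpow w \<alpha>\<close>, and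
  coefficients are unique.\<close>

lemma ip_e_e: "ip (e \<alpha>) (e \<beta>) = (if \<alpha> = \<beta> then of_real (1 / \<kappa> \<alpha>) else 0)"
proof -
  let ?q = "\<lambda>\<beta>. of_real (\<kappa> \<beta>) * ip (e \<alpha>) (e \<beta>) - (if \<beta> = \<alpha> then 1 else 0)"
  have "?q \<beta> = 0"
  proof (rule power_series_unique[where q = ?q, OF radius])
    fix w assume w: "w \<in> Y"
    have lim: "((\<lambda>F. ip (e \<alpha>) (proj (kcoef w) F)) \<longlongrightarrow> mpow w \<alpha>) (finite_subsets_at_top UNIV)"
    proof (rule Lim_null_comparison[THEN LIM_zero_cancel])
      show "\<forall>\<^sub>F F in finite_subsets_at_top UNIV. norm (ip (e \<alpha>) (proj (kcoef w) F) - mpow w \<alpha>)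
          \<le> hnorm ip (e \<alpha>) * hnorm ip (\<lambda>x. kernel_fun Y k w x - proj (kcoef w) F x)"
      proof (rule always_eventually, rule allI)
        fix F
        have "mpow w \<alpha> = ip (e \<alpha>) (kernel_fun Y k w)"
          using reproducing[OF e_mem w] w by (simp add: e_def fun_on_def)
        then have "norm (ip (e \<alpha>) (proj (kcoef w) F) - mpow w \<alpha>)
            = norm (ip (e \<alpha>) (\<lambda>x. kernel_fun Y k w x - proj (kcoef w) F x))"
          unfolding ip_diff_right[OF kernel_mem[OF w] proj_mem e_mem] by (simp add: norm_minus_commute)
        then show "norm (ip (e \<alpha>) (proj (kcoef w) F) - mpow w \<alpha>)
          \<le> hnorm ip (e \<alpha>) * hnorm ip (\<lambda>x. kernel_fun Y k w x - proj (kcoef w) F x)"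
          using ip_cs[OF e_mem diff_mem[OF kernel_mem[OF w] proj_mem]] by simp
      qed
      show "((\<lambda>F. hnorm ip (e \<alpha>) * hnorm ip (\<lambda>x. kernel_fun Y k w x - proj (kcoef w) F x)) \<longlongrightarrow> 0)
          (finite_subsets_at_top UNIV)"
        by (rule tendsto_mult_right_zero[OF kernel_remainder_tendsto[OF w]])
    qed
    have "ip (e \<alpha>) (proj (kcoef w) F) = (\<Sum>\<beta>\<in>F. of_real (\<kappa> \<beta>) * ip (e \<alpha>) (e \<beta>) * mpow w \<beta>)" for F
      unfolding proj_def
      by (subst ip_sum_right) (auto simp: scale_mem e_mem ip_scale_right kcoef_def mult_ac)
    then have "((\<lambda>\<beta>. of_real (\<kappa> \<beta>) * ip (e \<alpha>) (e \<beta>) * mpow w \<beta>) has_sum mpow w \<alpha>) UNIV"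
      using lim by (simp add: has_sum_def)
    from has_sum_diff_general[OF this has_sum_indicator[of \<alpha> "mpow w \<alpha>"]]
    have "((\<lambda>\<beta>. of_real (\<kappa> \<beta>) * ip (e \<alpha>) (e \<beta>) * mpow w \<beta> - (if \<beta> = \<alpha> then mpow w \<alpha> else 0)) has_sum 0) UNIV"
      by simp
    also have "(\<lambda>\<beta>. of_real (\<kappa> \<beta>) * ip (e \<alpha>) (e \<beta>) * mpow w \<beta> - (if \<beta> = \<alpha> then mpow w \<alpha> else 0))
        = (\<lambda>\<beta>. ?q \<beta> * mpow w \<beta>)"
      by (auto simp: left_diff_distrib)
    finally show "((\<lambda>\<beta>. ?q \<beta> * mpow w \<beta>) has_sum 0) UNIV" .
  qed
  then show ?thesis using \<kappa>_pos[of \<beta>] by (auto simp: field_simps split: if_splits)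
qed

definition coef :: "(('i \<Rightarrow> complex) \<Rightarrow> complex) \<Rightarrow> ('i \<Rightarrow> nat) \<Rightarrow> complex" where
  "coef f \<alpha> = of_real (\<kappa> \<alpha>) * ip f (e \<alpha>)"

lemma coef_add_scale: "f \<in> H \<Longrightarrow> g \<in> H \<Longrightarrow> coef (\<lambda>x. f x + c * g x) \<alpha> = coef f \<alpha> + c * coef g \<alpha>"
  by (simp add: coef_def ip_add ip_scale e_mem scale_mem algebra_simps)

lemma coef_kernel: "w \<in> Y \<Longrightarrow> coef (kernel_fun Y k w) \<alpha> = kcoef w \<alpha>"
  using ip_cnj[OF e_mem kernel_mem] reproducing[OF e_mem]
  by (simp add: coef_def kcoef_def e_def fun_on_def)

text \<open>Pythagoras. It allows the coefficients of an approximating combination to stand in for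
  those of \<open>f\<close>.\<close>

lemma best_approximation:
  assumes f: "f \<in> H" and F: "finite F"
  shows "hnorm ip (\<lambda>x. f x - proj (coef f) F x) \<le> hnorm ip (\<lambda>x. f x - proj d F x)"
proof -
  let ?u = "\<lambda>x. f x - proj (coef f) F x" and ?v = "proj (\<lambda>\<alpha>. coef f \<alpha> - d \<alpha>) F"
  have u: "?u \<in> H" by (rule diff_mem[OF f proj_mem])
  have orth: "ip ?u (e \<beta>) = 0" if "\<beta> \<in> F" for \<beta>
  proof -
    have "ip (proj (coef f) F) (e \<beta>) = (\<Sum>\<alpha>\<in>F. coef f \<alpha> * ip (e \<alpha>) (e \<beta>))"
      unfolding proj_def by (subst ip_sum) (auto simp: scale_mem e_mem ip_scale)
    also have "\<dots> = (\<Sum>\<alpha>\<in>F. if \<alpha> = \<beta> then coef f \<beta> * of_real (1 / \<kappa> \<beta>) else 0)"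
      by (intro sum.cong) (auto simp: ip_e_e)
    also have "\<dots> = ip f (e \<beta>)"
      using that F \<kappa>_pos[of \<beta>] by (simp add: coef_def)
    finally show ?thesis using ip_diff[OF f proj_mem e_mem] by simp
  qed
  have "ip ?u ?v = 0"
    unfolding proj_def[of "\<lambda>\<alpha>. coef f \<alpha> - d \<alpha>"]
    using orth by (subst ip_sum_right) (auto simp: scale_mem e_mem ip_scale_right u)
  then have "(hnorm ip (\<lambda>x. ?u x + 1 * ?v x))\<^sup>2 = (hnorm ip ?u)\<^sup>2 + (hnorm ip ?v)\<^sup>2"
    unfolding hnorm_sq_add_scale[OF u proj_mem] by simp
  moreover have "(\<lambda>x. ?u x + 1 * ?v x) = (\<lambda>x. f x - proj d F x)"
    by (simp add: proj_def sum_subtractf left_diff_distrib)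
  ultimately have "(hnorm ip ?u)\<^sup>2 \<le> (hnorm ip (\<lambda>x. f x - proj d F x))\<^sup>2" by simp
  then show ?thesis using hnorm_nonneg[OF diff_mem[OF f proj_mem]] power2_le_imp_le by blast
qed

text \<open>The claim holds for kernel functions by \<open>kernel_remainder_tendsto\<close> and is
  linear; \<open>best_approximation\<close> carries it to limits of combinations.\<close>

lemma expansion_tendsto:
  assumes f: "f \<in> H"
  shows "((\<lambda>F. hnorm ip (\<lambda>x. f x - proj (coef f) F x)) \<longlongrightarrow> 0) (finite_subsets_at_top UNIV)"
proof -
  let ?good = "\<lambda>f. ((\<lambda>F. hnorm ip (\<lambda>x. f x - proj (coef f) F x)) \<longlongrightarrow> 0) (finite_subsets_at_top UNIV)"
  have add: "?good (\<lambda>x. f x + c * g x)" if "f \<in> H" "g \<in> H" "?good f" "?good g" for f g c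
  proof (rule Lim_null_comparison)
    have lim: "((\<lambda>F. hnorm ip (\<lambda>x. f x - proj (coef f) F x) + norm c * hnorm ip (\<lambda>x. g x - proj (coef g) F x))
        \<longlongrightarrow> 0 + norm c * 0) (finite_subsets_at_top UNIV)"
      by (intro tendsto_add tendsto_mult tendsto_const that)
    then show "((\<lambda>F. hnorm ip (\<lambda>x. f x - proj (coef f) F x) + norm c * hnorm ip (\<lambda>x. g x - proj (coef g) F x))
        \<longlongrightarrow> 0) (finite_subsets_at_top UNIV)" by simp
    show "\<forall>\<^sub>F F in finite_subsets_at_top UNIV.
        norm (hnorm ip (\<lambda>x. (f x + c * g x) - proj (coef (\<lambda>x. f x + c * g x)) F x))
        \<le> hnorm ip (\<lambda>x. f x - proj (coef f) F x) + norm c * hnorm ip (\<lambda>x. g x - proj (coef g) F x)"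
    proof (rule always_eventually, rule allI)
      fix F
      let ?u = "\<lambda>x. f x - proj (coef f) F x" and ?v = "\<lambda>x. g x - proj (coef g) F x"
      have uv: "?u \<in> H" "?v \<in> H" using diff_mem proj_mem that by auto
      have "(\<lambda>x. (f x + c * g x) - proj (coef (\<lambda>x. f x + c * g x)) F x) = (\<lambda>x. ?u x + c * ?v x)"
        unfolding proj_def coef_add_scale[OF that(1,2)]
        by (simp add: algebra_simps sum.distrib sum_distrib_left)
      then show "norm (hnorm ip (\<lambda>x. (f x + c * g x) - proj (coef (\<lambda>x. f x + c * g x)) F x))
        \<le> hnorm ip ?u + norm c * hnorm ip ?v"
        using hnorm_triangle[OF uv(1) scale_mem[OF uv(2)], of c] hnorm_scale[OF uv(2), of c]
          hnorm_nonneg[OF add_mem[OF uv(1) scale_mem[OF uv(2)]], of c] by simp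
    qed
  qed
  have zero: "?good (\<lambda>x. 0)"
    using ip_zero[OF e_mem] by (simp add: coef_def proj_def hnorm_zero)
  have kern: "?good (kernel_fun Y k w)" if "w \<in> Y" for w
  proof -
    have "coef (kernel_fun Y k w) = kcoef w" using coef_kernel[OF that] by auto
    then show ?thesis using kernel_remainder_tendsto[OF that] by simp
  qed
  have ks: "(\<lambda>x. \<Sum>w\<in>G. c w * kernel_fun Y k w x) \<in> H \<and> ?good (\<lambda>x. \<Sum>w\<in>G. c w * kernel_fun Y k w x)"
    if "finite G" "G \<subseteq> Y" for G c
    using that
  proof (induction G rule: finite_induct)
    case (insert w G)
    then have "?good (\<lambda>x. (\<Sum>w\<in>G. c w * kernel_fun Y k w x) + c w * kernel_fun Y k w x)"
      by (intro add kern kernel_mem) auto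
    moreover have "(\<lambda>x. (\<Sum>w\<in>G. c w * kernel_fun Y k w x) + c w * kernel_fun Y k w x) \<in> H"
      using insert by (intro add_mem scale_mem kernel_mem) auto
    ultimately show ?case using insert.hyps by (simp add: add.commute)
  next
    case empty
    show ?case using zero zero_mem by simp
  qed
  show ?thesis
  proof (rule tendstoI)
    fix \<epsilon> :: real assume "\<epsilon> > 0"
    then obtain c where c: "c \<in> coeffs" "hnorm ip (\<lambda>x. f x - kspan c x) < \<epsilon> / 2"
      using kspan_dense[OF f, of "\<epsilon> / 2"] by auto
    let ?g = "kspan c"
    have g: "?g \<in> H" by (rule kspan_mem[OF c(1)])
    have "?good ?g" using c(1) ks[of "{w. c w \<noteq> 0}" c] unfolding kspan_def coeffs_def by blast
    then have "\<forall>\<^sub>F F in finite_subsets_at_top UNIV. hnorm ip (\<lambda>x. ?g x - proj (coef ?g) F x) < \<epsilon> / 2"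
      using \<open>\<epsilon> > 0\<close> by (intro order_tendstoD(2)) auto
    moreover have "\<forall>\<^sub>F F in finite_subsets_at_top UNIV. finite (F :: ('i \<Rightarrow> nat) set)"
      by (rule eventually_finite_subsets_at_top_weakI)
    ultimately show "\<forall>\<^sub>F F in finite_subsets_at_top UNIV. dist (hnorm ip (\<lambda>x. f x - proj (coef f) F x)) 0 < \<epsilon>"
    proof eventually_elim
      case (elim F)
      have "hnorm ip (\<lambda>x. f x - proj (coef f) F x) \<le> hnorm ip (\<lambda>x. f x - proj (coef ?g) F x)"
        by (rule best_approximation[OF f elim(2)])
      also have "\<dots> \<le> hnorm ip (\<lambda>x. f x - ?g x) + hnorm ip (\<lambda>x. ?g x - proj (coef ?g) F x)"
        by (rule hnorm_diff_triangle[OF f g proj_mem])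
      finally show ?case
        using c(2) elim(1) hnorm_nonneg[OF diff_mem[OF f proj_mem]] by (simp add: dist_real_def)
    qed
  qed
qed

text \<open>Norm convergence over the net of finite index sets makes the series unconditionally
  convergent, as needed for the Cauchy product later.\<close>

lemma functional_expansion:
  assumes L: "bounded_functional H ip \<Lambda>" and f: "f \<in> H"
  shows "((\<lambda>\<alpha>. coef f \<alpha> * \<Lambda> (e \<alpha>)) has_sum \<Lambda> f) UNIV"
proof -
  obtain C where add: "\<And>f g. f \<in> H \<Longrightarrow> g \<in> H \<Longrightarrow> \<Lambda> (\<lambda>x. f x + g x) = \<Lambda> f + \<Lambda> g"
    and scale: "\<And>c f. f \<in> H \<Longrightarrow> \<Lambda> (\<lambda>x. c * f x) = c * \<Lambda> f"
    and C: "\<And>f. f \<in> H \<Longrightarrow> norm (\<Lambda> f) \<le> C * hnorm ip f"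
    using L unfolding bounded_functional_def by blast
  have zero: "\<Lambda> (\<lambda>x. 0) = 0" using scale[OF zero_mem, of 0] by simp
  have sum: "\<Lambda> (proj d F) = (\<Sum>\<alpha>\<in>F. d \<alpha> * \<Lambda> (e \<alpha>))" if "finite F" for d F
    using that
  proof (induction F rule: finite_induct)
    case (insert \<alpha> F)
    have "proj d (insert \<alpha> F) = (\<lambda>x. d \<alpha> * e \<alpha> x + proj d F x)"
      using insert.hyps by (simp add: proj_def)
    then show ?case using insert add[OF scale_mem[OF e_mem] proj_mem] scale[OF e_mem] by simp
  qed (simp add: proj_def zero)
  have "((\<lambda>F. \<Lambda> (proj (coef f) F)) \<longlongrightarrow> \<Lambda> f) (finite_subsets_at_top UNIV)"
  proof (rule Lim_null_comparison[THEN LIM_zero_cancel])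
    show "\<forall>\<^sub>F F in finite_subsets_at_top UNIV. norm (\<Lambda> (proj (coef f) F) - \<Lambda> f)
        \<le> C * hnorm ip (\<lambda>x. f x - proj (coef f) F x)"
    proof (rule always_eventually, rule allI)
      fix F
      have "\<Lambda> (\<lambda>x. f x + (- 1) * proj (coef f) F x) = \<Lambda> f + (- 1) * \<Lambda> (proj (coef f) F)"
        using add[OF f scale_mem[OF proj_mem]] scale[OF proj_mem] by presburger
      then have "\<Lambda> f - \<Lambda> (proj (coef f) F) = \<Lambda> (\<lambda>x. f x - proj (coef f) F x)" by simp
      then show "norm (\<Lambda> (proj (coef f) F) - \<Lambda> f) \<le> C * hnorm ip (\<lambda>x. f x - proj (coef f) F x)"
        using C[OF diff_mem[OF f proj_mem]] by (metis norm_minus_commute)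
    qed
    show "((\<lambda>F. C * hnorm ip (\<lambda>x. f x - proj (coef f) F x)) \<longlongrightarrow> 0) (finite_subsets_at_top UNIV)"
      by (rule tendsto_mult_right_zero[OF expansion_tendsto[OF f]])
  qed
  moreover have "\<forall>\<^sub>F F in finite_subsets_at_top UNIV.
      \<Lambda> (proj (coef f) F) = (\<Sum>\<alpha>\<in>F. coef f \<alpha> * \<Lambda> (e \<alpha>))"
    by (rule eventually_finite_subsets_at_top_weakI) (rule sum)
  ultimately show ?thesis unfolding has_sum_def by (simp add: tendsto_cong)
qed

lemma pointwise_expansion:
  assumes f: "f \<in> H" and z: "z \<in> Y"
  shows "((\<lambda>\<alpha>. coef f \<alpha> * mpow z \<alpha>) has_sum f z) UNIV"
proof -
  have "bounded_functional H ip (\<lambda>f. f z)"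
    unfolding bounded_functional_def
  proof (intro conjI exI[of _ "hnorm ip (kernel_fun Y k z)"] ballI)
    show "norm (f z) \<le> hnorm ip (kernel_fun Y k z) * hnorm ip f" if "f \<in> H" for f
      using eval_bound[OF that z] by (simp add: mult.commute)
  qed auto
  from functional_expansion[OF this f] show ?thesis using z by (simp add: e_def fun_on_def)
qed

lemma coef_unique:
  assumes f: "f \<in> H" and c: "\<And>z. z \<in> Y \<Longrightarrow> ((\<lambda>\<alpha>. c \<alpha> * mpow z \<alpha>) has_sum f z) UNIV"
  shows "coef f \<alpha> = c \<alpha>"
proof -
  have "coef f \<alpha> - c \<alpha> = 0"
  proof (rule power_series_unique[OF radius])
    fix z assume z: "z \<in> Y"
    from has_sum_diff_general[OF pointwise_expansion[OF f z] c[OF z]]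
    show "((\<lambda>\<alpha>. (coef f \<alpha> - c \<alpha>) * mpow z \<alpha>) has_sum 0) UNIV"
      by (simp add: left_diff_distrib)
  qed
  then show ?thesis by simp
qed

lemma coef_mult:
  assumes "f \<in> H" "g \<in> H" "(\<lambda>x. f x * g x) \<in> H"
  shows "coef (\<lambda>x. f x * g x) \<gamma> = (\<Sum>\<alpha> | \<forall>i. \<alpha> i \<le> \<gamma> i. coef f \<alpha> * coef g (\<lambda>i. \<gamma> i - \<alpha> i))"
proof (rule coef_unique[OF assms(3)])
  fix z assume z: "z \<in> Y"
  have "((\<lambda>\<gamma>. \<Sum>\<alpha> | \<forall>i. \<alpha> i \<le> \<gamma> i. (coef f \<alpha> * mpow z \<alpha>)
      * (coef g (\<lambda>i. \<gamma> i - \<alpha> i) * mpow z (\<lambda>i. \<gamma> i - \<alpha> i))) has_sum (f z * g z)) UNIV"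
    by (rule has_sum_cauchy_product[OF pointwise_expansion[OF assms(1) z] pointwise_expansion[OF assms(2) z]])
  also have "(\<lambda>\<gamma>. \<Sum>\<alpha> | \<forall>i. \<alpha> i \<le> \<gamma> i. (coef f \<alpha> * mpow z \<alpha>)
      * (coef g (\<lambda>i. \<gamma> i - \<alpha> i) * mpow z (\<lambda>i. \<gamma> i - \<alpha> i)))
    = (\<lambda>\<gamma>. (\<Sum>\<alpha> | \<forall>i. \<alpha> i \<le> \<gamma> i. coef f \<alpha> * coef g (\<lambda>i. \<gamma> i - \<alpha> i)) * mpow z \<gamma>)"
    unfolding sum_distrib_right
    by (intro ext sum.cong refl) (simp add: mpow_split[symmetric] mult_ac)
  finally show "((\<lambda>\<gamma>. (\<Sum>\<alpha> | \<forall>i. \<alpha> i \<le> \<gamma> i. coef f \<alpha> * coef g (\<lambda>i. \<gamma> i - \<alpha> i)) * mpow z \<gamma>)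
      has_sum (f z * g z)) UNIV" .
qed

text \<open>Here \<mu> can be any tuple: summability at \<mu> comes from boundedness of \<Lambda>,
  not from \<mu> lying in the polydisc.\<close>

lemma multiplicative_if_character_on_monomials:
  assumes L: "bounded_functional H ip \<Lambda>" and ch: "\<And>\<alpha>. \<Lambda> (e \<alpha>) = mpow \<mu> \<alpha>"
  shows "multiplicative_functional H \<Lambda>"
  unfolding multiplicative_functional_def
proof (intro ballI impI)
  fix f g assume fg: "f \<in> H" "g \<in> H" "(\<lambda>x. f x * g x) \<in> H"
  have "((\<lambda>\<gamma>. \<Sum>\<alpha> | \<forall>i. \<alpha> i \<le> \<gamma> i. (coef f \<alpha> * mpow \<mu> \<alpha>)
      * (coef g (\<lambda>i. \<gamma> i - \<alpha> i) * mpow \<mu> (\<lambda>i. \<gamma> i - \<alpha> i))) has_sum (\<Lambda> f * \<Lambda> g)) UNIV"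
    using functional_expansion[OF L fg(1)] functional_expansion[OF L fg(2)] unfolding ch
    by (rule has_sum_cauchy_product)
  also have "(\<lambda>\<gamma>. \<Sum>\<alpha> | \<forall>i. \<alpha> i \<le> \<gamma> i. (coef f \<alpha> * mpow \<mu> \<alpha>)
      * (coef g (\<lambda>i. \<gamma> i - \<alpha> i) * mpow \<mu> (\<lambda>i. \<gamma> i - \<alpha> i)))
    = (\<lambda>\<gamma>. coef (\<lambda>x. f x * g x) \<gamma> * mpow \<mu> \<gamma>)"
    unfolding coef_mult[OF fg] sum_distrib_right
    by (intro ext sum.cong refl) (simp add: mpow_split[symmetric] mult_ac)
  finally show "\<Lambda> (\<lambda>x. f x * g x) = \<Lambda> f * \<Lambda> g"
    using functional_expansion[OF L fg(3)] unfolding ch by (metis has_sum_unique)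
qed

end

section \<open>Functionals on a polydisc\<close>

context cnp_family
begin

lemma b_mult_t: "x \<in> X \<Longrightarrow> y \<in> X \<Longrightarrow> b j x y * t j x y = t j x y - 1"
  using t_nz[of x y j] by (simp add: b_def left_diff_distrib)

lemma prod_minus_one_psd: "finite A \<Longrightarrow> reproducing_kernel X (\<lambda>x y. (\<Prod>l\<in>A. t l x y) - 1)"
proof (induction A rule: finite_induct)
  case (insert l A)
  have "reproducing_kernel X (\<lambda>x y. b l x y * (t l x y * (\<Prod>l\<in>A. t l x y)) + ((\<Prod>l\<in>A. t l x y) - 1))"
    by (intro reproducing_kernel_add reproducing_kernel_mult reproducing_kernel_prod b_kernel t_psd insert.IH)
  then show ?case
  proof (rule reproducing_kernel_congD)
    fix x y assume "x \<in> X" "y \<in> X"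
    then have t: "b l x y * t l x y = t l x y - 1" by (rule b_mult_t)
    have "b l x y * (t l x y * (\<Prod>l\<in>A. t l x y)) = (t l x y - 1) * (\<Prod>l\<in>A. t l x y)"
      unfolding t[symmetric] by (simp add: mult.assoc)
    then show "b l x y * (t l x y * (\<Prod>l\<in>A. t l x y)) + ((\<Prod>l\<in>A. t l x y) - 1) = (\<Prod>l\<in>insert l A. t l x y) - 1"
      using insert.hyps by (simp add: algebra_simps)
  qed
qed (simp add: reproducing_kernel_zero)

text \<open>Since \<open>t - 1 = b * t\<close>, a new factor \<open>l\<close> raises the expression
  by \<open>b l\<close> times the enlarged product minus one, which is positive.\<close>

lemma prod_minus_linear_psd:
  "finite A \<Longrightarrow> reproducing_kernel X (\<lambda>x y. (\<Prod>l\<in>A. t l x y) - 1 - (\<Sum>l\<in>A. b l x y))"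
proof (induction A rule: finite_induct)
  case (insert l A)
  have "reproducing_kernel X (\<lambda>x y. b l x y * ((\<Prod>l\<in>insert l A. t l x y) - 1)
      + ((\<Prod>l\<in>A. t l x y) - 1 - (\<Sum>l\<in>A. b l x y)))"
    using insert.hyps by (intro reproducing_kernel_add reproducing_kernel_mult b_kernel insert.IH prod_minus_one_psd) auto
  then show ?case
  proof (rule reproducing_kernel_congD)
    fix x y assume xy: "x \<in> X" "y \<in> X"
    have t: "b l x y * t l x y = t l x y - 1" by (rule b_mult_t[OF xy])
    have "b l x y * ((\<Prod>l\<in>insert l A. t l x y) - 1) = b l x y * t l x y * (\<Prod>l\<in>A. t l x y) - b l x y"
      using insert.hyps by (simp add: algebra_simps)
    then show "b l x y * ((\<Prod>l\<in>insert l A. t l x y) - 1) + ((\<Prod>l\<in>A. t l x y) - 1 - (\<Sum>l\<in>A. b l x y))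
        = (\<Prod>l\<in>insert l A. t l x y) - 1 - (\<Sum>l\<in>insert l A. b l x y)"
      unfolding t using insert.hyps by (simp add: algebra_simps)
  qed
qed (simp add: reproducing_kernel_zero)

text \<open>The increment used in \<open>prod_minus_linear_psd\<close>, with a chosen
  \<open>j\<close> as the last factor: it exhibits \<open>b j * (k - 1)\<close> as the part from
  which strict positivity will come.\<close>

lemma schur_minus_linear:
  assumes "x \<in> X" "y \<in> X"
  shows "schur_product t x y - 1 - (\<Sum>l\<in>UNIV. b l x y)
    = b j x y * (schur_product t x y - 1) + ((\<Prod>l\<in>UNIV - {j}. t l x y) - 1 - (\<Sum>l\<in>UNIV - {j}. b l x y))"
proof -
  have k: "schur_product t x y = t j x y * (\<Prod>l\<in>UNIV - {j}. t l x y)"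
    unfolding schur_product_def by (rule prod.remove) auto
  have s: "(\<Sum>l\<in>UNIV. b l x y) = b j x y + (\<Sum>l\<in>UNIV - {j}. b l x y)"
    by (rule sum.remove) auto
  have "b j x y * t j x y = t j x y - 1" by (rule b_mult_t[OF assms])
  then have "b j x y * schur_product t x y = (t j x y - 1) * (\<Prod>l\<in>UNIV - {j}. t l x y)"
    unfolding k by (metis mult.assoc)
  then show ?thesis unfolding s by (simp add: k algebra_simps)
qed

lemma schur_inverse: "x \<in> X \<Longrightarrow> y \<in> X \<Longrightarrow> schur_product t x y * (\<Prod>j\<in>UNIV. 1 - b j x y) = 1"
  by (simp add: schur_product_def b_def t_nz flip: prod.distrib)

end

section \<open>Coefficient comparison for diagonal Pick factors on a polydisc\<close>

locale diag_cnp = cnp_space "polydisc \<rho>" t "\<lambda>i. 0" H ip + diag_space \<rho> "schur_product t" H ip \<kappa>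
  for \<rho> :: real and t :: "'p::finite \<Rightarrow> ('i::finite \<Rightarrow> complex) \<Rightarrow> ('i \<Rightarrow> complex) \<Rightarrow> complex" and H ip \<kappa> +
  fixes a :: "'p \<Rightarrow> ('i \<Rightarrow> nat) \<Rightarrow> real"
  assumes t_sum: "\<And>j z w. z \<in> polydisc \<rho> \<Longrightarrow> w \<in> polydisc \<rho> \<Longrightarrow>
      ((\<lambda>\<alpha>. of_real (a j \<alpha>) * (mpow z \<alpha> * cnj (mpow w \<alpha>))) has_sum t j z w) UNIV"
begin

lemma Y_scale: "z \<in> Y \<Longrightarrow> (\<And>i. norm (x i) \<le> 1) \<Longrightarrow> (\<lambda>i. x i * z i) \<in> Y"
  unfolding polydisc_def norm_mult mem_Collect_eq
  by (metis mult_left_le_one_le norm_ge_zero order_le_less_trans)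

text \<open>A diagonal series involves only the products of \<open>z i\<close> with the conjugate of
  \<open>w i\<close>, so a factor moves to the other side conjugated.\<close>

lemma t_shift:
  assumes "z \<in> Y" "w \<in> Y" "\<And>i. norm (x i) \<le> 1"
  shows "t j (\<lambda>i. x i * z i) w = t j z (\<lambda>i. cnj (x i) * w i)"
proof -
  have 1: "(\<lambda>i. x i * z i) \<in> Y" "(\<lambda>i. cnj (x i) * w i) \<in> Y" using assms by (auto intro!: Y_scale)
  have "mpow (\<lambda>i. x i * z i) \<alpha> * cnj (mpow w \<alpha>) = mpow z \<alpha> * cnj (mpow (\<lambda>i. cnj (x i) * w i) \<alpha>)" for \<alpha>
    by (simp add: mpow_mult cnj_mpow)
  then show ?thesis
    using t_sum[OF 1(1) assms(2), of j] t_sum[OF assms(1) 1(2), of j] by (simp add: has_sum_unique)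
qed

definition r :: real where "r = \<rho> / 2"

lemma r: "0 < r" "r < \<rho>"
  using radius by (auto simp: r_def)

lemma mem_Y_r: "(\<And>i. norm (w i) \<le> r) \<Longrightarrow> w \<in> Y"
  unfolding polydisc_def using r(2) by (auto intro: order_le_less_trans)

abbreviation w0 :: "'i \<Rightarrow> complex" where "w0 \<equiv> \<lambda>i. of_real r"

lemma w0: "w0 \<in> Y"
  using r by (intro mem_Y_r) simp

definition bf :: "'p \<Rightarrow> ('i \<Rightarrow> complex) \<Rightarrow> ('i \<Rightarrow> complex) \<Rightarrow> complex" where
  "bf j w = fun_on Y (\<lambda>z. b j z w)"

lemma inverse_eq_bf: "fun_on Y (\<lambda>z. 1 / t j z w) = (\<lambda>x. fun_on Y (\<lambda>z. 1) x + (- 1) * bf j w x)"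
  by (auto simp: fun_on_def bf_def b_def)

lemma bf_mem:
  assumes "w \<in> Y"
  shows "bf j w \<in> H"
proof -
  have "bf j w = (\<lambda>x. fun_on Y (\<lambda>z. 1) x - fun_on Y (\<lambda>z. 1 / t j z w) x)"
    by (auto simp: fun_on_def bf_def b_def)
  then show ?thesis using diff_mem[OF one_mem inverse_mem[OF assms]] by simp
qed

text \<open>Since \<open>b(xz, w) = b(z, x\<^sup>* w)\<close>, the coefficients of \<open>b(\<cdot>, w)\<close> for one \<open>w\<close> with nonzero entries
  determine those for all smaller \<open>w\<close>.\<close>

definition c :: "'p \<Rightarrow> ('i \<Rightarrow> nat) \<Rightarrow> complex" where
  "c j \<alpha> = coef (bf j w0) \<alpha> * mpow (\<lambda>i. 1 / of_real r) \<alpha>"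

text \<open>The series of \<open>1 / t\<close> is never inverted formally: \<open>b\<close> at
  \<open>w0\<close> lies in \<open>H\<close> and so has an expansion, which \<open>t_shift\<close>
  carries to every smaller \<open>w\<close>.\<close>

lemma b_sum:
  assumes z: "z \<in> Y" and w: "\<And>i. norm (w i) \<le> r"
  shows "((\<lambda>\<alpha>. c j \<alpha> * (mpow z \<alpha> * cnj (mpow w \<alpha>))) has_sum b j z w) UNIV"
proof -
  \<comment> \<open>Chosen so that \<open>w\<close> is the conjugate of \<open>x\<close> times
    \<open>w0\<close>; the entries have modulus at most one because those of \<open>w\<close> are at
    most \<open>r\<close>.\<close>
  define x where "x = (\<lambda>i. cnj (w i) / of_real r)"
  have x: "norm (x i) \<le> 1" for i using w[of i] r(1) by (simp add: x_def norm_divide)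
  have w_eq: "w = (\<lambda>i. cnj (x i) * w0 i)" using r(1) by (simp add: x_def)
  have xz: "(\<lambda>i. x i * z i) \<in> Y" by (rule Y_scale[OF z x])
  have "b j z w = b j (\<lambda>i. x i * z i) w0"
    unfolding b_def t_shift[OF z w0 x] w_eq[symmetric] ..
  also have "\<dots> = bf j w0 (\<lambda>i. x i * z i)" using xz by (simp add: bf_def fun_on_def)
  finally have "((\<lambda>\<alpha>. coef (bf j w0) \<alpha> * mpow (\<lambda>i. x i * z i) \<alpha>) has_sum b j z w) UNIV"
    using pointwise_expansion[OF bf_mem[OF w0] xz] by simp
  moreover have "mpow (\<lambda>i. x i * z i) \<alpha> = mpow (\<lambda>i. 1 / of_real r) \<alpha> * (mpow z \<alpha> * cnj (mpow w \<alpha>))" for \<alpha>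
    unfolding cnj_mpow mpow_mult[symmetric] by (simp add: x_def mult_ac)
  ultimately show ?thesis by (simp add: c_def mult.assoc)
qed

lemma coef_bf:
  assumes "\<And>i. norm (w i) \<le> r"
  shows "coef (bf j w) \<alpha> = c j \<alpha> * cnj (mpow w \<alpha>)"
proof (rule coef_unique[OF bf_mem[OF mem_Y_r[OF assms]]])
  fix z assume "z \<in> Y"
  then show "((\<lambda>\<alpha>. c j \<alpha> * cnj (mpow w \<alpha>) * mpow z \<alpha>) has_sum bf j w z) UNIV"
    using b_sum[OF _ assms, of z j] by (simp add: bf_def fun_on_def mult_ac)
qed

lemma polydisc_r: "z \<in> polydisc r \<Longrightarrow> z \<in> Y" "z \<in> polydisc r \<Longrightarrow> norm (z i) \<le> r"
  using r(2) by (auto simp: polydisc_def intro: less_imp_le order_less_trans)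

lemma c_nonneg: "c j \<alpha> \<in> \<real>\<^sub>\<ge>\<^sub>0"
proof (rule diagonal_kernel_coeff_nonneg[OF r(1)])
  show "reproducing_kernel (polydisc r) (b j)"
    by (rule reproducing_kernel_subset[OF b_kernel]) (auto intro: polydisc_r)
  show "((\<lambda>\<alpha>. c j \<alpha> * (mpow z \<alpha> * cnj (mpow w \<alpha>))) has_sum b j z w) UNIV"
    if "z \<in> polydisc r" "w \<in> polydisc r" for z w
    using that by (intro b_sum polydisc_r)
qed

lemma zero_Y: "(\<lambda>i. 0) \<in> Y"
  using radius by (simp add: polydisc_def)

lemma c_zero: "c j (\<lambda>i. 0) = 0"
proof -
  have "b j (\<lambda>i. 0) (\<lambda>i. 0) = 0" using t_norm[OF zero_Y] by (simp add: b_def)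
  then have "((\<lambda>\<alpha>. c j \<alpha> * (mpow (\<lambda>i. 0) \<alpha> * cnj (mpow (\<lambda>i. 0) \<alpha>))) has_sum 0) UNIV"
    using b_sum[OF zero_Y, of "\<lambda>i. 0" j] r(1) by simp
  also have "(\<lambda>\<alpha>. c j \<alpha> * (mpow (\<lambda>i. 0) \<alpha> * cnj (mpow (\<lambda>i. 0) \<alpha>)))
      = (\<lambda>\<alpha>. if \<alpha> = (\<lambda>i. 0) then c j (\<lambda>i. 0) else 0)"
    by (auto simp: mpow_zero)
  finally show ?thesis using has_sum_indicator has_sum_unique by metis
qed

lemma \<kappa>_zero: "\<kappa> (\<lambda>i. 0) = 1"
proof -
  have "((\<lambda>\<alpha>. of_real (\<kappa> \<alpha>) * (mpow (\<lambda>i. 0) \<alpha> * cnj (mpow (\<lambda>i. 0) \<alpha>))) has_sum 1) UNIV"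
    using k_sum[OF zero_Y zero_Y] schur_norm[OF zero_Y] by simp
  also have "(\<lambda>\<alpha>. of_real (\<kappa> \<alpha>) * (mpow (\<lambda>i. 0) \<alpha> * cnj (mpow (\<lambda>i. 0) \<alpha>)))
      = (\<lambda>\<alpha>. if \<alpha> = (\<lambda>i. 0) then complex_of_real (\<kappa> (\<lambda>i. 0)) else 0)"
    by (auto simp: mpow_zero)
  finally have "complex_of_real (\<kappa> (\<lambda>i. 0)) = 1" using has_sum_indicator has_sum_unique by metis
  then show ?thesis by simp
qed

text \<open>Two solutions of \<open>A \<cdot> \<Prod>(1 - B\<^sub>j) = 1\<close> with power series data \<open>\<kappa> p\<close>, \<open>c\<^sub>j p\<close> and \<open>\<kappa> p'\<close>, \<open>c\<^sub>j p'\<close>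
  are compared at the first index where \<open>p\<close> and \<open>p'\<close> differ; all products of lower terms cancel.\<close>

lemma comparison:
  assumes P: "inj P" "\<And>i. prime (P i)"
    and A: "\<forall>\<^sub>F n in sequentially. ((\<lambda>\<alpha>. of_real (\<kappa> \<alpha>) * p \<alpha> / of_nat (prime_code P \<alpha>) ^ n) has_sum A n) UNIV"
    and A': "\<forall>\<^sub>F n in sequentially. ((\<lambda>\<alpha>. of_real (\<kappa> \<alpha>) * p' \<alpha> / of_nat (prime_code P \<alpha>) ^ n) has_sum A' n) UNIV"
    and B: "\<And>j. \<forall>\<^sub>F n in sequentially. ((\<lambda>\<alpha>. c j \<alpha> * p \<alpha> / of_nat (prime_code P \<alpha>) ^ n) has_sum B j n) UNIV"
    and B': "\<And>j. \<forall>\<^sub>F n in sequentially. ((\<lambda>\<alpha>. c j \<alpha> * p' \<alpha> / of_nat (prime_code P \<alpha>) ^ n) has_sum B' j n) UNIV"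
    and prod: "\<forall>\<^sub>F n in sequentially. A n * (\<Prod>j\<in>UNIV. 1 - B j n) = 1"
      "\<forall>\<^sub>F n in sequentially. A' n * (\<Prod>j\<in>UNIV. 1 - B' j n) = 1"
    and p: "p (\<lambda>i. 0) = 1" "p' (\<lambda>i. 0) = 1"
    and low: "\<And>\<alpha>. prime_code P \<alpha> < prime_code P \<alpha>0 \<Longrightarrow> p \<alpha> = p' \<alpha>"
  shows "(of_real (\<kappa> \<alpha>0) - (\<Sum>j\<in>UNIV. c j \<alpha>0)) * (p \<alpha>0 - p' \<alpha>0) = 0"
proof -
  let ?N = "prime_code P"
  let ?s = "\<lambda>n. of_nat (?N \<alpha>0) ^ n :: complex"
  note lead = dirichlet_leading_coefficient[OF prime_code_inj[OF P] prime_code_pos[OF P]]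
  have N0: "\<not> ?N \<alpha> < ?N (\<lambda>i. 0)" for \<alpha>
    using prime_code_pos[OF P, of \<alpha>] by (simp add: prime_code_zero[OF P])
  \<comment> \<open>The zero index has the smallest code, \<open>1\<close>, so the sums converge to
    the constant term without rescaling.\<close>
  have const: "S \<longlonglongrightarrow> q (\<lambda>i. 0)"
    if "\<forall>\<^sub>F n in sequentially. ((\<lambda>\<alpha>. q \<alpha> / of_nat (?N \<alpha>) ^ n) has_sum S n) UNIV" for q :: "('i \<Rightarrow> nat) \<Rightarrow> complex" and S
  proof -
    have "(\<lambda>n. of_nat (?N (\<lambda>i. 0)) ^ n * S n) \<longlonglongrightarrow> q (\<lambda>i. 0)"
      by (rule lead[OF that]) (use N0 in blast)
    then show ?thesis by (simp add: prime_code_zero[OF P])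
  qed
  \<comment> \<open>Below \<alpha>0 the two data agree, so the difference series has its leading
    term at \<alpha>0.\<close>
  have diff: "(\<lambda>n. ?s n * (S n - S' n)) \<longlonglongrightarrow> q \<alpha>0 * (p \<alpha>0 - p' \<alpha>0)"
    if S: "\<forall>\<^sub>F n in sequentially. ((\<lambda>\<alpha>. q \<alpha> * p \<alpha> / of_nat (?N \<alpha>) ^ n) has_sum S n) UNIV"
      "\<forall>\<^sub>F n in sequentially. ((\<lambda>\<alpha>. q \<alpha> * p' \<alpha> / of_nat (?N \<alpha>) ^ n) has_sum S' n) UNIV" for q :: "('i \<Rightarrow> nat) \<Rightarrow> complex" and S S'
  proof (rule lead)
    show "\<forall>\<^sub>F n in sequentially. ((\<lambda>\<alpha>. q \<alpha> * (p \<alpha> - p' \<alpha>) / of_nat (?N \<alpha>) ^ n) has_sum (S n - S' n)) UNIV"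
      using S
    proof eventually_elim
      case (elim n)
      from has_sum_diff_general[OF elim] show ?case
        by (simp add: right_diff_distrib diff_divide_distrib)
    qed
    show "q \<alpha> * (p \<alpha> - p' \<alpha>) = 0" if "?N \<alpha> < ?N \<alpha>0" for \<alpha> using low[OF that] by simp
  qed
  have lA': "A' \<longlonglongrightarrow> 1" using const[OF A'] p by (simp add: \<kappa>_zero)
  have lB: "(\<lambda>n. 1 - B j n) \<longlonglongrightarrow> 1" and lB': "(\<lambda>n. 1 - B' j n) \<longlonglongrightarrow> 1" for j
    using tendsto_diff[OF tendsto_const const[OF B[of j]], of 1]
      tendsto_diff[OF tendsto_const const[OF B'[of j]], of 1] by (simp_all add: c_zero)
  have dB: "(\<lambda>n. ?s n * ((1 - B j n) - (1 - B' j n))) \<longlonglongrightarrow> - (c j \<alpha>0 * (p \<alpha>0 - p' \<alpha>0))" for j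
    using tendsto_minus[OF diff[OF B[of j] B'[of j]]] by (simp add: algebra_simps)
  have dP: "(\<lambda>n. ?s n * ((\<Prod>j\<in>UNIV. 1 - B j n) - (\<Prod>j\<in>UNIV. 1 - B' j n)))
      \<longlonglongrightarrow> (\<Sum>j\<in>UNIV. - (c j \<alpha>0 * (p \<alpha>0 - p' \<alpha>0)))"
    by (rule prod_diff_limit[where u = "\<lambda>j n. 1 - B j n" and v = "\<lambda>j n. 1 - B' j n", OF finite lB lB' dB])
  have "(\<lambda>n. \<Prod>j\<in>UNIV. 1 - B j n) \<longlonglongrightarrow> (\<Prod>j\<in>(UNIV :: 'p set). 1)"
    by (intro tendsto_prod lB)
  then have lP: "(\<lambda>n. \<Prod>j\<in>UNIV. 1 - B j n) \<longlonglongrightarrow> 1" by simp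
  \<comment> \<open>Both products equal \<open>1\<close>, so their difference, written as
    \<open>(A - A') P + A' (P - P')\<close> and scaled, is eventually zero; its limit is the claimed
    expression.\<close>
  have lim: "(\<lambda>n. (?s n * (A n - A' n)) * (\<Prod>j\<in>UNIV. 1 - B j n)
      + A' n * (?s n * ((\<Prod>j\<in>UNIV. 1 - B j n) - (\<Prod>j\<in>UNIV. 1 - B' j n))))
    \<longlonglongrightarrow> (of_real (\<kappa> \<alpha>0) * (p \<alpha>0 - p' \<alpha>0)) * 1 + 1 * (\<Sum>j\<in>UNIV. - (c j \<alpha>0 * (p \<alpha>0 - p' \<alpha>0)))"
    by (intro tendsto_add tendsto_mult diff[OF A A'] lP lA' dP)
  have ev: "\<forall>\<^sub>F n in sequentially. (?s n * (A n - A' n)) * (\<Prod>j\<in>UNIV. 1 - B j n)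
      + A' n * (?s n * ((\<Prod>j\<in>UNIV. 1 - B j n) - (\<Prod>j\<in>UNIV. 1 - B' j n))) = 0"
    using prod
  proof eventually_elim
    case (elim n)
    have "(?s n * (A n - A' n)) * (\<Prod>j\<in>UNIV. 1 - B j n)
      + A' n * (?s n * ((\<Prod>j\<in>UNIV. 1 - B j n) - (\<Prod>j\<in>UNIV. 1 - B' j n)))
      = ?s n * (A n * (\<Prod>j\<in>UNIV. 1 - B j n) - A' n * (\<Prod>j\<in>UNIV. 1 - B' j n))"
      by (simp add: algebra_simps)
    then show ?case using elim by simp
  qed
  have "(of_real (\<kappa> \<alpha>0) * (p \<alpha>0 - p' \<alpha>0)) * 1 + 1 * (\<Sum>j\<in>UNIV. - (c j \<alpha>0 * (p \<alpha>0 - p' \<alpha>0))) = 0"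
    by (rule LIMSEQ_unique[OF lim tendsto_eventually[OF ev]])
  then show ?thesis by (simp add: sum_negf sum_distrib_right left_diff_distrib)
qed

text \<open>Paired with \<open>w0\<close>, this point produces the monomials of
  \<open>\<mu> i * prime_point P n i\<close>. For large \<open>n\<close> it lies in the polydisc,
  whatever \<mu> is.\<close>

definition diag_point :: "('i \<Rightarrow> nat) \<Rightarrow> ('i \<Rightarrow> complex) \<Rightarrow> nat \<Rightarrow> 'i \<Rightarrow> complex" where
  "diag_point P \<mu> n = (\<lambda>i. \<mu> i * prime_point P n i / of_real r)"

lemma diag_point:
  assumes P: "inj P" "\<And>i. prime (P i)"
  shows "\<forall>\<^sub>F n in sequentially. diag_point P \<mu> n \<in> Y"
    and "\<forall>\<^sub>F n in sequentially. ((\<lambda>\<alpha>. of_real (\<kappa> \<alpha>) * mpow \<mu> \<alpha> / of_nat (prime_code P \<alpha>) ^ n)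
          has_sum schur_product t (diag_point P \<mu> n) w0) UNIV"
    and "\<forall>\<^sub>F n in sequentially. ((\<lambda>\<alpha>. c j \<alpha> * mpow \<mu> \<alpha> / of_nat (prime_code P \<alpha>) ^ n)
          has_sum b j (diag_point P \<mu> n) w0) UNIV"
    and "\<forall>\<^sub>F n in sequentially. schur_product t (diag_point P \<mu> n) w0 * (\<Prod>j\<in>UNIV. 1 - b j (diag_point P \<mu> n) w0) = 1"
proof -
  show Y: "\<forall>\<^sub>F n in sequentially. diag_point P \<mu> n \<in> Y"
  proof (rule polydisc_eventually[OF _ radius])
    fix i
    have "(\<lambda>n. \<mu> i * prime_point P n i / of_real r) \<longlonglongrightarrow> \<mu> i * 0 / of_real r"
      using r(1) by (intro tendsto_divide tendsto_mult tendsto_const prime_point_tendsto[OF P]) auto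
    then show "(\<lambda>n. diag_point P \<mu> n i) \<longlonglongrightarrow> 0" by (simp add: diag_point_def)
  qed
  have mono: "mpow (diag_point P \<mu> n) \<alpha> * cnj (mpow w0 \<alpha>) = mpow \<mu> \<alpha> / of_nat (prime_code P \<alpha>) ^ n" for n \<alpha>
  proof -
    have "mpow (diag_point P \<mu> n) \<alpha> * cnj (mpow w0 \<alpha>) = mpow (\<lambda>i. \<mu> i * prime_point P n i) \<alpha>"
      unfolding cnj_mpow mpow_mult[symmetric] using r(1) by (simp add: diag_point_def)
    then show ?thesis by (simp add: mpow_mult mpow_prime_point[OF P])
  qed
  show "\<forall>\<^sub>F n in sequentially. ((\<lambda>\<alpha>. of_real (\<kappa> \<alpha>) * mpow \<mu> \<alpha> / of_nat (prime_code P \<alpha>) ^ n)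
          has_sum schur_product t (diag_point P \<mu> n) w0) UNIV"
    using Y
  proof eventually_elim
    case (elim n)
    from k_sum[OF elim w0] show ?case by (simp only: mono times_divide_eq_right)
  qed
  show "\<forall>\<^sub>F n in sequentially. ((\<lambda>\<alpha>. c j \<alpha> * mpow \<mu> \<alpha> / of_nat (prime_code P \<alpha>) ^ n)
          has_sum b j (diag_point P \<mu> n) w0) UNIV"
    using Y
  proof eventually_elim
    case (elim n)
    have "norm (w0 i) \<le> r" for i using r(1) by simp
    from b_sum[OF elim this] show ?case by (simp only: mono times_divide_eq_right)
  qed
  show "\<forall>\<^sub>F n in sequentially. schur_product t (diag_point P \<mu> n) w0 * (\<Prod>j\<in>UNIV. 1 - b j (diag_point P \<mu> n) w0) = 1"
    using Y by eventually_elim (rule schur_inverse[OF _ w0])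
qed

abbreviation \<delta> :: "'i \<Rightarrow> 'i \<Rightarrow> nat" where "\<delta> i \<equiv> \<lambda>l. if l = i then 1 else 0"

text \<open>First-order part of \<open>k * (\<Prod>j. 1 - b j) = 1\<close>. It comes from
  \<open>comparison\<close> of the solution with all powers equal to \<open>1\<close> against the
  trivial solution \<open>A' = 1\<close>, \<open>B' = 0\<close>, the code of
  \<open>\<delta> i\<close> being \<open>2\<close>.\<close>

lemma linear_coefficients: "of_real (\<kappa> (\<delta> i)) = (\<Sum>j\<in>UNIV. c j (\<delta> i))"
proof -
  obtain P :: "'i \<Rightarrow> nat" where P: "inj P" "\<And>l. prime (P l)" "P i = 2"
    using ex_distinct_primes[of i] by blast
  let ?N = "prime_code P" and ?p' = "\<lambda>\<alpha>. if \<alpha> = (\<lambda>i. 0) then 1 else 0 :: complex"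
  have N: "?N (\<delta> i) = 2"
  proof -
    have "?N (\<delta> i) = (\<Prod>l\<in>UNIV. if l = i then P i else 1)"
      unfolding prime_code_def by (intro prod.cong) auto
    then show ?thesis using P(3) by simp
  qed
  have one: "mpow (\<lambda>i. 1) \<alpha> = 1" for \<alpha> :: "'i \<Rightarrow> nat" by (simp add: mpow_def)
  have pt: "(\<lambda>\<alpha>. q \<alpha> * ?p' \<alpha> / of_nat (?N \<alpha>) ^ n) = (\<lambda>\<alpha>. if \<alpha> = (\<lambda>i. 0) then q (\<lambda>i. 0) else 0)" for q n
    by (auto simp: prime_code_zero[OF P(1,2)])
  have "(of_real (\<kappa> (\<delta> i)) - (\<Sum>j\<in>UNIV. c j (\<delta> i))) * (mpow (\<lambda>i. 1) (\<delta> i) - ?p' (\<delta> i)) = 0"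
  proof (rule comparison[OF P(1,2) diag_point(2)[OF P(1,2)] _ diag_point(3)[OF P(1,2)] _ diag_point(4)[OF P(1,2)]])
    show "\<forall>\<^sub>F n in sequentially. ((\<lambda>\<alpha>. of_real (\<kappa> \<alpha>) * ?p' \<alpha> / of_nat (?N \<alpha>) ^ n) has_sum 1) UNIV"
      unfolding pt \<kappa>_zero of_real_1 by (rule always_eventually) (rule allI, rule has_sum_indicator)
    show "\<forall>\<^sub>F n in sequentially. ((\<lambda>\<alpha>. c j \<alpha> * ?p' \<alpha> / of_nat (?N \<alpha>) ^ n) has_sum 0) UNIV" for j
      unfolding pt c_zero by simp
    show "mpow (\<lambda>i. 1) \<alpha> = ?p' \<alpha>" if "?N \<alpha> < ?N (\<delta> i)" for \<alpha>
    proof -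
      have "?N \<alpha> = ?N (\<lambda>i. 0)"
        using that prime_code_pos[OF P(1,2), of \<alpha>] unfolding N by (simp add: prime_code_zero[OF P(1,2)])
      then have "\<alpha> = (\<lambda>i. 0)" by (rule injD[OF prime_code_inj[OF P(1,2)]])
      then show ?thesis by (simp add: one)
    qed
  qed (auto simp: one)
  moreover have "\<delta> i \<noteq> (\<lambda>i. 0)" by (metis zero_neq_one)
  ultimately show ?thesis by (simp add: one)
qed

lemma sub_term_psd:
  fixes d :: "('i \<Rightarrow> nat) \<Rightarrow> complex"
  assumes sums: "\<And>z w. z \<in> polydisc r \<Longrightarrow> w \<in> polydisc r \<Longrightarrow>
      ((\<lambda>\<alpha>. d \<alpha> * (mpow z \<alpha> * cnj (mpow w \<alpha>))) has_sum K z w) UNIV"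
    and d: "\<And>\<alpha>. d \<alpha> \<in> \<real>\<^sub>\<ge>\<^sub>0" and F: "finite F"
  shows "reproducing_kernel (polydisc r) (\<lambda>z w. K z w - (\<Sum>\<alpha>\<in>F. d \<alpha> * (mpow z \<alpha> * cnj (mpow w \<alpha>))))"
proof (rule reproducing_kernel_has_sum)
  show "reproducing_kernel (polydisc r) (\<lambda>z w. if \<alpha> \<in> F then 0 else d \<alpha> * (mpow z \<alpha> * cnj (mpow w \<alpha>)))" for \<alpha>
    using reproducing_kernel_scale[OF reproducing_kernel_rank1 d] reproducing_kernel_zero
    by (cases "\<alpha> \<in> F") simp_all
  fix z w :: "'i \<Rightarrow> complex" assume zw: "z \<in> polydisc r" "w \<in> polydisc r"
  have "((\<lambda>\<alpha>. if \<alpha> \<in> F then d \<alpha> * (mpow z \<alpha> * cnj (mpow w \<alpha>)) else 0)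
      has_sum (\<Sum>\<alpha>\<in>F. d \<alpha> * (mpow z \<alpha> * cnj (mpow w \<alpha>)))) UNIV"
    using F by (intro has_sum_finite_neutralI[of F]) auto
  from has_sum_diff_general[OF sums[OF zw] this]
  show "((\<lambda>\<alpha>. if \<alpha> \<in> F then 0 else d \<alpha> * (mpow z \<alpha> * cnj (mpow w \<alpha>)))
      has_sum (K z w - (\<Sum>\<alpha>\<in>F. d \<alpha> * (mpow z \<alpha> * cnj (mpow w \<alpha>))))) UNIV"
    by (rule has_sum_cong[THEN iffD1, rotated]) simp
qed

text \<open>Write \<alpha> as \<open>\<delta> i\<close> plus a nonzero index. By
  \<open>linear_coefficients\<close> some \<open>b j\<close> has a positive coefficient at
  \<open>\<delta> i\<close>, and its product with the matching term of \<open>k - 1\<close>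
  contributes a positive amount at \<alpha>. The choice of \<open>j\<close> depends on
  \<open>i\<close>.\<close>

lemma higher_coefficients:
  assumes "\<alpha> \<noteq> (\<lambda>i. 0)" "\<And>i. \<alpha> \<noteq> \<delta> i"
  shows "of_real (\<kappa> \<alpha>) \<noteq> (\<Sum>j\<in>UNIV. c j \<alpha>)"
proof -
  obtain i where i: "\<alpha> i \<noteq> 0" using assms(1) by blast
  define \<alpha>' where "\<alpha>' = (\<lambda>l. \<alpha> l - \<delta> i l)"
  have \<alpha>_eq: "\<alpha> = (\<lambda>l. \<delta> i l + \<alpha>' l)" using i by (auto simp: \<alpha>'_def)
  have \<alpha>'0: "\<alpha>' \<noteq> (\<lambda>i. 0)" using assms(2)[of i] \<alpha>_eq by auto
  have "(\<Sum>j\<in>UNIV. c j (\<delta> i)) \<noteq> 0"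
    unfolding linear_coefficients[symmetric] using \<kappa>_pos[of "\<delta> i"] by simp
  then obtain j where j: "c j (\<delta> i) \<noteq> 0" by (rule sum.not_neutral_contains_not_neutral)
  let ?Z = "polydisc r :: ('i \<Rightarrow> complex) set" and ?k = "schur_product t"
  let ?m = "\<lambda>\<beta> z w. mpow z \<beta> * cnj (mpow w \<beta>)"
  let ?g = "c j (\<delta> i) * of_real (\<kappa> \<alpha>')"
  have sub: "?Z \<subseteq> Y" using polydisc_r by blast
  have \<kappa>0: "complex_of_real (\<kappa> \<beta>) \<in> \<real>\<^sub>\<ge>\<^sub>0" for \<beta>
    using \<kappa>_pos[of \<beta>] by (simp add: complex_nonneg_Reals_iff)
  have ks: "((\<lambda>\<beta>. of_real (\<kappa> \<beta>) * ?m \<beta> z w) has_sum ?k z w) UNIV"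
    if "z \<in> ?Z" "w \<in> ?Z" for z w
    by (rule k_sum[OF polydisc_r(1)[OF that(1)] polydisc_r(1)[OF that(2)]])
  have bs: "((\<lambda>\<beta>. c l \<beta> * ?m \<beta> z w) has_sum b l z w) UNIV"
    if "z \<in> ?Z" "w \<in> ?Z" for l z w
    by (rule b_sum[OF polydisc_r(1)[OF that(1)] polydisc_r(2)[OF that(2)]])
  have k1: "reproducing_kernel ?Z (\<lambda>z w. ?k z w - 1)"
    using sub_term_psd[OF ks \<kappa>0, of "{\<lambda>i. 0}"] by (simp add: mpow_zero_index \<kappa>_zero)
  have k2: "reproducing_kernel ?Z (\<lambda>z w. ?k z w - 1 - of_real (\<kappa> \<alpha>') * ?m \<alpha>' z w)"
    using sub_term_psd[OF ks \<kappa>0, of "{\<lambda>i. 0, \<alpha>'}"] \<alpha>'0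
    by (simp add: mpow_zero_index \<kappa>_zero algebra_simps)
  have b2: "reproducing_kernel ?Z (\<lambda>z w. b j z w - c j (\<delta> i) * ?m (\<delta> i) z w)"
    using sub_term_psd[OF bs c_nonneg, of "{\<delta> i}"] by simp
  let ?D = "\<lambda>z w. ?k z w - 1 - (\<Sum>l\<in>UNIV. b l z w) - ?g * ?m \<alpha> z w"
  \<comment> \<open>Removing one monomial from \<open>b j * (k - 1)\<close> keeps it positive: drop
    the linear term from the first factor, and for that term drop one term from the second.\<close>
  have "reproducing_kernel ?Z (\<lambda>z w. ((b j z w - c j (\<delta> i) * ?m (\<delta> i) z w) * (?k z w - 1)
      + (c j (\<delta> i) * ?m (\<delta> i) z w) * (?k z w - 1 - of_real (\<kappa> \<alpha>') * ?m \<alpha>' z w))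
      + ((\<Prod>l\<in>UNIV - {j}. t l z w) - 1 - (\<Sum>l\<in>UNIV - {j}. b l z w)))"
    by (intro reproducing_kernel_add reproducing_kernel_mult reproducing_kernel_scale reproducing_kernel_rank1
        k1 k2 b2 c_nonneg reproducing_kernel_subset[OF prod_minus_linear_psd sub]) simp
  then have D: "reproducing_kernel ?Z ?D"
  proof (rule reproducing_kernel_congD)
    fix z w assume "z \<in> ?Z" "w \<in> ?Z"
    then have zw: "z \<in> Y" "w \<in> Y" using sub by auto
    have m: "?m \<alpha> z w = ?m (\<delta> i) z w * ?m \<alpha>' z w"
      unfolding \<alpha>_eq mpow_add by simp
    have "((b j z w - c j (\<delta> i) * ?m (\<delta> i) z w) * (?k z w - 1)
      + (c j (\<delta> i) * ?m (\<delta> i) z w) * (?k z w - 1 - of_real (\<kappa> \<alpha>') * ?m \<alpha>' z w))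
      = b j z w * (?k z w - 1) - ?g * (?m (\<delta> i) z w * ?m \<alpha>' z w)"
      by (simp only: left_diff_distrib right_diff_distrib mult_ac) simp
    then show "((b j z w - c j (\<delta> i) * ?m (\<delta> i) z w) * (?k z w - 1)
      + (c j (\<delta> i) * ?m (\<delta> i) z w) * (?k z w - 1 - of_real (\<kappa> \<alpha>') * ?m \<alpha>' z w))
      + ((\<Prod>l\<in>UNIV - {j}. t l z w) - 1 - (\<Sum>l\<in>UNIV - {j}. b l z w)) = ?D z w"
      unfolding schur_minus_linear[OF zw, of j] m by simp
  qed
  define q where "q = (\<lambda>\<beta>. of_real (\<kappa> \<beta>) - (if \<beta> = (\<lambda>i. 0) then 1 else 0)
      - (\<Sum>l\<in>UNIV. c l \<beta>) - (if \<beta> = \<alpha> then ?g else 0))"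
  have "q \<alpha> \<in> \<real>\<^sub>\<ge>\<^sub>0"
  proof (rule diagonal_kernel_coeff_nonneg[where d = q, OF r(1) D])
    fix z w :: "'i \<Rightarrow> complex" assume zw: "z \<in> ?Z" "w \<in> ?Z"
    have "((\<lambda>\<beta>. of_real (\<kappa> \<beta>) * ?m \<beta> z w - (if \<beta> = (\<lambda>i. 0) then 1 else 0)
        - (\<Sum>l\<in>UNIV. c l \<beta> * ?m \<beta> z w) - (if \<beta> = \<alpha> then ?g * ?m \<alpha> z w else 0)) has_sum ?D z w) UNIV"
      by (intro has_sum_diff_general has_sum_indicator has_sum_finite_sum ks bs zw)
    also have "(\<lambda>\<beta>. of_real (\<kappa> \<beta>) * ?m \<beta> z w - (if \<beta> = (\<lambda>i. 0) then 1 else 0)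
        - (\<Sum>l\<in>UNIV. c l \<beta> * ?m \<beta> z w) - (if \<beta> = \<alpha> then ?g * ?m \<alpha> z w else 0))
      = (\<lambda>\<beta>. q \<beta> * ?m \<beta> z w)"
      by (intro ext) (simp add: q_def left_diff_distrib sum_distrib_right mpow_zero_index)
    finally show "((\<lambda>\<beta>. q \<beta> * ?m \<beta> z w) has_sum ?D z w) UNIV" .
  qed
  then have "of_real (\<kappa> \<alpha>) - (\<Sum>l\<in>UNIV. c l \<alpha>) - ?g \<in> \<real>\<^sub>\<ge>\<^sub>0" using assms(1) by (simp add: q_def)
  moreover have "Re ?g > 0"
    using c_nonneg[of j "\<delta> i"] j \<kappa>_pos[of \<alpha>'] by (auto simp: complex_nonneg_Reals_iff complex_eq_iff less_le)
  ultimately show ?thesis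
  proof (intro notI)
    assume eq: "of_real (\<kappa> \<alpha>) = (\<Sum>j\<in>UNIV. c j \<alpha>)"
    assume "of_real (\<kappa> \<alpha>) - (\<Sum>l\<in>UNIV. c l \<alpha>) - ?g \<in> \<real>\<^sub>\<ge>\<^sub>0" "Re ?g > 0"
    then show False unfolding eq by (simp add: complex_nonneg_Reals_iff)
  qed
qed

lemma product_imp_multiplicative:
  assumes L: "bounded_functional H ip \<Lambda>" and one: "\<Lambda> (fun_on Y (\<lambda>z. 1)) = 1"
    and prod: "\<And>w. w \<in> Y \<Longrightarrow>
      \<Lambda> (kernel_fun Y (schur_product t) w) * (\<Prod>j\<in>UNIV. \<Lambda> (fun_on Y (\<lambda>z. 1 / t j z w))) = 1"
  shows "multiplicative_functional H \<Lambda>"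
proof (rule multiplicative_if_character_on_monomials[OF L])
  define \<mu> where "\<mu> i = \<Lambda> (e (\<delta> i))" for i
  have e0: "e (\<lambda>i. 0) = fun_on Y (\<lambda>z. 1)" by (simp add: e_def mpow_zero_index)
  have \<mu>: "mpow \<mu> (\<delta> i) = \<Lambda> (e (\<delta> i))" for i
  proof -
    have "mpow \<mu> (\<delta> i) = (\<Prod>l\<in>UNIV. if l = i then \<mu> i else 1)"
      unfolding mpow_def by (intro prod.cong) auto
    then show ?thesis by (simp add: \<mu>_def)
  qed
  have inv: "\<Lambda> (fun_on Y (\<lambda>z. 1 / t j z w)) = 1 - \<Lambda> (bf j w)" if "w \<in> Y" for j w
  proof -
    have "\<Lambda> (\<lambda>x. fun_on Y (\<lambda>z. 1) x + (- 1) * bf j w x) = \<Lambda> (fun_on Y (\<lambda>z. 1)) + (- 1) * \<Lambda> (bf j w)"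
      using L one_mem bf_mem[OF that] scale_mem unfolding bounded_functional_def by presburger
    then show ?thesis unfolding inverse_eq_bf one by simp
  qed
  show "\<Lambda> (e \<alpha>) = mpow \<mu> \<alpha>" for \<alpha>
  proof (rule ccontr)
    assume "\<Lambda> (e \<alpha>) \<noteq> mpow \<mu> \<alpha>"
    obtain P :: "'i \<Rightarrow> nat" where P: "inj P" "\<And>i. prime (P i)" using ex_distinct_primes[of undefined] by blast
    let ?N = "prime_code P"
    obtain \<alpha>0 where \<alpha>0: "\<Lambda> (e \<alpha>0) \<noteq> mpow \<mu> \<alpha>0" "\<And>\<beta>. \<Lambda> (e \<beta>) \<noteq> mpow \<mu> \<beta> \<Longrightarrow> ?N \<alpha>0 \<le> ?N \<beta>"
      using ex_has_least_nat[of "\<lambda>\<beta>. \<Lambda> (e \<beta>) \<noteq> mpow \<mu> \<beta>" \<alpha> ?N] \<open>\<Lambda> (e \<alpha>) \<noteq> mpow \<mu> \<alpha>\<close> by blast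
    have near: "\<forall>\<^sub>F n in sequentially. prime_point P n \<in> polydisc r"
      by (rule polydisc_eventually[OF _ r(1)]) (rule prime_point_tendsto[OF P])
    have cnj: "cnj (mpow (prime_point P n) \<beta>) = 1 / of_nat (?N \<beta>) ^ n" for n \<beta>
      by (simp add: mpow_prime_point[OF P])
    \<comment> \<open>The first data are the moments of \<Lambda>, produced by kernel functions at
      prime points; the second are the powers of \<mu>, produced by values of the kernels at
      \<open>diag_point\<close>.\<close>
    have "(of_real (\<kappa> \<alpha>0) - (\<Sum>j\<in>UNIV. c j \<alpha>0)) * (\<Lambda> (e \<alpha>0) - mpow \<mu> \<alpha>0) = 0"
    proof (rule comparison[OF P _ diag_point(2)[OF P] _ diag_point(3)[OF P] _ diag_point(4)[OF P]])
      show "\<forall>\<^sub>F n in sequentially. ((\<lambda>\<alpha>. of_real (\<kappa> \<alpha>) * \<Lambda> (e \<alpha>) / of_nat (?N \<alpha>) ^ n)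
          has_sum \<Lambda> (kernel_fun Y (schur_product t) (prime_point P n))) UNIV"
        using near
      proof eventually_elim
        case (elim n)
        then have w: "prime_point P n \<in> Y" by (rule polydisc_r)
        from functional_expansion[OF L kernel_mem[OF w]] show ?case
          unfolding coef_kernel[OF w] kcoef_def cnj by (simp add: mult.commute)
      qed
      show "\<forall>\<^sub>F n in sequentially. ((\<lambda>\<alpha>. c j \<alpha> * \<Lambda> (e \<alpha>) / of_nat (?N \<alpha>) ^ n)
          has_sum \<Lambda> (bf j (prime_point P n))) UNIV" for j
        using near
      proof eventually_elim
        case (elim n)
        then have w: "prime_point P n \<in> Y" by (rule polydisc_r)
        from functional_expansion[OF L bf_mem[OF w, of j]] show ?case
          unfolding coef_bf[OF polydisc_r(2)[OF elim]] cnj by (simp add: mult.commute)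
      qed
      show "\<forall>\<^sub>F n in sequentially. \<Lambda> (kernel_fun Y (schur_product t) (prime_point P n))
          * (\<Prod>j\<in>UNIV. 1 - \<Lambda> (bf j (prime_point P n))) = 1"
        using near
      proof eventually_elim
        case (elim n)
        then have w: "prime_point P n \<in> Y" by (rule polydisc_r)
        from prod[OF w] show ?case unfolding inv[OF w] .
      qed
      show "\<Lambda> (e \<alpha>) = mpow \<mu> \<alpha>" if "?N \<alpha> < ?N \<alpha>0" for \<alpha>
        using \<alpha>0(2)[of \<alpha>] that by force
    qed (simp_all add: e0 one mpow_zero_index)
    \<comment> \<open>At zero and at \<open>\<delta> i\<close> the two data agree, by normalization
      of \<Lambda> and by the choice of \<mu>, so \<alpha>0 has degree at least two.\<close>
    moreover have "of_real (\<kappa> \<alpha>0) \<noteq> (\<Sum>j\<in>UNIV. c j \<alpha>0)"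
    proof (rule higher_coefficients)
      show "\<alpha>0 \<noteq> (\<lambda>i. 0)" using \<alpha>0(1) by (auto simp: e0 one mpow_zero_index)
      show "\<alpha>0 \<noteq> \<delta> i" for i using \<alpha>0(1) \<mu> by auto
    qed
    ultimately show False using \<alpha>0(1) by simp
  qed
qed

end

text \<open>\<open>V\<^sub>j\<close> is the set of variables on which \<open>t\<^sub>j\<close> depends.\<close>

lemma prod_diagonal_expansion:
  fixes t :: "'p \<Rightarrow> ('i::finite \<Rightarrow> complex) \<Rightarrow> ('i \<Rightarrow> complex) \<Rightarrow> complex"
  assumes fin: "finite J"
    and sums: "\<And>j z w. j \<in> J \<Longrightarrow> z \<in> Y \<Longrightarrow> w \<in> Y \<Longrightarrow>
      ((\<lambda>\<alpha>. of_real (a j \<alpha>) * (mpow z \<alpha> * cnj (mpow w \<alpha>))) has_sum t j z w) UNIV"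
    and nonneg: "\<And>j \<alpha>. 0 \<le> a j \<alpha>"
    and pos: "\<And>j \<alpha>. (\<And>i. \<alpha> i \<noteq> 0 \<Longrightarrow> i \<in> V j) \<Longrightarrow> 0 < a j \<alpha>"
  shows "\<exists>\<kappa>. (\<forall>\<alpha>. 0 \<le> \<kappa> \<alpha>) \<and> (\<forall>\<alpha>. (\<forall>i. \<alpha> i \<noteq> 0 \<longrightarrow> i \<in> (\<Union>j\<in>J. V j)) \<longrightarrow> 0 < \<kappa> \<alpha>) \<and>
    (\<forall>z\<in>Y. \<forall>w\<in>Y. ((\<lambda>\<alpha>. of_real (\<kappa> \<alpha>) * (mpow z \<alpha> * cnj (mpow w \<alpha>))) has_sum (\<Prod>j\<in>J. t j z w)) UNIV)"
    (is "?E J")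
  using fin sums
proof (induction J rule: finite_induct)
  case empty
  let ?\<kappa> = "\<lambda>\<alpha>. if \<alpha> = (\<lambda>i. 0) then 1 else 0 :: real"
  have eq: "(\<lambda>\<alpha>. of_real (?\<kappa> \<alpha>) * (mpow z \<alpha> * cnj (mpow w \<alpha>))) = (\<lambda>\<alpha>. if \<alpha> = (\<lambda>i. 0) then 1 else 0)"
    for z w :: "'i \<Rightarrow> complex"
    by (auto simp: mpow_zero_index)
  have "((\<lambda>\<alpha>. of_real (?\<kappa> \<alpha>) * (mpow z \<alpha> * cnj (mpow w \<alpha>))) has_sum (\<Prod>j\<in>{}. t j z w)) UNIV" for z w
    unfolding eq prod.empty by (rule has_sum_indicator)
  then show ?case by (intro exI[of _ ?\<kappa>]) auto
next
  case (insert j J)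
  have "?E J" by (rule insert.IH) (rule insert.prems, simp)
  then obtain \<kappa> where \<kappa>: "\<forall>\<alpha>. 0 \<le> \<kappa> \<alpha>"
      "\<forall>\<alpha>. (\<forall>i. \<alpha> i \<noteq> 0 \<longrightarrow> i \<in> (\<Union>j\<in>J. V j)) \<longrightarrow> 0 < \<kappa> \<alpha>"
      "\<forall>z\<in>Y. \<forall>w\<in>Y. ((\<lambda>\<alpha>. of_real (\<kappa> \<alpha>) * (mpow z \<alpha> * cnj (mpow w \<alpha>))) has_sum (\<Prod>j\<in>J. t j z w)) UNIV"
    by (elim exE conjE)
  note \<kappa>0 = \<kappa>(1)[rule_format] and \<kappa>pos = \<kappa>(2)[rule_format] and \<kappa>sum = \<kappa>(3)[rule_format]
  let ?le = "\<lambda>\<gamma>. {\<alpha> :: 'i \<Rightarrow> nat. \<forall>i. \<alpha> i \<le> \<gamma> i}"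
  let ?\<kappa> = "\<lambda>\<gamma>. \<Sum>\<alpha>\<in>?le \<gamma>. \<kappa> \<alpha> * a j (\<lambda>i. \<gamma> i - \<alpha> i)"
  have "0 < ?\<kappa> \<gamma>" if \<gamma>: "\<forall>i. \<gamma> i \<noteq> 0 \<longrightarrow> i \<in> (\<Union>j\<in>insert j J. V j)" for \<gamma>
  proof -
    \<comment> \<open>One strictly positive term of the convolution suffices: give the variables in
      \<open>V j\<close> to the factor \<open>j\<close> and the others to the previous
      product.\<close>
    let ?\<alpha> = "\<lambda>i. if i \<in> V j then 0 else \<gamma> i"
    have "0 < \<kappa> ?\<alpha>"
    proof (rule \<kappa>pos)
      show "i \<in> (\<Union>j\<in>J. V j)" if "?\<alpha> i \<noteq> 0" for i
        using \<gamma>[rule_format, of i] that by (auto split: if_splits)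
    qed
    moreover have "0 < a j (\<lambda>i. \<gamma> i - ?\<alpha> i)" by (rule pos) (auto split: if_splits)
    ultimately have "0 < \<kappa> ?\<alpha> * a j (\<lambda>i. \<gamma> i - ?\<alpha> i)" by simp
    also have "\<dots> \<le> ?\<kappa> \<gamma>"
      using \<kappa>0 nonneg by (intro member_le_sum[of ?\<alpha> "?le \<gamma>" "\<lambda>\<alpha>. \<kappa> \<alpha> * a j (\<lambda>i. \<gamma> i - \<alpha> i)"])
        (auto simp: finite_multi_index_le)
    finally show ?thesis .
  qed
  moreover have "0 \<le> ?\<kappa> \<gamma>" for \<gamma> using \<kappa>0 nonneg by (intro sum_nonneg) auto
  moreover have "((\<lambda>\<gamma>. of_real (?\<kappa> \<gamma>) * (mpow z \<gamma> * cnj (mpow w \<gamma>))) has_sum (\<Prod>j\<in>insert j J. t j z w)) UNIV"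
    if "z \<in> Y" "w \<in> Y" for z w
  proof -
    have tj: "((\<lambda>\<alpha>. of_real (a j \<alpha>) * (mpow z \<alpha> * cnj (mpow w \<alpha>))) has_sum t j z w) UNIV"
      using insert.prems that by blast
    have "((\<lambda>\<gamma>. \<Sum>\<alpha>\<in>?le \<gamma>. (of_real (\<kappa> \<alpha>) * (mpow z \<alpha> * cnj (mpow w \<alpha>)))
        * (of_real (a j (\<lambda>i. \<gamma> i - \<alpha> i)) * (mpow z (\<lambda>i. \<gamma> i - \<alpha> i) * cnj (mpow w (\<lambda>i. \<gamma> i - \<alpha> i)))))
        has_sum ((\<Prod>j\<in>J. t j z w) * t j z w)) UNIV"
      by (rule has_sum_cauchy_product[OF \<kappa>sum[OF that] tj])
    also have "(\<lambda>\<gamma>. \<Sum>\<alpha>\<in>?le \<gamma>. (of_real (\<kappa> \<alpha>) * (mpow z \<alpha> * cnj (mpow w \<alpha>)))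
        * (of_real (a j (\<lambda>i. \<gamma> i - \<alpha> i)) * (mpow z (\<lambda>i. \<gamma> i - \<alpha> i) * cnj (mpow w (\<lambda>i. \<gamma> i - \<alpha> i)))))
      = (\<lambda>\<gamma>. of_real (?\<kappa> \<gamma>) * (mpow z \<gamma> * cnj (mpow w \<gamma>)))"
      unfolding of_real_sum sum_distrib_right
    proof (intro ext sum.cong refl)
      fix \<gamma> \<alpha> assume "\<alpha> \<in> ?le \<gamma>"
      then have m: "mpow x \<gamma> = mpow x \<alpha> * mpow x (\<lambda>i. \<gamma> i - \<alpha> i)" for x
        by (simp add: mpow_split)
      show "(of_real (\<kappa> \<alpha>) * (mpow z \<alpha> * cnj (mpow w \<alpha>)))
        * (of_real (a j (\<lambda>i. \<gamma> i - \<alpha> i)) * (mpow z (\<lambda>i. \<gamma> i - \<alpha> i) * cnj (mpow w (\<lambda>i. \<gamma> i - \<alpha> i))))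
        = of_real (\<kappa> \<alpha> * a j (\<lambda>i. \<gamma> i - \<alpha> i)) * (mpow z \<gamma> * cnj (mpow w \<gamma>))"
        unfolding m by (simp add: mult_ac)
    qed
    also have "(\<Prod>j\<in>J. t j z w) * t j z w = (\<Prod>j\<in>insert j J. t j z w)"
      using insert.hyps by (simp add: mult.commute)
    finally show ?thesis .
  qed
  ultimately show ?case by (intro exI[of _ ?\<kappa>]) blast
qed

text \<open>Common form of both products. The map \<open>v\<close> supplies coordinates near the
  base point; every \<open>V j\<close> is the set of all variables for the Schur product and the
  \<open>j\<close>-th block for the tensor product.\<close>

lemma (in cnp_holomorphic) characterization:
  fixes v :: "('i::finite \<Rightarrow> complex) \<Rightarrow> 'a" and a :: "'p \<Rightarrow> ('i \<Rightarrow> nat) \<Rightarrow> real"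
  assumes \<rho>: "0 < \<rho>" and v: "\<And>y. y \<in> polydisc \<rho> \<Longrightarrow> v y \<in> X" "v (\<lambda>i. 0) = p"
    and ball: "0 < \<epsilon>" "ball p \<epsilon> \<subseteq> v ` polydisc \<rho>"
    and sums: "\<And>j z w. z \<in> polydisc \<rho> \<Longrightarrow> w \<in> polydisc \<rho> \<Longrightarrow>
      ((\<lambda>\<alpha>. of_real (a j \<alpha>) * (mpow z \<alpha> * cnj (mpow w \<alpha>))) has_sum t j (v z) (v w)) UNIV"
    and nonneg: "\<And>j \<alpha>. 0 \<le> a j \<alpha>"
    and pos: "\<And>j \<alpha>. (\<And>i. \<alpha> i \<noteq> 0 \<Longrightarrow> i \<in> V j) \<Longrightarrow> 0 < a j \<alpha>"
    and V: "(\<Union>j. V j) = UNIV"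
    and R: "rkhs X (schur_product t) H ip"
  shows "(\<forall>j. \<forall>w\<in>X. fun_on X (\<lambda>z. 1 / t j z w) \<in> multiplier_algebra sc X H ip) \<and>
      (\<forall>\<Lambda>. bounded_functional H ip \<Lambda> \<and> \<Lambda> (fun_on X (\<lambda>z. 1)) = 1 \<longrightarrow>
         (multiplicative_functional H \<Lambda> \<longleftrightarrow>
          (\<forall>w\<in>X. \<Lambda> (kernel_fun X (schur_product t) w) \<noteq> 0 \<and>
             1 / \<Lambda> (kernel_fun X (schur_product t) w) = (\<Prod>j\<in>UNIV. \<Lambda> (fun_on X (\<lambda>z. 1 / t j z w))))))"
proof (intro conjI allI ballI impI)
  interpret rkhs X "schur_product t" H ip by (rule R)
  interpret cnp_space X t p H ip by unfold_locales
  fix j w assume w: "w \<in> X"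
  have "holomorphic_mv sc (fun_on X (\<lambda>z. 1 / t j z w)) X"
    unfolding holomorphic_mv_def
  proof
    fix x assume x: "x \<in> X"
    then obtain D where D: "((\<lambda>z. 1 / t j z w) has_derivative D) (at x)" "\<forall>c v. D (sc c v) = c * D v"
      using inverse_holo[OF w] unfolding holomorphic_mv_def by blast
    have "(fun_on X (\<lambda>z. 1 / t j z w) has_derivative D) (at x)"
      by (rule has_derivative_transform_within_open[OF D(1) X_open x]) (simp add: fun_on_def)
    then show "\<exists>D. (fun_on X (\<lambda>z. 1 / t j z w) has_derivative D) (at x) \<and> (\<forall>c v. D (sc c v) = c * D v)"
      using D(2) by blast
  qed
  then show "fun_on X (\<lambda>z. 1 / t j z w) \<in> multiplier_algebra sc X H ip"
    unfolding multiplier_algebra_def using inverse_multiplier[OF w, of _ j]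
    by (intro CollectI conjI allI impI ballI exI[of _ 2]) (auto simp: fun_on_def)
next
  interpret rkhs X "schur_product t" H ip by (rule R)
  interpret cnp_space X t p H ip by unfold_locales
  fix \<Lambda> assume "bounded_functional H ip \<Lambda> \<and> \<Lambda> (fun_on X (\<lambda>z. 1)) = 1"
  then have L: "bounded_functional H ip \<Lambda>" and one: "\<Lambda> (fun_on X (\<lambda>z. 1)) = 1" by auto
  let ?P = "\<lambda>w. \<Lambda> (kernel_fun X (schur_product t) w) * (\<Prod>j\<in>UNIV. \<Lambda> (fun_on X (\<lambda>z. 1 / t j z w))) = 1"
  have P: "?P w \<longleftrightarrow> \<Lambda> (kernel_fun X (schur_product t) w) \<noteq> 0 \<and>
      1 / \<Lambda> (kernel_fun X (schur_product t) w) = (\<Prod>j\<in>UNIV. \<Lambda> (fun_on X (\<lambda>z. 1 / t j z w)))" for w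
  proof -
    have "x * y = 1 \<longleftrightarrow> x \<noteq> 0 \<and> 1 / x = y" for x y :: complex
      by (metis divide_eq_eq mult.commute mult_zero_left zero_neq_one)
    then show ?thesis .
  qed
  let ?Y = "polydisc \<rho> :: ('i \<Rightarrow> complex) set"
  have "multiplicative_functional H \<Lambda>" if prod: "\<forall>w\<in>X. ?P w"
  proof -
    \<comment> \<open>The image of the polydisc contains a ball around the base point, hence is a
      set of uniqueness.\<close>
    have unique: "f = (\<lambda>x. 0)" if "f \<in> H" "\<And>y. y \<in> ?Y \<Longrightarrow> f (v y) = 0" for f
      by (rule mem_identity[OF R that(1) ball(1)]) (use that(2) ball(2) in blast)
    let ?restr = "restr ?Y v" and ?extend = "extend ?Y v"
    let ?t = "\<lambda>j y y'. t j (v y) (v y')"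
    let ?H = "?restr ` H" and ?ip = "\<lambda>f g. ip (?extend f) (?extend g)"
    obtain \<kappa> where \<kappa>': "\<forall>\<alpha>. 0 < \<kappa> \<alpha>" "\<forall>z\<in>?Y. \<forall>w\<in>?Y.
        ((\<lambda>\<alpha>. of_real (\<kappa> \<alpha>) * (mpow z \<alpha> * cnj (mpow w \<alpha>))) has_sum (\<Prod>j\<in>UNIV. t j (v z) (v w))) UNIV"
      using prod_diagonal_expansion[of UNIV ?Y a ?t V, OF finite sums nonneg pos] V by auto
    have \<kappa>: "0 < \<kappa> \<alpha>" for \<alpha> using \<kappa>'(1) by blast
    have \<kappa>_sum: "((\<lambda>\<alpha>. of_real (\<kappa> \<alpha>) * (mpow z \<alpha> * cnj (mpow w \<alpha>))) has_sum schur_product ?t z w) UNIV"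
      if "z \<in> ?Y" "w \<in> ?Y" for z w
      unfolding schur_product_def using \<kappa>'(2) that by blast
    have Rr: "rkhs ?Y (schur_product ?t) ?H ?ip"
    proof -
      have eq: "schur_product ?t = (\<lambda>y y'. schur_product t (v y) (v y'))"
        by (intro ext) (simp add: schur_product_def)
      show ?thesis unfolding eq by (rule rkhs_restr[where Y = ?Y and v = v, OF v(1) unique])
    qed
    have zero: "(\<lambda>i. 0) \<in> ?Y" using \<rho> by (simp add: polydisc_def)
    interpret D: diag_cnp \<rho> ?t ?H ?ip \<kappa> a
    proof (intro diag_cnp.intro cnp_space.intro diag_space.intro diag_space_axioms.intro diag_cnp_axioms.intro
        cnp_family.intro Rr \<kappa> \<kappa>_sum \<rho> sums zero)
      show "reproducing_kernel ?Y (?t j)" for j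
        by (rule reproducing_kernel_pullback[OF t_psd v(1)])
      show "?t j z w \<noteq> 0" if "z \<in> ?Y" "w \<in> ?Y" for j z w using t_nz v(1) that by blast
      show "?t j z (\<lambda>i. 0) = 1" if "z \<in> ?Y" for j z unfolding v(2) using t_norm v(1) that by blast
      show "reproducing_kernel ?Y (\<lambda>z w. 1 - 1 / ?t j z w)" for j
        by (rule reproducing_kernel_pullback[OF b_psd v(1)])
    qed
    have er: "?extend (?restr f) = f" if "f \<in> H" for f
      using extend_restr[where Y = ?Y and v = v, OF v(1) unique that] .
    have restr_eq: "?restr f = fun_on ?Y (\<lambda>y. f (v y))" for f
      by (rule restr_def[where Y = ?Y and v = v, OF v(1) unique])
    have "multiplicative_functional ?H (\<lambda>f. \<Lambda> (?extend f))"
    proof (rule D.product_imp_multiplicative)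
      show "bounded_functional ?H ?ip (\<lambda>f. \<Lambda> (?extend f))"
        using bounded_functional_restr[where Y = ?Y and v = v, OF v(1) unique L] .
      have "fun_on ?Y (\<lambda>z. 1) = ?restr (fun_on X (\<lambda>z. 1))"
        using v(1) by (auto simp: restr_eq fun_on_def)
      then show "\<Lambda> (?extend (fun_on ?Y (\<lambda>z. 1))) = 1" by (simp add: er one_mem one)
      fix w assume w: "w \<in> ?Y"
      have "kernel_fun ?Y (schur_product ?t) w = ?restr (kernel_fun X (schur_product t) (v w))"
        using v(1) by (auto simp: restr_eq fun_on_def kernel_fun_def schur_product_def)
      moreover have "fun_on ?Y (\<lambda>z. 1 / ?t j z w) = ?restr (fun_on X (\<lambda>z. 1 / t j z (v w)))" for j
        using v(1) by (auto simp: restr_eq fun_on_def)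
      ultimately show "\<Lambda> (?extend (kernel_fun ?Y (schur_product ?t) w))
          * (\<Prod>j\<in>UNIV. \<Lambda> (?extend (fun_on ?Y (\<lambda>z. 1 / ?t j z w)))) = 1"
        using prod v(1)[OF w] by (simp add: er kernel_mem inverse_mem)
    qed
    then show ?thesis
      using multiplicative_restr[where Y = ?Y and v = v, OF v(1) unique] by blast
  qed
  then show "multiplicative_functional H \<Lambda> \<longleftrightarrow>
      (\<forall>w\<in>X. \<Lambda> (kernel_fun X (schur_product t) w) \<noteq> 0 \<and>
         1 / \<Lambda> (kernel_fun X (schur_product t) w) = (\<Prod>j\<in>UNIV. \<Lambda> (fun_on X (\<lambda>z. 1 / t j z w))))"
    unfolding P[symmetric] using multiplicative_imp_product[where \<Lambda> = \<Lambda>, OF _ one] by blast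
qed

section \<open>The two products\<close>

lemma norm_vector_scalar_mult: "norm (c *s v) = norm c * norm (v :: complex^'d)"
  by (simp add: norm_vec_def norm_mult L2_set_right_distrib)

lemma complex_scaling_vec: "complex_scaling ((*s) :: complex \<Rightarrow> complex^'d \<Rightarrow> complex^'d)"
proof (rule complex_scaling.intro)
  fix v :: "complex^'d"
  show "bounded_linear (\<lambda>c. c *s v)"
    by (rule bounded_linear_intro[where K = "norm v"])
      (simp_all add: vec_eq_iff algebra_simps norm_vector_scalar_mult)
qed (auto simp: norm_vector_scalar_mult)

lemma norm_scale_tuple: "norm (scale_tuple c v) = norm c * norm (v :: complex^'d^'p)"
  by (simp add: scale_tuple_def norm_vec_def[where 'b = 'p] norm_vector_scalar_mult L2_set_right_distrib)

lemma complex_scaling_tuple: "complex_scaling (scale_tuple :: complex \<Rightarrow> complex^'d^'p \<Rightarrow> complex^'d^'p)"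
proof (rule complex_scaling.intro)
  fix v :: "complex^'d^'p"
  show "bounded_linear (\<lambda>c. scale_tuple c v)"
  proof (rule bounded_linear_intro[where K = "norm v"])
    show "scale_tuple (x + y) v = scale_tuple x v + scale_tuple y v" for x y
      by (simp add: scale_tuple_def vec_eq_iff distrib_right)
    show "scale_tuple (r *\<^sub>R x) v = r *\<^sub>R scale_tuple x v" for r x
      by (simp add: scale_tuple_def vec_eq_iff)
    show "norm (scale_tuple x v) \<le> norm x * norm v" for x
      by (simp add: norm_scale_tuple)
  qed
  show "scale_tuple 1 v = v" by (simp add: scale_tuple_def)
qed (rule norm_scale_tuple)

lemma mono_power_eq_mpow: "mono_power z \<alpha> = mpow (\<lambda>i. z $ i) \<alpha>"
  by (simp add: mono_power_def mpow_def)

text \<open>With second argument zero only the constant term of the expansion survives, which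
  settles a neighbourhood of the origin; the identity principle extends this to the domain.\<close>

lemma diagonal_kernel_normalized:
  assumes "open \<Omega>" "connected \<Omega>" "0 \<in> \<Omega>" and s: "normalized_diagonal_holomorphic_kernel \<Omega> s" and z: "z \<in> \<Omega>"
  shows "s z 0 = 1"
proof -
  interpret complex_scaling "(*s) :: complex \<Rightarrow> complex^'a \<Rightarrow> complex^'a" by (rule complex_scaling_vec)
  obtain a r where a: "a (\<lambda>i. 0) = 1" and r: "r > 0" "ball 0 r \<subseteq> \<Omega>"
    and sum: "\<And>z w. z \<in> ball 0 r \<Longrightarrow> w \<in> ball 0 r \<Longrightarrow>
      ((\<lambda>\<alpha>. of_real (a \<alpha>) * mono_power z \<alpha> * cnj (mono_power w \<alpha>)) has_sum s z w) UNIV"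
    using s unfolding normalized_diagonal_holomorphic_kernel_def diagonal_expansion_def by blast
  have hol: "holomorphic_mv (*s) (\<lambda>z. s z 0) \<Omega>"
    using s assms(3) unfolding normalized_diagonal_holomorphic_kernel_def by blast
  have "s z 0 - 1 = 0"
  proof (rule identity_principle[OF assms(1,2) _ r(1) assms(3) _ z])
    fix z0 assume "z0 \<in> \<Omega>"
    then obtain R where R: "R > 0" "ball z0 R \<subseteq> \<Omega>" using assms(1) open_contains_ball by blast
    have "(\<lambda>\<zeta>. s (a + \<zeta> *s v) 0 - 1) holomorphic_on {\<zeta>. a + \<zeta> *s v \<in> ball z0 R}" for a v
      using R by (intro holomorphic_on_diff holomorphic_on_const holomorphic_on_line[OF hol]) auto
    then show "\<exists>r>0. ball z0 r \<subseteq> \<Omega> \<and>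
        (\<forall>a v. (\<lambda>\<zeta>. s (a + \<zeta> *s v) 0 - 1) holomorphic_on {\<zeta>. a + \<zeta> *s v \<in> ball z0 r})"
      using R by blast
  next
    fix z :: "complex^'a" assume "z \<in> ball 0 r"
    then have "((\<lambda>\<alpha>. of_real (a \<alpha>) * mono_power z \<alpha> * cnj (mono_power 0 \<alpha>)) has_sum s z 0) UNIV"
      using r by (intro sum) auto
    also have "(\<lambda>\<alpha>. of_real (a \<alpha>) * mono_power z \<alpha> * cnj (mono_power 0 \<alpha>)) = (\<lambda>\<alpha>. if \<alpha> = (\<lambda>i. 0) then 1 else 0)"
      by (auto simp: mono_power_eq_mpow mpow_zero mpow_zero_index a)
    finally have "s z 0 = 1" using has_sum_indicator has_sum_unique by metis
    then show "s z 0 - 1 = 0" by simp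
  qed
  then show ?thesis by simp
qed

lemma norm_vec_less:
  fixes x :: "'d::finite \<Rightarrow> complex"
  assumes "x \<in> polydisc (r / real CARD('d))"
  shows "norm (\<chi> i. x i) < r"
proof -
  have "norm (\<chi> i. x i) \<le> (\<Sum>i\<in>UNIV. norm (x i))"
    by (simp add: norm_vec_def L2_set_le_sum)
  also have "\<dots> < (\<Sum>i\<in>(UNIV :: 'd set). r / real CARD('d))"
    using assms by (intro sum_strict_mono) (auto simp: polydisc_def)
  also have "\<dots> = r" by simp
  finally show ?thesis .
qed

lemma open_tuples_in:
  assumes "open \<Omega>"
  shows "open (tuples_in \<Omega> :: ('a::euclidean_space^'p) set)"
proof -
  have "tuples_in \<Omega> = (\<Inter>j. (\<lambda>z :: 'a^'p. z $ j) -` \<Omega>)" by (auto simp: tuples_in_def)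
  then show ?thesis using assms by (auto intro!: open_INT open_vimage_vec_nth)
qed

text \<open>An open connected set is path connected, and paths can be chosen coordinate by
  coordinate.\<close>

lemma connected_tuples_in:
  fixes \<Omega> :: "'a::euclidean_space set"
  assumes "open \<Omega>" "connected \<Omega>"
  shows "connected (tuples_in \<Omega> :: ('a^'p) set)"
proof (rule path_connected_imp_connected)
  have pc: "path_connected \<Omega>" using assms connected_open_path_connected by blast
  show "path_connected (tuples_in \<Omega> :: ('a^'p) set)"
    unfolding path_connected_def
  proof (intro ballI)
    fix x y :: "'a^'p" assume "x \<in> tuples_in \<Omega>" "y \<in> tuples_in \<Omega>"
    then have "\<forall>j. \<exists>g. path g \<and> path_image g \<subseteq> \<Omega> \<and> pathstart g = x $ j \<and> pathfinish g = y $ j"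
      using pc by (auto simp: path_connected_def tuples_in_def)
    then obtain g where g: "\<And>j. path (g j)" "\<And>j. path_image (g j) \<subseteq> \<Omega>"
      "\<And>j. pathstart (g j) = x $ j" "\<And>j. pathfinish (g j) = y $ j" by metis
    let ?g = "\<lambda>u. \<chi> j. g j u"
    have "path ?g" using g(1) unfolding path_def by (intro continuous_on_vec_lambda)
    moreover have "path_image ?g \<subseteq> tuples_in \<Omega>"
      using g(2) by (auto simp: path_image_def tuples_in_def image_subset_iff)
    moreover have "pathstart ?g = x" "pathfinish ?g = y"
      using g(3,4) by (auto simp: pathstart_def pathfinish_def vec_eq_iff)
    ultimately show "\<exists>g. path g \<and> path_image g \<subseteq> tuples_in \<Omega> \<and> pathstart g = x \<and> pathfinish g = y"
      by blast
  qed
qed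

section \<open>Series in one block of variables, viewed in all variables\<close>

lemma mpow_embedded:
  fixes x :: "'p::finite \<times> 'd::finite \<Rightarrow> complex"
  shows "mpow x (\<lambda>(l, i). if l = j then \<beta> i else 0) = mpow (\<lambda>i. x (j, i)) \<beta>"
proof -
  have "mpow x (\<lambda>(l, i). if l = j then \<beta> i else 0)
      = (\<Prod>l\<in>UNIV. \<Prod>i\<in>UNIV. x (l, i) ^ (if l = j then \<beta> i else 0))"
    unfolding mpow_def prod.cartesian_product UNIV_Times_UNIV by (intro prod.cong) auto
  also have "\<dots> = (\<Prod>l\<in>UNIV. if l = j then mpow (\<lambda>i. x (j, i)) \<beta> else 1)"
    by (intro prod.cong) (auto simp: mpow_def)
  finally show ?thesis by simp
qed

lemma has_sum_embedded:
  fixes x y :: "'p::finite \<times> 'd::finite \<Rightarrow> complex"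
  assumes "((\<lambda>\<beta>. of_real (a \<beta>) * (mpow (\<lambda>i. x (j, i)) \<beta> * cnj (mpow (\<lambda>i. y (j, i)) \<beta>))) has_sum S) UNIV"
  shows "((\<lambda>\<alpha>. of_real (if \<forall>l i. l \<noteq> j \<longrightarrow> \<alpha> (l, i) = 0 then a (\<lambda>i. \<alpha> (j, i)) else 0)
    * (mpow x \<alpha> * cnj (mpow y \<alpha>))) has_sum S) UNIV"
proof -
  let ?h = "\<lambda>\<beta> (l, i). if l = j then \<beta> i else 0 :: nat"
  let ?A = "{\<alpha> :: 'p \<times> 'd \<Rightarrow> nat. \<forall>l i. l \<noteq> j \<longrightarrow> \<alpha> (l, i) = 0}"
  let ?f = "\<lambda>\<alpha>. of_real (if \<forall>l i. l \<noteq> j \<longrightarrow> \<alpha> (l, i) = 0 then a (\<lambda>i. \<alpha> (j, i)) else 0) * (mpow x \<alpha> * cnj (mpow y \<alpha>))"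
  have "((\<lambda>\<beta>. of_real (a \<beta>) * (mpow (\<lambda>i. x (j, i)) \<beta> * cnj (mpow (\<lambda>i. y (j, i)) \<beta>))) has_sum S) UNIV
      \<longleftrightarrow> (?f has_sum S) ?A"
    by (rule has_sum_reindex_bij_witness[where j = ?h and i = "\<lambda>\<alpha> i. \<alpha> (j, i)"])
      (auto simp: mpow_embedded fun_eq_iff)
  then have "(?f has_sum S) ?A" using assms by blast
  then show ?thesis by (rule has_sum_cong_neutral[THEN iffD1, rotated -1]) auto
qed

theorem theorem2:
  fixes \<Omega> :: "(complex^'d) set"
    and s :: "'p::finite \<Rightarrow> complex^'d \<Rightarrow> complex^'d \<Rightarrow> complex"
  assumes "open \<Omega>" and "connected \<Omega>" and "0 \<in> \<Omega>"
    and "\<And>j. normalized_diagonal_holomorphic_kernel \<Omega> (s j)"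
    and "\<And>j. irreducible_kernel \<Omega> (s j)"
    and "\<And>j. complete_pick_kernel \<Omega> (s j)"
  shows "(\<forall>H ip. rkhs \<Omega> (schur_product s) H ip \<longrightarrow>
      (\<forall>j. \<forall>w\<in>\<Omega>. fun_on \<Omega> (\<lambda>z. 1 / s j z w) \<in> multiplier_algebra (*s) \<Omega> H ip) \<and>
      (\<forall>\<Lambda>. bounded_functional H ip \<Lambda> \<and> \<Lambda> (fun_on \<Omega> (\<lambda>z. 1)) = 1 \<longrightarrow>
         (multiplicative_functional H \<Lambda> \<longleftrightarrow>
          (\<forall>w\<in>\<Omega>. \<Lambda> (kernel_fun \<Omega> (schur_product s) w) \<noteq> 0 \<and>
             1 / \<Lambda> (kernel_fun \<Omega> (schur_product s) w) =
               (\<Prod>j\<in>UNIV. \<Lambda> (fun_on \<Omega> (\<lambda>z. 1 / s j z w))))))) \<and>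
    (\<forall>H ip. rkhs (tuples_in \<Omega>) (tensor_product s) H ip \<longrightarrow>
      (\<forall>j. \<forall>w\<in>\<Omega>. fun_on (tuples_in \<Omega>) (\<lambda>z. 1 / s j (z $ j) w)
         \<in> multiplier_algebra scale_tuple (tuples_in \<Omega>) H ip) \<and>
      (\<forall>\<Lambda>. bounded_functional H ip \<Lambda> \<and> \<Lambda> (fun_on (tuples_in \<Omega>) (\<lambda>z. 1)) = 1 \<longrightarrow>
         (multiplicative_functional H \<Lambda> \<longleftrightarrow>
          (\<forall>w\<in>tuples_in \<Omega>. \<Lambda> (kernel_fun (tuples_in \<Omega>) (tensor_product s) w) \<noteq> 0 \<and>
             1 / \<Lambda> (kernel_fun (tuples_in \<Omega>) (tensor_product s) w) =
               (\<Prod>j\<in>UNIV. \<Lambda> (fun_on (tuples_in \<Omega>) (\<lambda>z. 1 / s j (z $ j) (w $ j))))))))"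
proof -
  have s1: "s j z 0 = 1" if "z \<in> \<Omega>" for j z
    by (rule diagonal_kernel_normalized[OF assms(1-4) that])
  have psd: "reproducing_kernel \<Omega> (s j)" and hol: "w \<in> \<Omega> \<Longrightarrow> holomorphic_mv (*s) (\<lambda>z. s j z w) \<Omega>"
    and ex: "\<exists>a. diagonal_expansion \<Omega> (s j) a" for j w
    using assms(4)[of j] unfolding normalized_diagonal_holomorphic_kernel_def by blast+
  have nz: "s j z w \<noteq> 0" if "z \<in> \<Omega>" "w \<in> \<Omega>" for j z w
    using assms(5)[of j] that unfolding irreducible_kernel_def by blast
  have bpsd: "reproducing_kernel \<Omega> (\<lambda>z w. 1 - 1 / s j z w)" for j
    by (rule complete_pick_kernel_psd[OF assms(6,3) s1 nz])
  obtain a where "\<And>j. diagonal_expansion \<Omega> (s j) (a j)" using ex by metis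
  then have apos: "\<And>j \<alpha>. 0 < a j \<alpha>" and "\<exists>r>0. ball 0 r \<subseteq> \<Omega> \<and> (\<forall>z\<in>ball 0 r. \<forall>w\<in>ball 0 r.
      ((\<lambda>\<alpha>. of_real (a j \<alpha>) * mono_power z \<alpha> * cnj (mono_power w \<alpha>)) has_sum s j z w) UNIV)" for j
    unfolding diagonal_expansion_def by blast+
  then have "\<forall>j. \<exists>r. 0 < r \<and> ball 0 r \<subseteq> \<Omega> \<and> (\<forall>z\<in>ball 0 r. \<forall>w\<in>ball 0 r.
      ((\<lambda>\<alpha>. of_real (a j \<alpha>) * mono_power z \<alpha> * cnj (mono_power w \<alpha>)) has_sum s j z w) UNIV)"
    by blast
  from choice[OF this] obtain R where R': "\<forall>j. 0 < R j \<and> ball 0 (R j) \<subseteq> \<Omega> \<and>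
      (\<forall>z\<in>ball 0 (R j). \<forall>w\<in>ball 0 (R j).
      ((\<lambda>\<alpha>. of_real (a j \<alpha>) * mono_power z \<alpha> * cnj (mono_power w \<alpha>)) has_sum s j z w) UNIV)" ..
  have R: "0 < R j" "ball 0 (R j) \<subseteq> \<Omega>" for j using R' by blast+
  have asum: "((\<lambda>\<alpha>. of_real (a j \<alpha>) * mono_power z \<alpha> * cnj (mono_power w \<alpha>)) has_sum s j z w) UNIV"
    if "z \<in> ball 0 (R j)" "w \<in> ball 0 (R j)" for j z w
    using R' that by blast
  define r where "r = Min (range R)"
  have r: "0 < r" "\<And>j. r \<le> R j" using R(1) by (auto simp: r_def)
  \<comment> \<open>The Euclidean norm is at most the sum of the moduli of the coordinates, so
    dividing by the dimension puts the polydisc inside the ball.\<close>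
  define \<rho> where "\<rho> = r / real CARD('d)"
  have \<rho>: "0 < \<rho>" using r(1) by (simp add: \<rho>_def)
  have small: "(\<chi> i. x i) \<in> ball 0 (R j)" if "x \<in> polydisc \<rho>" for x :: "'d \<Rightarrow> complex" and j
    using norm_vec_less[of x r] that r(2)[of j] by (simp add: \<rho>_def)
  have small_\<Omega>: "(\<chi> i. x i) \<in> \<Omega>" if "x \<in> polydisc \<rho>" for x :: "'d \<Rightarrow> complex"
    using small[OF that] R(2) by blast
  have sums: "((\<lambda>\<alpha>. of_real (a j \<alpha>) * (mpow z \<alpha> * cnj (mpow w \<alpha>))) has_sum s j (\<chi> i. z i) (\<chi> i. w i)) UNIV"
    if "z \<in> polydisc \<rho>" "w \<in> polydisc \<rho>" for j z w
    using asum[OF small[OF that(1)] small[OF that(2)], of j] by (simp add: mono_power_eq_mpow mult.assoc)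
  interpret S: cnp_holomorphic \<Omega> s 0 "(*s)"
    by (intro cnp_holomorphic.intro cnp_family.intro cnp_holomorphic_axioms.intro complex_scaling_vec
        assms(1-3) psd nz s1 bpsd hol)
  let ?T = "tuples_in \<Omega> :: (complex^'d^'p) set"
  let ?t = "\<lambda>j z w. s j (z $ j) (w $ j)"
  have T: "z $ j \<in> \<Omega>" if "z \<in> ?T" for z :: "complex^'d^'p" and j
    using that by (simp add: tuples_in_def)
  have thol: "holomorphic_mv scale_tuple (\<lambda>z. s j (z $ j) w) ?T" if w: "w \<in> \<Omega>" for j w
    unfolding holomorphic_mv_def
  proof
    fix x assume "x \<in> ?T"
    then obtain D where D: "((\<lambda>z. s j z w) has_derivative D) (at (x $ j))" "\<And>c v. D (c *s v) = c * D v"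
      using hol[OF w, of j] T unfolding holomorphic_mv_def by blast
    have "((\<lambda>z. s j (z $ j) w) has_derivative (\<lambda>h. D (h $ j))) (at x)"
      by (rule has_derivative_compose[OF bounded_linear_imp_has_derivative[OF bounded_linear_vec_nth] D(1)])
    then show "\<exists>D. ((\<lambda>z. s j (z $ j) w) has_derivative D) (at x) \<and> (\<forall>c v. D (scale_tuple c v) = c * D v)"
      using D(2) by (intro exI[of _ "\<lambda>h. D (h $ j)"]) (simp add: scale_tuple_def)
  qed
  interpret T: cnp_holomorphic ?T ?t 0 scale_tuple
  proof (intro cnp_holomorphic.intro cnp_family.intro cnp_holomorphic_axioms.intro complex_scaling_tuple
      open_tuples_in connected_tuples_in assms(1,2))
    show "0 \<in> ?T" using assms(3) by (simp add: tuples_in_def)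
    show "reproducing_kernel ?T (?t j)" for j by (rule reproducing_kernel_pullback[OF psd T])
    show "?t j z w \<noteq> 0" if "z \<in> ?T" "w \<in> ?T" for j z w using nz T that by blast
    show "?t j z 0 = 1" if "z \<in> ?T" for j z using s1 T that by simp
    show "reproducing_kernel ?T (\<lambda>z w. 1 - 1 / ?t j z w)" for j
      by (rule reproducing_kernel_pullback[OF bpsd T])
    show "holomorphic_mv scale_tuple (\<lambda>z. ?t j z w) ?T" if "w \<in> ?T" for j w
      by (rule thol[OF T[OF that]])
  qed
  have tensor: "tensor_product s = schur_product ?t"
    by (intro ext) (simp add: tensor_product_def schur_product_def)
  have part1: "(\<forall>j. \<forall>w\<in>\<Omega>. fun_on \<Omega> (\<lambda>z. 1 / s j z w) \<in> multiplier_algebra (*s) \<Omega> H ip) \<and>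
      (\<forall>\<Lambda>. bounded_functional H ip \<Lambda> \<and> \<Lambda> (fun_on \<Omega> (\<lambda>z. 1)) = 1 \<longrightarrow>
         (multiplicative_functional H \<Lambda> \<longleftrightarrow>
          (\<forall>w\<in>\<Omega>. \<Lambda> (kernel_fun \<Omega> (schur_product s) w) \<noteq> 0 \<and>
             1 / \<Lambda> (kernel_fun \<Omega> (schur_product s) w) =
               (\<Prod>j\<in>UNIV. \<Lambda> (fun_on \<Omega> (\<lambda>z. 1 / s j z w))))))"
    if "rkhs \<Omega> (schur_product s) H ip" for H ip
  proof (rule S.characterization[where v = "\<lambda>x. \<chi> i. x i" and \<rho> = \<rho> and \<epsilon> = \<rho> and a = a and V = "\<lambda>_. UNIV",
        OF \<rho> small_\<Omega> _ \<rho> _ sums _ _ _ that])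
    show "(ball 0 \<rho> :: (complex^'d) set) \<subseteq> (\<lambda>x. \<chi> i. x i) ` polydisc \<rho>"
    proof
      fix z :: "complex^'d" assume "z \<in> ball 0 \<rho>"
      then have "(\<lambda>i. z $ i) \<in> polydisc \<rho>"
        using Finite_Cartesian_Product.norm_nth_le[of z] by (auto simp: polydisc_def intro: order_le_less_trans)
      then show "z \<in> (\<lambda>x. \<chi> i. x i) ` polydisc \<rho>" by (intro image_eqI[of _ _ "\<lambda>i. z $ i"]) auto
    qed
  qed (use apos less_imp_le in \<open>auto simp: vec_eq_iff\<close>)
  \<comment> \<open>Factor \<open>j\<close> contributes nothing at indices that touch other blocks,
    so its coefficients are positive only for indices supported in block \<open>j\<close>.\<close>
  define a' where "a' = (\<lambda>j \<alpha>. if \<forall>l i. l \<noteq> j \<longrightarrow> \<alpha> (l, i) = 0 then a j (\<lambda>i. \<alpha> (j, i)) else 0)"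
  let ?v = "\<lambda>x :: 'p \<times> 'd \<Rightarrow> complex. \<chi> j. \<chi> i. x (j, i)"
  have slice: "(\<lambda>i. x (j, i)) \<in> polydisc \<rho>" if "x \<in> polydisc \<rho>" for x :: "'p \<times> 'd \<Rightarrow> complex" and j
    using that by (simp add: polydisc_def)
  have part2: "(\<forall>j. \<forall>w\<in>?T. fun_on ?T (\<lambda>z. 1 / ?t j z w) \<in> multiplier_algebra scale_tuple ?T H ip) \<and>
      (\<forall>\<Lambda>. bounded_functional H ip \<Lambda> \<and> \<Lambda> (fun_on ?T (\<lambda>z. 1)) = 1 \<longrightarrow>
         (multiplicative_functional H \<Lambda> \<longleftrightarrow>
          (\<forall>w\<in>?T. \<Lambda> (kernel_fun ?T (schur_product ?t) w) \<noteq> 0 \<and>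
             1 / \<Lambda> (kernel_fun ?T (schur_product ?t) w) = (\<Prod>j\<in>UNIV. \<Lambda> (fun_on ?T (\<lambda>z. 1 / ?t j z w))))))"
    if "rkhs ?T (schur_product ?t) H ip" for H ip
  proof (rule T.characterization[where v = ?v and \<rho> = \<rho> and \<epsilon> = \<rho> and a = a' and V = "\<lambda>j. {j} \<times> UNIV",
        OF \<rho> _ _ \<rho> _ _ _ _ _ that])
    show "?v y \<in> ?T" if "y \<in> polydisc \<rho>" for y
      using small_\<Omega>[OF slice[OF that]] by (simp add: tuples_in_def)
    show "?v (\<lambda>i. 0) = 0" by (simp add: vec_eq_iff)
    show "(ball 0 \<rho> :: (complex^'d^'p) set) \<subseteq> ?v ` polydisc \<rho>"
    proof
      fix z :: "complex^'d^'p" assume z: "z \<in> ball 0 \<rho>"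
      have "norm (z $ j $ i) < \<rho>" for j i
        using Finite_Cartesian_Product.norm_nth_le[of z j] Finite_Cartesian_Product.norm_nth_le[of "z $ j" i] z by simp
      then have "(\<lambda>(j, i). z $ j $ i) \<in> polydisc \<rho>" by (auto simp: polydisc_def)
      then show "z \<in> ?v ` polydisc \<rho>" by (intro image_eqI[of _ _ "\<lambda>(j, i). z $ j $ i"]) (auto simp: vec_eq_iff)
    qed
    show "((\<lambda>\<alpha>. of_real (a' j \<alpha>) * (mpow z \<alpha> * cnj (mpow w \<alpha>))) has_sum ?t j (?v z) (?v w)) UNIV"
      if "z \<in> polydisc \<rho>" "w \<in> polydisc \<rho>" for j z w
      unfolding a'_def using has_sum_embedded[OF sums[OF slice[OF that(1)] slice[OF that(2)]], of j j]
      by simp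
    show "0 \<le> a' j \<alpha>" for j \<alpha> using apos less_imp_le by (auto simp: a'_def)
    show "0 < a' j \<alpha>" if \<alpha>: "\<And>i. \<alpha> i \<noteq> 0 \<Longrightarrow> i \<in> {j} \<times> UNIV" for j \<alpha>
    proof -
      have "\<alpha> (l, i) = 0" if "l \<noteq> j" for l i using \<alpha>[of "(l, i)"] that by auto
      then show ?thesis using apos by (simp add: a'_def)
    qed
    show "(\<Union>j. {j} \<times> UNIV) = UNIV" by auto
  qed
  have mult2: "fun_on ?T (\<lambda>z. 1 / s j (z $ j) w) \<in> multiplier_algebra scale_tuple ?T H ip"
    if "rkhs ?T (schur_product ?t) H ip" "w \<in> \<Omega>" for H ip j w
  proof -
    \<comment> \<open>\<open>part2\<close> is indexed by tuples; the constant tuple has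
      \<open>w\<close> as its \<open>j\<close>-th entry.\<close>
    have "(\<chi> l. w) \<in> ?T" using that(2) by (simp add: tuples_in_def)
    then show ?thesis using part2[OF that(1)] by fastforce
  qed
  show ?thesis
    unfolding tensor using part1 part2 mult2 by blast
qed

end
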